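(* For any rigid group $M\in\mathcal{A}_0$, there exists a group $G\in\mathcal{A}_0$ such that $M\cong\mathrm{Mult}\,G$.
   Context: All groups are additively written Abelian groups. A multiplication on a group $G$ is a homomorphism $G\otimes G\to G$; $\mathrm{Mult}\,G=\mathrm{Hom}(G\otimes G,G)$ is the additive group of all multiplications on $G$. A torsion-free group $G$ of finite rank is almost completely decomposable (ACD) if it contains a completely decomposable subgroup (a direct sum of rank-1 groups) of finite index. Its regulator $\mathrm{Reg}\,G$ is the intersection of all its completely decomposable subgroups of least index; it is a completely decomposable, fully invariant subgroup of finite index. For a type $\tau$, $\mathrm{Reg}_\tau G$ denotes the sum of the rank-1 direct summands of type $\tau$ in a given decomposition of $\mathrm{Reg}\,G$ into rank-1 summands, and $T(G)=\{\tau\mid \mathrm{Reg}_\tau G\neq0\}$ is the set of critical types. $G$ is block-rigid if the types in $T(G)$ are pairwise incomparable (then the $\mathrm{Reg}_\tau G$ are uniquely determined); it is rigid if moreover each $\mathrm{Reg}_\tau G$ ($\tau\in T(G)$) has rank 1. $G$ is of ring type if all types in $T(G)$ are idempotent. $\mathcal{A}_0$ is the class of block-rigid ACD groups of ring type with cyclic quotient $G/\mathrm{Reg}\,G$. *)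

theory Defs
  imports "HOL-Algebra.Free_Abelian_Groups" "HOL-Library.Extended_Nat"
    "HOL-Computational_Algebra.Primes"
begin

text \<open>
  Abelian groups are the commutative groups of HOL-Algebra, hence written multiplicatively:
  \<open>x [^] n\<close> is the multiple \<open>nx\<close>, and the trivial subgroup \<open>0\<close> is \<open>{\<one>}\<close>.
  A subgroup \<open>H\<close> of \<open>G\<close> is turned into a group as \<open>G\<lparr>carrier := H\<rparr>\<close>.
\<close>

section \<open>Tensor products, homomorphism groups and multiplications\<close>

definition tensor_relations ::
    "('a, 'm) monoid_scheme \<Rightarrow> ('b, 'n) monoid_scheme \<Rightarrow> ('a \<times> 'b \<Rightarrow>\<^sub>0 int) set" where
  "tensor_relations G H =
     {frag_of (x \<otimes>\<^bsub>G\<^esub> y, z) - frag_of (x, z) - frag_of (y, z) | x y z.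
        x \<in> carrier G \<and> y \<in> carrier G \<and> z \<in> carrier H} \<union>
     {frag_of (x, y \<otimes>\<^bsub>H\<^esub> z) - frag_of (x, y) - frag_of (x, z) | x y z.
        x \<in> carrier G \<and> y \<in> carrier H \<and> z \<in> carrier H}"

definition tensor_group ::
    "('a, 'm) monoid_scheme \<Rightarrow> ('b, 'n) monoid_scheme \<Rightarrow> ('a \<times> 'b \<Rightarrow>\<^sub>0 int) set monoid" where
  "tensor_group G H =
     (let F = free_Abelian_group (carrier G \<times> carrier H)
      in F Mod generate F (tensor_relations G H))"

text \<open>
  The library set \<^term>\<open>hom G H\<close> leaves the values outside \<^term>\<open>carrier G\<close> arbitrary;
  requiring \<open>extensional\<close> makes each homomorphism a single element.
\<close>

definition hom_group ::
    "('a, 'm) monoid_scheme \<Rightarrow> ('b, 'n) monoid_scheme \<Rightarrow> ('a \<Rightarrow> 'b) monoid" where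
  "hom_group G H =
     \<lparr>carrier = hom G H \<inter> extensional (carrier G),
      monoid.mult = (\<lambda>f g. \<lambda>x\<in>carrier G. f x \<otimes>\<^bsub>H\<^esub> g x),
      one = (\<lambda>x\<in>carrier G. \<one>\<^bsub>H\<^esub>)\<rparr>"

definition Mult :: "('a, 'm) monoid_scheme \<Rightarrow> (('a \<times> 'a \<Rightarrow>\<^sub>0 int) set \<Rightarrow> 'a) monoid" where
  "Mult G = hom_group (tensor_group G G) G"

section \<open>Torsion-free groups and rank\<close>

definition torsion_free :: "('a, 'm) monoid_scheme \<Rightarrow> bool" where
  "torsion_free G \<longleftrightarrow>
     (\<forall>x\<in>carrier G. \<forall>n::nat. n > 0 \<longrightarrow> x [^]\<^bsub>G\<^esub> n = \<one>\<^bsub>G\<^esub> \<longrightarrow> x = \<one>\<^bsub>G\<^esub>)"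

definition independent_in :: "('a, 'm) monoid_scheme \<Rightarrow> 'a set \<Rightarrow> bool" where
  "independent_in G B \<longleftrightarrow> finite B \<and> B \<subseteq> carrier G \<and>
     (\<forall>c::'a \<Rightarrow> int. (\<Otimes>\<^bsub>G\<^esub>b\<in>B. b [^]\<^bsub>G\<^esub> c b) = \<one>\<^bsub>G\<^esub> \<longrightarrow> (\<forall>b\<in>B. c b = 0))"

definition has_rank :: "('a, 'm) monoid_scheme \<Rightarrow> nat \<Rightarrow> bool" where
  "has_rank G n \<longleftrightarrow>
     (\<exists>B. independent_in G B \<and> card B = n) \<and> (\<forall>B. independent_in G B \<longrightarrow> card B \<le> n)"

definition rank_one_group :: "('a, 'm) monoid_scheme \<Rightarrow> bool" where
  "rank_one_group G \<longleftrightarrow> comm_group G \<and> torsion_free G \<and> has_rank G 1"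

section \<open>Types\<close>

text \<open>
  A characteristic assigns to each prime an element of \<open>\<nat> \<union> {\<infinity>}\<close>. It is represented by a function
  on all of \<^typ>\<open>nat\<close> whose values at non-primes are never inspected.
  A type is an equivalence class of characteristics.
\<close>

definition height :: "('a, 'm) monoid_scheme \<Rightarrow> nat \<Rightarrow> 'a \<Rightarrow> enat" where
  "height G p x = (SUP k \<in> {k::nat. \<exists>y\<in>carrier G. y [^]\<^bsub>G\<^esub> (p ^ k) = x}. enat k)"

definition char_equiv :: "(nat \<Rightarrow> enat) \<Rightarrow> (nat \<Rightarrow> enat) \<Rightarrow> bool" where
  "char_equiv \<chi> \<psi> \<longleftrightarrow>
     finite {p. prime p \<and> \<chi> p \<noteq> \<psi> p} \<and> (\<forall>p. prime p \<longrightarrow> (\<chi> p = \<infinity> \<longleftrightarrow> \<psi> p = \<infinity>))"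

text \<open>
  In a group of rank 1 the characteristics of any two non-zero elements are equivalent, so the
  following set is then a single equivalence class. It is only used for such groups.
\<close>

definition type_of :: "('a, 'm) monoid_scheme \<Rightarrow> (nat \<Rightarrow> enat) set" where
  "type_of G = {\<chi>. \<exists>x\<in>carrier G. x \<noteq> \<one>\<^bsub>G\<^esub> \<and> char_equiv (\<lambda>p. height G p x) \<chi>}"

definition type_le :: "(nat \<Rightarrow> enat) set \<Rightarrow> (nat \<Rightarrow> enat) set \<Rightarrow> bool" where
  "type_le \<sigma> \<tau> \<longleftrightarrow> (\<exists>\<chi>\<in>\<sigma>. \<exists>\<psi>\<in>\<tau>. \<forall>p. prime p \<longrightarrow> \<chi> p \<le> \<psi> p)"

definition type_mult ::
    "(nat \<Rightarrow> enat) set \<Rightarrow> (nat \<Rightarrow> enat) set \<Rightarrow> (nat \<Rightarrow> enat) set" where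
  "type_mult \<sigma> \<tau> = {\<phi>. \<exists>\<chi>\<in>\<sigma>. \<exists>\<psi>\<in>\<tau>. char_equiv (\<lambda>p. \<chi> p + \<psi> p) \<phi>}"

definition idempotent_type :: "(nat \<Rightarrow> enat) set \<Rightarrow> bool" where
  "idempotent_type \<tau> \<longleftrightarrow> type_mult \<tau> \<tau> = \<tau>"

lemma char_equiv_refl: "char_equiv \<chi> \<chi>"
  by (simp add: char_equiv_def)

lemma char_equiv_sym: "char_equiv \<chi> \<psi> \<Longrightarrow> char_equiv \<psi> \<chi>"
  by (simp add: char_equiv_def eq_commute)

lemma char_equiv_trans:
  assumes "char_equiv \<chi> \<psi>" "char_equiv \<psi> \<phi>"
  shows "char_equiv \<chi> \<phi>"
proof -
  have "{p. prime p \<and> \<chi> p \<noteq> \<phi> p} \<subseteq> {p. prime p \<and> \<chi> p \<noteq> \<psi> p} \<union> {p. prime p \<and> \<psi> p \<noteq> \<phi> p}"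
    by auto
  with assms show ?thesis
    unfolding char_equiv_def by (meson finite_UnI finite_subset)
qed

lemma char_equiv_add:
  assumes "char_equiv \<chi> \<chi>'" "char_equiv \<psi> \<psi>'"
  shows "char_equiv (\<lambda>p. \<chi> p + \<psi> p) (\<lambda>p. \<chi>' p + \<psi>' p)"
proof -
  have "{p. prime p \<and> \<chi> p + \<psi> p \<noteq> \<chi>' p + \<psi>' p}
      \<subseteq> {p. prime p \<and> \<chi> p \<noteq> \<chi>' p} \<union> {p. prime p \<and> \<psi> p \<noteq> \<psi>' p}"
    by auto
  with assms show ?thesis
    unfolding char_equiv_def by (auto intro: finite_subset simp: plus_eq_infty_iff_enat)
qed

text \<open>The other customary description of idempotent types.\<close>

lemma idempotent_type_iff:
  assumes \<tau>: "\<tau> = {\<chi>. char_equiv \<chi>\<^sub>0 \<chi>}"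
  shows "idempotent_type \<tau> \<longleftrightarrow> (\<exists>\<chi>\<in>\<tau>. \<forall>p. prime p \<longrightarrow> \<chi> p = 0 \<or> \<chi> p = \<infinity>)"
proof
  assume "idempotent_type \<tau>"
  then have "(\<lambda>p. \<chi>\<^sub>0 p + \<chi>\<^sub>0 p) \<in> \<tau>"
    unfolding idempotent_type_def type_mult_def using \<tau> char_equiv_refl by blast
  then have fin: "finite {p. prime p \<and> \<chi>\<^sub>0 p \<noteq> \<chi>\<^sub>0 p + \<chi>\<^sub>0 p}"
    using \<tau> by (simp add: char_equiv_def)
  define \<chi> where "\<chi> = (\<lambda>p. if \<chi>\<^sub>0 p = \<infinity> then \<infinity> else (0::enat))"
  have *: "a \<noteq> 0 \<Longrightarrow> a \<noteq> \<infinity> \<Longrightarrow> a \<noteq> a + a" for a :: enat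
    by (cases a) (auto simp: zero_enat_def)
  have "finite {p. prime p \<and> \<chi>\<^sub>0 p \<noteq> \<chi> p}"
    by (rule finite_subset[OF _ fin]) (auto simp: \<chi>_def dest: * split: if_splits)
  then have "\<chi> \<in> \<tau>"
    using \<tau> by (auto simp: char_equiv_def \<chi>_def)
  then show "\<exists>\<chi>\<in>\<tau>. \<forall>p. prime p \<longrightarrow> \<chi> p = 0 \<or> \<chi> p = \<infinity>"
    by (rule bexI[rotated]) (simp add: \<chi>_def)
next
  assume "\<exists>\<chi>\<in>\<tau>. \<forall>p. prime p \<longrightarrow> \<chi> p = 0 \<or> \<chi> p = \<infinity>"
  then obtain \<chi> where \<chi>: "\<chi> \<in> \<tau>" "\<And>p. prime p \<Longrightarrow> \<chi> p = 0 \<or> \<chi> p = \<infinity>" by blast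
  have "\<chi> p + \<chi> p = \<chi> p" if "prime p" for p
    using \<chi>(2)[OF that] by (elim disjE) simp_all
  then have dbl: "char_equiv (\<lambda>p. \<chi> p + \<chi> p) \<chi>"
    by (simp add: char_equiv_def plus_eq_infty_iff_enat cong: conj_cong)
  have \<tau>': "\<phi> \<in> \<tau> \<longleftrightarrow> char_equiv \<chi> \<phi>" for \<phi>
  proof -
    have "char_equiv \<chi>\<^sub>0 \<chi>" using \<chi>(1) \<tau> by simp
    then show ?thesis
      unfolding \<tau> mem_Collect_eq by (metis char_equiv_sym char_equiv_trans)
  qed
  have "\<phi> \<in> \<tau>" if "\<alpha> \<in> \<tau>" "\<beta> \<in> \<tau>" "char_equiv (\<lambda>p. \<alpha> p + \<beta> p) \<phi>" for \<alpha> \<beta> \<phi>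
  proof -
    have "char_equiv (\<lambda>p. \<chi> p + \<chi> p) (\<lambda>p. \<alpha> p + \<beta> p)"
      using that(1,2) by (simp add: \<tau>' char_equiv_add)
    then have "char_equiv \<chi> (\<lambda>p. \<alpha> p + \<beta> p)"
      by (rule char_equiv_trans[OF char_equiv_sym[OF dbl]])
    then show ?thesis
      unfolding \<tau>' using that(3) by (rule char_equiv_trans)
  qed
  moreover have "\<exists>\<alpha>\<in>\<tau>. \<exists>\<beta>\<in>\<tau>. char_equiv (\<lambda>p. \<alpha> p + \<beta> p) \<phi>" if "\<phi> \<in> \<tau>" for \<phi>
  proof (intro bexI)
    show "char_equiv (\<lambda>p. \<chi> p + \<chi> p) \<phi>"
      using dbl that[unfolded \<tau>'] by (rule char_equiv_trans)
  qed (rule \<chi>(1))+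
  ultimately show "idempotent_type \<tau>"
    unfolding idempotent_type_def type_mult_def by blast
qed

section \<open>Almost completely decomposable groups\<close>

text \<open>
  \<open>G\<close> is the internal direct sum of the members of \<open>D\<close>, all of which are subgroups of rank 1.
  As these are non-trivial, distinct summands are distinct sets, so no separate index set is needed.
\<close>

definition rank_one_decomposition :: "('a, 'm) monoid_scheme \<Rightarrow> 'a set set \<Rightarrow> bool" where
  "rank_one_decomposition G D \<longleftrightarrow>
     (\<forall>A\<in>D. subgroup A G \<and> rank_one_group (G\<lparr>carrier := A\<rparr>)) \<and>
     (\<lambda>x. gfinprod G x D) \<in> iso (sum_group D (\<lambda>A. G\<lparr>carrier := A\<rparr>)) G"

definition completely_decomposable :: "('a, 'm) monoid_scheme \<Rightarrow> bool" where
  "completely_decomposable G \<longleftrightarrow> comm_group G \<and> (\<exists>D. rank_one_decomposition G D)"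

definition cd_subgroups :: "('a, 'm) monoid_scheme \<Rightarrow> 'a set set" where
  "cd_subgroups G =
     {H. subgroup H G \<and> finite (rcosets\<^bsub>G\<^esub> H) \<and> completely_decomposable (G\<lparr>carrier := H\<rparr>)}"

definition ACD_group :: "('a, 'm) monoid_scheme \<Rightarrow> bool" where
  "ACD_group G \<longleftrightarrow>
     comm_group G \<and> torsion_free G \<and> (\<exists>n. has_rank G n) \<and> cd_subgroups G \<noteq> {}"

definition Reg :: "('a, 'm) monoid_scheme \<Rightarrow> 'a set" where
  "Reg G =
     \<Inter>{H \<in> cd_subgroups G. \<forall>K\<in>cd_subgroups G. card (rcosets\<^bsub>G\<^esub> H) \<le> card (rcosets\<^bsub>G\<^esub> K)}"

text \<open>
  A decomposition of the regulator into rank 1 summands is fixed by an arbitrary choice. The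
  critical types and the ranks of the \<open>Reg_part G \<tau>\<close> do not depend on it.
\<close>

definition Reg_decomposition :: "('a, 'm) monoid_scheme \<Rightarrow> 'a set set" where
  "Reg_decomposition G = (SOME D. rank_one_decomposition (G\<lparr>carrier := Reg G\<rparr>) D)"

definition Reg_part :: "('a, 'm) monoid_scheme \<Rightarrow> (nat \<Rightarrow> enat) set \<Rightarrow> 'a set" where
  "Reg_part G \<tau> = generate G (\<Union>{A \<in> Reg_decomposition G. type_of (G\<lparr>carrier := A\<rparr>) = \<tau>})"

definition critical_types :: "('a, 'm) monoid_scheme \<Rightarrow> (nat \<Rightarrow> enat) set set" where
  "critical_types G = {\<tau>. Reg_part G \<tau> \<noteq> {\<one>\<^bsub>G\<^esub>}}"

definition block_rigid :: "('a, 'm) monoid_scheme \<Rightarrow> bool" where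
  "block_rigid G \<longleftrightarrow>
     (\<forall>\<sigma>\<in>critical_types G. \<forall>\<tau>\<in>critical_types G. \<sigma> \<noteq> \<tau> \<longrightarrow> \<not> type_le \<sigma> \<tau> \<and> \<not> type_le \<tau> \<sigma>)"

definition rigid :: "('a, 'm) monoid_scheme \<Rightarrow> bool" where
  "rigid G \<longleftrightarrow>
     block_rigid G \<and> (\<forall>\<tau>\<in>critical_types G. has_rank (G\<lparr>carrier := Reg_part G \<tau>\<rparr>) 1)"

definition of_ring_type :: "('a, 'm) monoid_scheme \<Rightarrow> bool" where
  "of_ring_type G \<longleftrightarrow> (\<forall>\<tau>\<in>critical_types G. idempotent_type \<tau>)"

text \<open>The class \<open>\<A>\<^sub>0\<close>.\<close>

definition class_A0 :: "('a, 'm) monoid_scheme \<Rightarrow> bool" where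
  "class_A0 G \<longleftrightarrow>
     ACD_group G \<and> block_rigid G \<and> of_ring_type G \<and> cyclic_group (G Mod Reg G)"

end

theory Submission
  imports Defs "HOL-Library.Function_Algebras"
begin

text \<open>
  A rigid group \<open>M\<close> in \<open>\<A>\<^sub>0\<close> consists, in suitable coordinates, of the vectors congruent to a multiple of
  \<open>d = (m\<^sub>i / N\<^sub>i)\<^sub>i\<close> modulo \<open>\<Prod>\<^sub>i R\<^sub>i\<close>, where the \<open>R\<^sub>i\<close> are pairwise incomparable subrings of \<open>\<rat>\<close> and the
  fractions are in lowest terms. By incomparability every endomorphism of such a group is
  diagonal, so a multiplication has the form \<open>(x * y)\<^sub>i = a\<^sub>i x\<^sub>i y\<^sub>i\<close>. Writing \<open>a\<^sub>i = N\<^sub>i\<^sup>2 b\<^sub>i\<close> and computing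
  the squares of \<open>d\<close> and of the basis vectors, one finds that the admissible \<open>b\<close> form the group of
  the same shape in which each \<open>m\<^sub>i\<close> is replaced by an inverse modulo \<open>N\<^sub>i\<close>. Hence \<open>M\<close> is the group
  of multiplications of the group \<open>G\<close> obtained from \<open>M\<close> by inverting the \<open>m\<^sub>i\<close>. It has the same
  \<open>R\<^sub>i\<close> and \<open>N\<^sub>i\<close>, and its regulator is again \<open>\<Prod>\<^sub>i R\<^sub>i\<close>.
\<close>


section \<open>Subgroups and subrings of the rationals\<close>

text \<open>The inverses of the m_i come from squaring the adjoined vector. Let G be generated over
  the product of the R_i by d' = (m'_i / N_i), with basis vectors e_i. The products e_i * e_i and d'
  * e_i lie on the i-th axis, so a_i and a_i m'_i / N_i lie in R_i; as m'_i is prime to N_i, so does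
  t_i = a_i / N_i. Moreover d' * d' is congruent to some k d', that is, t_i m'_i m'_i / N_i to k
  m'_i / N_i modulo R_i. Cancelling one m'_i and inverting the other makes b_i = t_i / N_i congruent
  to k m_i / N_i.

  The definitions offer no coordinates: \<open>Reg\<close> is an intersection and
  \<open>Reg_decomposition\<close> a choice, so facts on summands are shown for every decomposition.
  For M, the least index of the regulator yields the condition \<open>pure\<close>; for G,
  \<open>pure\<close> makes the product of the R_i the greatest completely decomposable subgroup of
  finite index. Given the R_i, \<open>pure\<close> depends on the N_i only, so it passes from M to
  G.\<close>

definition add_subgroup :: "'b::ab_group_add set \<Rightarrow> bool" where
  "add_subgroup S \<longleftrightarrow> 0 \<in> S \<and> (\<forall>x\<in>S. \<forall>y\<in>S. x - y \<in> S)"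

lemma add_subgroup_zero: "add_subgroup S \<Longrightarrow> 0 \<in> S"
  by (simp add: add_subgroup_def)

lemma add_subgroup_diff: "add_subgroup S \<Longrightarrow> x \<in> S \<Longrightarrow> y \<in> S \<Longrightarrow> x - y \<in> S"
  by (simp add: add_subgroup_def)

lemma add_subgroup_minus: "add_subgroup S \<Longrightarrow> x \<in> S \<Longrightarrow> - x \<in> S"
  using add_subgroup_diff[of S 0 x] add_subgroup_zero[of S] by simp

lemma add_subgroup_add: "add_subgroup S \<Longrightarrow> x \<in> S \<Longrightarrow> y \<in> S \<Longrightarrow> x + y \<in> S"
  using add_subgroup_diff[of S x "- y"] add_subgroup_minus[of S y] by simp

lemma add_subgroup_sum:
  assumes "add_subgroup S" "\<And>i. i \<in> I \<Longrightarrow> f i \<in> S"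
  shows "sum f I \<in> S"
  using assms(2) by (induction I rule: infinite_finite_induct)
    (auto simp: add_subgroup_zero[OF assms(1)] intro: add_subgroup_add[OF assms(1)])

lemma add_subgroup_of_nat_mult:
  fixes S :: "'b::ring_1 set"
  assumes "add_subgroup S" "x \<in> S"
  shows "of_nat k * x \<in> S"
  by (induction k) (auto simp: algebra_simps add_subgroup_zero add_subgroup_add assms)

lemma add_subgroup_of_int_mult:
  fixes S :: "'b::ring_1 set"
  assumes "add_subgroup S" "x \<in> S"
  shows "of_int k * x \<in> S"
  using add_subgroup_of_nat_mult[OF assms] add_subgroup_minus[OF assms(1)]
  by (cases k rule: int_cases2) auto

text \<open>Bezout. This is how factors prime to a denominator are cancelled throughout:
  \<open>x\<close> is an integral combination of its two multiples.\<close>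

lemma add_subgroup_coprime:
  fixes x :: "'b::ring_1"
  assumes "add_subgroup S" "coprime a b" "of_int a * x \<in> S" "of_int b * x \<in> S"
  shows "x \<in> S"
proof -
  obtain u v where "u * a + v * b = 1"
    using bezout_int[of a b] assms(2) by (auto simp: coprime_iff_gcd_eq_1)
  then have "x = of_int u * (of_int a * x) + of_int v * (of_int b * x)"
    by (metis (no_types, lifting) distrib_right mult.assoc mult_1 of_int_1 of_int_add of_int_mult)
  then show ?thesis
    using assms by (metis add_subgroup_add add_subgroup_of_int_mult)
qed

section \<open>Heights in subgroups of the rationals\<close>

definition rat_height :: "rat set \<Rightarrow> nat \<Rightarrow> rat \<Rightarrow> enat" where
  "rat_height S p q = (SUP k \<in> {k. q / of_nat p ^ k \<in> S}. enat k)"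

text \<open>Dividing fewer times by \<open>p\<close> gives a multiple, so the exponents collected in
  \<open>rat_height\<close> form an initial segment, and bounds on the supremum become memberships
  in \<open>S\<close>.\<close>

lemma rat_height_ge_iff:
  assumes "add_subgroup S" "q \<in> S" "p > 0"
  shows "enat k \<le> rat_height S p q \<longleftrightarrow> q / of_nat p ^ k \<in> S"
proof
  assume "q / of_nat p ^ k \<in> S"
  then show "enat k \<le> rat_height S p q"
    unfolding rat_height_def by (auto intro: SUP_upper)
next
  assume le: "enat k \<le> rat_height S p q"
  show "q / of_nat p ^ k \<in> S"
  proof (cases k)
    case 0
    then show ?thesis using assms by simp
  next
    case (Suc j)
    \<comment> \<open>Being strictly below the supremum yields an attained exponent
      \<open>l > j\<close>, hence \<open>l \<ge> k\<close>.\<close>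
    have "enat j < rat_height S p q"
      using le Suc by (metis Suc_ile_eq)
    then obtain l where l: "q / of_nat p ^ l \<in> S" "j < l"
      unfolding rat_height_def by (auto simp: less_SUP_iff)
    have eq: "q / of_nat p ^ k = of_nat (p ^ (l - k)) * (q / of_nat p ^ l)"
      using l(2) Suc assms(3) by (simp add: field_simps flip: power_add power_Suc)
    then show ?thesis
      by (subst eq) (rule add_subgroup_of_nat_mult[OF assms(1) l(1)])
  qed
qed

lemma enat_eqI: "(\<And>k. enat k \<le> x \<longleftrightarrow> enat k \<le> y) \<Longrightarrow> x = y"
  by (metis enat_ile enat_ord_code(3) enat_ord_simps(1) linorder_linear not_less_eq_eq order_antisym order_refl not_infinity_eq)

lemma not_one_le_enat_iff: "\<not> enat 1 \<le> x \<longleftrightarrow> x = 0"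
  by (cases x) (auto simp: zero_enat_def)

lemma enat_eq_infinity_iff: "x = \<infinity> \<longleftrightarrow> (\<forall>k. enat k \<le> x)"
  by (metis enat_ile enat_ord_code(3) enat_ord_simps(1) not_less_eq_eq order_refl not_infinity_eq)

lemma rat_height_mult_coprime:
  assumes S: "add_subgroup S" "q \<in> S" and p: "prime p" "\<not> int p dvd a"
  shows "rat_height S p (of_int a * q) = rat_height S p q"
proof (rule enat_eqI)
  fix k
  have aq: "of_int a * q \<in> S" using S by (rule add_subgroup_of_int_mult)
  have p0: "p > 0" using p prime_gt_0_nat by blast
  have "of_int a * q / of_nat p ^ k \<in> S \<longleftrightarrow> q / of_nat p ^ k \<in> S"
  proof
    assume l: "of_int a * q / of_nat p ^ k \<in> S"
    have "coprime (int p ^ k) a"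
      using p by (simp add: prime_imp_coprime)
    then show "q / of_nat p ^ k \<in> S"
      by (rule add_subgroup_coprime[OF S(1)]) (use l S p0 in auto)
  next
    assume "q / of_nat p ^ k \<in> S"
    then show "of_int a * q / of_nat p ^ k \<in> S"
      using add_subgroup_of_int_mult[OF S(1), of "q / of_nat p ^ k" a] by simp
  qed
  then show "enat k \<le> rat_height S p (of_int a * q) \<longleftrightarrow> enat k \<le> rat_height S p q"
    using rat_height_ge_iff[OF S p0] rat_height_ge_iff[OF S(1) aq p0] by simp
qed

text \<open>A finite height shifts by the exponent of \<open>p\<close> in \<open>a\<close>; an
  infinite one absorbs the shift.\<close>

lemma rat_height_mult_infinity:
  assumes S: "add_subgroup S" "q \<in> S" and p: "prime p" and a: "a \<noteq> 0"
  shows "rat_height S p (of_int a * q) = \<infinity> \<longleftrightarrow> rat_height S p q = \<infinity>"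
proof -
  have aq: "of_int a * q \<in> S" using S by (rule add_subgroup_of_int_mult)
  have p0: "p > 0" using p prime_gt_0_nat by blast
  obtain s a' where a': "a = int p ^ s * a'" "\<not> int p dvd a'"
    using a p by (metis multiplicity_decompose' not_prime_unit prime_nat_int_transfer)
  have "(\<forall>k. of_int a * q / of_nat p ^ k \<in> S) \<longleftrightarrow> (\<forall>k. q / of_nat p ^ k \<in> S)"
  proof safe
    fix k assume "\<forall>k. q / of_nat p ^ k \<in> S"
    then show "of_int a * q / of_nat p ^ k \<in> S"
      using add_subgroup_of_int_mult[OF S(1), of "q / of_nat p ^ k" a] by simp
  next
    fix k assume "\<forall>k. of_int a * q / of_nat p ^ k \<in> S"
    \<comment> \<open>The extra division by \<open>p ^ s\<close> uses up the \<open>p\<close>-part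
      of \<open>a\<close>; the factor \<open>a'\<close> left over is prime to \<open>p\<close> and
      can be cancelled.\<close>
    then have "of_int a * q / of_nat p ^ (k + s) \<in> S" by blast
    then have 1: "of_int a' * (q / of_nat p ^ k) \<in> S"
      using p0 by (simp add: a'(1) power_add field_simps)
    have "coprime (int p ^ k) a'"
      using p a'(2) by (simp add: prime_imp_coprime)
    then show "q / of_nat p ^ k \<in> S"
      by (rule add_subgroup_coprime[OF S(1)]) (use 1 S p0 in auto)
  qed
  then show ?thesis
    using rat_height_ge_iff[OF S p0] rat_height_ge_iff[OF S(1) aq p0]
    by (simp add: enat_eq_infinity_iff)
qed

text \<open>Heights can change only at the finitely many primes dividing \<open>a\<close>, and
  infinite heights are preserved even there.\<close>

lemma char_equiv_rat_height_mult:
  assumes S: "add_subgroup S" "q \<in> S" and a: "a \<noteq> 0"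
  shows "char_equiv (\<lambda>p. rat_height S p (of_int a * q)) (\<lambda>p. rat_height S p q)"
proof -
  have "{p. prime p \<and> rat_height S p (of_int a * q) \<noteq> rat_height S p q}
      \<subseteq> {p. int p dvd a}"
    using rat_height_mult_coprime[OF S] by blast
  moreover have "finite {p. int p dvd a}"
  proof -
    have "{p. int p dvd a} = {p. p dvd nat \<bar>a\<bar>}" by auto
    moreover have "finite {p. p dvd nat \<bar>a\<bar>}" using a by (intro finite_divisors_nat) simp
    ultimately show ?thesis by simp
  qed
  ultimately show ?thesis
    unfolding char_equiv_def using rat_height_mult_infinity[OF S _ a] finite_subset by blast
qed

lemma rat_common_multiple:
  fixes q r :: rat
  assumes "q \<noteq> 0" "r \<noteq> 0"
  obtains a b where "a \<noteq> 0" "b \<noteq> 0" "of_int a * q = of_int b * r"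
proof -
  obtain u v where q: "q = of_int u / of_int v" "v > 0"
    by (metis Fract_of_int_quotient Rat_cases)
  obtain s t where r: "r = of_int s / of_int t" "t > 0"
    by (metis Fract_of_int_quotient Rat_cases)
  show thesis
    by (rule that[of "s * v" "u * t"]) (use assms q r in auto)
qed

lemma char_equiv_rat_height:
  assumes S: "add_subgroup S" "q \<in> S" "r \<in> S" and "q \<noteq> 0" "r \<noteq> 0"
  shows "char_equiv (\<lambda>p. rat_height S p q) (\<lambda>p. rat_height S p r)"
proof -
  obtain a b where ab: "a \<noteq> 0" "b \<noteq> 0" "of_int a * q = of_int b * r"
    using rat_common_multiple assms by metis
  show ?thesis
    using char_equiv_rat_height_mult[OF S(1,2) ab(1)] char_equiv_rat_height_mult[OF S(1,3) ab(2)] ab(3)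
    by (metis char_equiv_sym char_equiv_trans)
qed

section \<open>Subrings of the rationals and the primes they invert\<close>

definition rat_subring :: "rat set \<Rightarrow> bool" where
  "rat_subring R \<longleftrightarrow> add_subgroup R \<and> 1 \<in> R \<and> (\<forall>x\<in>R. \<forall>y\<in>R. x * y \<in> R)"

lemma rat_subringD:
  assumes "rat_subring R"
  shows "add_subgroup R" "1 \<in> R" "\<And>x y. x \<in> R \<Longrightarrow> y \<in> R \<Longrightarrow> x * y \<in> R"
  using assms by (auto simp: rat_subring_def)

lemma rat_subring_of_int: "rat_subring R \<Longrightarrow> of_int k \<in> R"
  using add_subgroup_of_int_mult[of R 1 k] by (simp add: rat_subring_def)

lemma rat_subring_power: "rat_subring R \<Longrightarrow> x \<in> R \<Longrightarrow> x ^ k \<in> R"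
  by (induction k) (auto simp: rat_subringD)

text \<open>The characteristic of 1 in a subring: once \<open>1 / p\<close> belongs to the ring, so
  do all its powers, hence no value besides 0 and infinity occurs.\<close>

definition ring_char :: "rat set \<Rightarrow> nat \<Rightarrow> enat" where
  "ring_char R p = (if 1 / of_nat p \<in> R then \<infinity> else 0)"

lemma rat_height_one:
  assumes R: "rat_subring R" and p: "prime p"
  shows "rat_height R p 1 = ring_char R p"
proof -
  have p0: "p > 0" using p prime_gt_0_nat by blast
  note ge = rat_height_ge_iff[OF rat_subringD(1,2)[OF R] p0]
  show ?thesis
  proof (cases "1 / of_nat p \<in> R")
    case True
    then have "(1 / of_nat p) ^ k \<in> R" for k
      using R rat_subring_power by blast
    then show ?thesis
      using True ge by (simp add: enat_eq_infinity_iff ring_char_def power_one_over)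
  next
    case False
    then have "\<not> enat 1 \<le> rat_height R p 1"
      using ge[of 1] by simp
    then show ?thesis using False
      unfolding not_one_le_enat_iff by (simp add: ring_char_def)
  qed
qed

lemma unit_fraction_mem:
  assumes "add_subgroup R" "1 \<in> R" "of_int u / of_int v \<in> R" "coprime u v" "v \<noteq> 0"
  shows "1 / of_int v \<in> (R :: rat set)"
  by (rule add_subgroup_coprime[OF assms(1,4)]) (use assms in auto)

lemma rat_lowest_terms:
  fixes q :: rat
  obtains u v :: int where "v > 0" "coprime u v" "q = of_int u / of_int v"
  by (metis Fract_of_int_quotient Rat_cases)

lemma nat_prime_induct [consumes 1, case_names 1 prime]:
  assumes "v > 0" "P (1::nat)" "\<And>p v. prime p \<Longrightarrow> v > 0 \<Longrightarrow> P v \<Longrightarrow> P (p * v)"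
  shows "P v"
  using assms(1)
proof (induction v rule: less_induct)
  case (less v)
  show ?case
  proof (cases "v = 1")
    case False
    then obtain p w where p: "prime p" "v = p * w"
      by (metis prime_factor_nat dvdE)
    then have "w < v" "w > 0"
      using less.prems prime_gt_1_nat[OF p(1)] by auto
    then show ?thesis
      using less.IH assms(3) p by blast
  qed (use assms(2) in simp)
qed

text \<open>
  A group containing 1 all of whose heights of 1 are 0 or infinite is a ring: writing an element as
  \<open>u / v\<close> in lowest terms, 1 is divisible by every power of every prime dividing \<open>v\<close>.
\<close>

lemma rat_subringI:
  assumes S: "add_subgroup S" "1 \<in> S"
    and ht: "\<And>p. prime p \<Longrightarrow> rat_height S p 1 = 0 \<or> rat_height S p 1 = \<infinity>"
  shows "rat_subring S"
proof -
  have pdiv: "y / of_nat p \<in> S" if p: "prime p" "1 / of_nat p \<in> S" and y: "y \<in> S" for p y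
  proof -
    have p0: "p > 0" using p prime_gt_0_nat by blast
    note ge = rat_height_ge_iff[OF S p0]
    have "rat_height S p 1 = \<infinity>"
      using ht[OF p(1)] ge[of 1] p(2) not_one_le_enat_iff[of "rat_height S p 1"] by simp
    then have pow: "1 / of_nat p ^ k \<in> S" for k
      using ge[of k] by simp
    obtain z c where zc: "c > 0" "coprime z c" "y = of_int z / of_int c"
      by (rule rat_lowest_terms)
    obtain s c' where c': "c = int p ^ s * c'" "\<not> int p dvd c'"
      using zc(1) p(1) by (metis multiplicity_decompose' not_prime_unit prime_nat_int_transfer less_irrefl)
    \<comment> \<open>With the \<open>p\<close>-part split off the denominator of \<open>y\<close>,
      the \<open>c'\<close>-fold of \<open>y / p\<close> is an integral multiple of
      \<open>1 / p ^ Suc s\<close>. Its \<open>p\<close>-fold is \<open>y\<close>, and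
      \<open>c'\<close> is prime to \<open>p\<close>.\<close>
    have "of_int c' * (y / of_nat p) = of_int z * (1 / of_nat p ^ Suc s)"
      using zc c' p0 by (auto simp: field_simps)
    then have 1: "of_int c' * (y / of_nat p) \<in> S"
      using add_subgroup_of_int_mult[OF S(1) pow] by metis
    have "coprime c' (int p)"
      using c'(2) p(1) by (metis coprime_commute prime_imp_coprime prime_nat_int_transfer)
    then show ?thesis
      by (rule add_subgroup_coprime[OF S(1)]) (use 1 y p0 in auto)
  qed
  have vdiv: "1 / of_nat v \<in> S \<longrightarrow> (\<forall>y\<in>S. y / of_nat v \<in> S)" if "v > 0" for v :: nat
    using that
  proof (induction v rule: nat_prime_induct)
    case (prime p v)
    show ?case
    proof (intro impI ballI)
      fix y assume 1: "1 / of_nat (p * v) \<in> S" and y: "y \<in> S"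
      have p0: "p > 0" using prime prime_gt_0_nat by blast
      have "1 / of_nat p = of_nat v * (1 / of_nat (p * v) :: rat)" using prime by simp
      then have "1 / of_nat p \<in> S" using add_subgroup_of_nat_mult[OF S(1) 1] by metis
      moreover have "1 / of_nat v = of_nat p * (1 / of_nat (p * v) :: rat)" using p0 by simp
      then have "1 / of_nat v \<in> S" using add_subgroup_of_nat_mult[OF S(1) 1] by metis
      ultimately have "(y / of_nat p) / of_nat v \<in> S"
        using prime pdiv y by blast
      then show "y / of_nat (p * v) \<in> S" by (simp add: mult.commute)
    qed
  qed simp
  have "x * y \<in> S" if "x \<in> S" "y \<in> S" for x y
  proof -
    obtain u v where uv: "v > 0" "coprime u v" "x = of_int u / of_int v"
      by (rule rat_lowest_terms)
    have "1 / of_int v \<in> S"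
      using unit_fraction_mem[OF S] uv that by auto
    then have "1 / of_nat (nat v) \<in> S" using uv(1) by simp
    then have "y / of_nat (nat v) \<in> S"
      using vdiv[of "nat v"] uv(1) that by auto
    then have "y / of_int v \<in> S" using uv(1) by simp
    then have "of_int u * (y / of_int v) \<in> S" by (rule add_subgroup_of_int_mult[OF S(1)])
    moreover have "x * y = of_int u * (y / of_int v)" using uv(3) by simp
    ultimately show ?thesis by (simp only:)
  qed
  then show ?thesis using S by (simp add: rat_subring_def)
qed

lemma rat_subring_unit_fraction:
  assumes R: "rat_subring R" and "v > 0" "\<And>p. prime p \<Longrightarrow> p dvd v \<Longrightarrow> 1 / of_nat p \<in> R"
  shows "1 / of_nat v \<in> R"
  using assms(2,3)
proof (induction v rule: nat_prime_induct)
  case (prime p v)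
  then have "(1 / of_nat p) * (1 / of_nat v) \<in> R"
    by (intro rat_subringD(3)[OF R]) auto
  then show ?case by simp
qed (simp add: rat_subringD[OF R])

lemma rat_subring_prime_denominator:
  assumes R: "rat_subring R" and p: "prime p" "int p dvd v" and "coprime u v" "of_int u / of_int v \<in> R" "v \<noteq> 0"
  shows "1 / of_nat p \<in> R"
proof -
  have 1: "1 / of_int v \<in> R"
    using unit_fraction_mem[OF rat_subringD(1,2)[OF R]] assms by blast
  obtain w where "v = int p * w" using p by auto
  then have "1 / of_nat p = of_int w * (1 / of_int v :: rat)" using assms by auto
  then show ?thesis using add_subgroup_of_int_mult[OF rat_subringD(1)[OF R] 1] by metis
qed

text \<open>A subring of the rationals is determined by the primes it inverts, since
  \<open>u / v\<close> in lowest terms requires exactly the primes dividing \<open>v\<close>.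
  Inclusion of rings thereby becomes a comparison of characteristics.\<close>

lemma rat_subring_subsetI:
  assumes R: "rat_subring R" and S: "rat_subring S"
    and "\<And>p. prime p \<Longrightarrow> 1 / of_nat p \<in> R \<Longrightarrow> 1 / of_nat p \<in> S"
  shows "R \<subseteq> S"
proof
  fix x assume x: "x \<in> R"
  obtain u v where uv: "v > 0" "coprime u v" "x = of_int u / of_int v"
    by (rule rat_lowest_terms)
  have "1 / of_nat (nat v) \<in> S"
  proof (rule rat_subring_unit_fraction[OF S])
    fix p assume "prime p" "p dvd nat v"
    then have "int p dvd v" using uv(1) by (simp add: int_dvd_int_iff[symmetric] del: int_dvd_int_iff)
    then show "1 / of_nat p \<in> S"
      using rat_subring_prime_denominator[OF R \<open>prime p\<close>] assms(3) uv x \<open>prime p\<close> by auto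
  qed (use uv in simp)
  then show "x \<in> S"
    using add_subgroup_of_int_mult[OF rat_subringD(1)[OF S], of "1 / of_nat (nat v)" u] uv by simp
qed

text \<open>If \<open>R\<close> inverts \<open>p\<close>, unlimited powers of \<open>1 / p\<close>
  are available to beat the \<open>p\<close>-part of \<open>z\<close>, so \<open>S\<close> inverts
  \<open>p\<close> too. This is the bridge from nonzero matrix entries of endomorphisms to
  comparability of the rings.\<close>

lemma rat_subring_subset_if_scaled:
  assumes R: "rat_subring R" and S: "rat_subring S" and z: "z \<noteq> 0"
    and zR: "\<And>r. r \<in> R \<Longrightarrow> z * r \<in> S"
  shows "R \<subseteq> S"
proof (rule rat_subring_subsetI[OF R S])
  fix p assume p: "prime p" "1 / of_nat p \<in> R"
  have p0: "p > 0" using p prime_gt_0_nat by blast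
  obtain a b where ab: "b > 0" "coprime a b" "z = of_int a / of_int b"
    by (rule rat_lowest_terms)
  have a0: "a \<noteq> 0" using z ab by auto
  obtain s a' where a': "a = int p ^ s * a'" "\<not> int p dvd a'"
    using a0 p(1) by (metis multiplicity_decompose' not_prime_unit prime_nat_int_transfer)
  \<comment> \<open>One power more than the exponent of \<open>p\<close> in the numerator: after
    clearing \<open>b\<close>, what remains is \<open>a' / p\<close> with \<open>a'\<close> prime to
    \<open>p\<close>.\<close>
  have "z * (1 / of_nat p) ^ Suc s \<in> S"
    by (intro zR rat_subring_power[OF R] p)
  then have "of_int b * (z * (1 / of_nat p) ^ Suc s) \<in> S"
    by (rule add_subgroup_of_int_mult[OF rat_subringD(1)[OF S]])
  then have 1: "of_int a' * (1 / of_nat p) \<in> S"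
    using ab p0 by (simp add: a' power_one_over field_simps)
  have "coprime a' (int p)"
    using a'(2) p(1) by (metis coprime_commute prime_imp_coprime prime_nat_int_transfer)
  then show "1 / of_nat p \<in> S"
    by (rule add_subgroup_coprime[OF rat_subringD(1)[OF S]])
      (use 1 p0 rat_subringD(2)[OF S] in auto)
qed

text \<open>At each of the finitely many offending primes the element is divided by the full power
  allowed by its height; the number of such primes drops each time.\<close>

lemma finite_heights_reduce:
  assumes "add_subgroup S" "q \<in> S" "q \<noteq> 0"
    and "finite {p. prime p \<and> rat_height S p q \<noteq> 0 \<and> rat_height S p q \<noteq> \<infinity>}"
  shows "\<exists>e\<in>S. e \<noteq> 0 \<and> (\<forall>p. prime p \<longrightarrow> rat_height S p e = 0 \<or> rat_height S p e = \<infinity>)"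
  using assms(2-)
proof (induction "card {p. prime p \<and> rat_height S p q \<noteq> 0 \<and> rat_height S p q \<noteq> \<infinity>}" arbitrary: q rule: less_induct)
  case less
  let ?B = "\<lambda>q. {p. prime p \<and> rat_height S p q \<noteq> 0 \<and> rat_height S p q \<noteq> \<infinity>}"
  show ?case
  proof (cases "?B q = {}")
    case True
    then show ?thesis using less.prems by blast
  next
    case False
    then obtain p where p: "prime p" "rat_height S p q \<noteq> 0" "rat_height S p q \<noteq> \<infinity>" by blast
    then obtain k where k: "rat_height S p q = enat k" by auto
    have p0: "p > 0" using p prime_gt_0_nat by blast
    note ge = rat_height_ge_iff[OF assms(1) less.prems(1) p0]
    \<comment> \<open>Dividing out the exact height leaves height 0 at \<open>p\<close>, and heights
      at other primes are unaffected because \<open>p ^ k\<close> is prime to them.\<close>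
    define r where "r = q / of_nat p ^ k"
    have r: "r \<in> S" using ge[of k] k r_def by simp
    have q: "q = of_int (int p ^ k) * r" using p0 by (simp add: r_def)
    have r0: "r \<noteq> 0" using less.prems(2) q by auto
    have "\<not> enat 1 \<le> rat_height S p r"
    proof
      assume "enat 1 \<le> rat_height S p r"
      then have "r / of_nat p ^ 1 \<in> S" using rat_height_ge_iff[OF assms(1) r p0] by blast
      then have "enat (Suc k) \<le> rat_height S p q" using ge[of "Suc k"] by (simp add: r_def field_simps)
      then show False using k by simp
    qed
    then have hp: "rat_height S p r = 0"
      unfolding not_one_le_enat_iff .
    have other: "rat_height S p' q = rat_height S p' r" if "prime p'" "p' \<noteq> p" for p'
    proof -
      have "\<not> int p' dvd int p ^ k"
        using that p(1) by (metis int_dvd_int_iff of_nat_power prime_dvd_power primes_dvd_imp_eq)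
      then show ?thesis
        unfolding q using rat_height_mult_coprime[OF assms(1) r that(1)] by blast
    qed
    have sub: "?B r \<subset> ?B q"
    proof (rule psubsetI)
      show "?B r \<subseteq> ?B q"
      proof
        fix p' assume p': "p' \<in> ?B r"
        then have "p' \<noteq> p" using hp by auto
        then show "p' \<in> ?B q" using p' other[of p'] by simp
      qed
      show "?B r \<noteq> ?B q" using hp p by blast
    qed
    from sub have "card (?B r) < card (?B q)"
      by (rule psubset_card_mono[OF less.prems(3)])
    moreover have "finite (?B r)"
      by (rule finite_subset[OF psubset_imp_subset[OF sub] less.prems(3)])
    ultimately show ?thesis
      by (intro less.hyps[of r] r r0)
  qed
qed

section \<open>Groups of rank 1 and their types\<close>

definition additive_group :: "'b::ab_group_add set \<Rightarrow> 'b monoid" where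
  "additive_group S = \<lparr>carrier = S, monoid.mult = (+), one = 0\<rparr>"

lemma additive_group_simps [simp]:
  "carrier (additive_group S) = S"
  "x \<otimes>\<^bsub>additive_group S\<^esub> y = x + y"
  "\<one>\<^bsub>additive_group S\<^esub> = 0"
  "(additive_group S)\<lparr>carrier := H\<rparr> = additive_group H"
  by (simp_all add: additive_group_def)

lemma comm_group_additive_group: "add_subgroup S \<Longrightarrow> comm_group (additive_group S)"
  by (rule comm_groupI)
    (auto simp: add_subgroup_zero add_subgroup_add algebra_simps intro: bexI[of _ "- x" for x] add_subgroup_minus)

lemma inv_additive_group:
  assumes "add_subgroup S" "x \<in> S"
  shows "inv\<^bsub>additive_group S\<^esub> x = - x"
proof -
  interpret comm_group "additive_group S" using assms by (simp add: comm_group_additive_group)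
  show ?thesis by (rule inv_equality) (use assms in \<open>simp_all add: add_subgroup_minus\<close>)
qed

lemma nat_pow_additive_group:
  fixes x :: "'b::ring_1"
  shows "x [^]\<^bsub>additive_group S\<^esub> (k::nat) = of_nat k * x"
  by (induction k) (simp_all add: algebra_simps nat_pow_def)

lemma int_pow_additive_group:
  fixes x :: "'b::ring_1"
  assumes "add_subgroup S" "x \<in> S"
  shows "x [^]\<^bsub>additive_group S\<^esub> (k::int) = of_int k * x"
proof -
  have "inv\<^bsub>additive_group S\<^esub> (of_nat n * x) = - (of_nat n * x)" for n
    by (rule inv_additive_group[OF assms(1) add_subgroup_of_nat_mult[OF assms]])
  then show ?thesis
    by (cases k rule: int_cases2) (simp_all add: int_pow_def2 nat_pow_additive_group)
qed

lemma finprod_additive_group: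
  assumes "add_subgroup S" "\<And>i. i \<in> I \<Longrightarrow> f i \<in> S"
  shows "finprod (additive_group S) f I = sum f I"
proof -
  interpret comm_group "additive_group S" using assms by (simp add: comm_group_additive_group)
  show ?thesis using assms(2)
  proof (induction I rule: infinite_finite_induct)
    case (insert i I)
    then show ?case by (subst finprod_insert) auto
  qed simp_all
qed

lemma subgroup_additive_group_iff:
  assumes "add_subgroup S"
  shows "subgroup H (additive_group S) \<longleftrightarrow> H \<subseteq> S \<and> add_subgroup H"
proof -
  interpret comm_group "additive_group S" using assms by (simp add: comm_group_additive_group)
  show ?thesis
  proof
    assume "subgroup H (additive_group S)"
    then interpret H: subgroup H "additive_group S" .
    have "H \<subseteq> S" using H.subset by simp
    moreover have "x - y \<in> H" if "x \<in> H" "y \<in> H" for x y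
      using H.m_closed[OF that(1) H.m_inv_closed[OF that(2)]] \<open>H \<subseteq> S\<close> that
      by (simp add: inv_additive_group assms subset_iff)
    ultimately show "H \<subseteq> S \<and> add_subgroup H"
      using H.one_closed by (simp add: add_subgroup_def)
  next
    assume "H \<subseteq> S \<and> add_subgroup H"
    then show "subgroup H (additive_group S)"
      by unfold_locales
        (auto simp: add_subgroup_add add_subgroup_zero add_subgroup_minus inv_additive_group assms subset_iff)
  qed
qed

lemma add_subgroup_UNIV [simp]: "add_subgroup UNIV"
  by (simp add: add_subgroup_def)

abbreviation rat_group :: "rat monoid" where "rat_group \<equiv> additive_group UNIV"

lemma group_hom_additive_group:
  assumes "comm_group A" "f \<in> hom A (additive_group UNIV)"
  shows "group_hom A (additive_group UNIV) f"
  using assms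
  by (simp add: group_hom_def group_hom_axioms_def comm_group.axioms(2) comm_group_additive_group)

lemma hom_additive_pow:
  fixes f :: "'a \<Rightarrow> 'b::ring_1"
  assumes "comm_group A" "f \<in> hom A (additive_group UNIV)" "x \<in> carrier A"
  shows "f (x [^]\<^bsub>A\<^esub> (k::nat)) = of_nat k * f x" "f (x [^]\<^bsub>A\<^esub> (l::int)) = of_int l * f x"
proof -
  interpret group_hom A "additive_group UNIV" f by (rule group_hom_additive_group[OF assms(1,2)])
  show "f (x [^]\<^bsub>A\<^esub> (k::nat)) = of_nat k * f x"
    using hom_nat_pow[OF assms(3)] by (simp add: nat_pow_additive_group)
  show "f (x [^]\<^bsub>A\<^esub> (l::int)) = of_int l * f x"
    using hom_int_pow[OF assms(3)] by (simp add: int_pow_additive_group)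
qed

lemma add_subgroup_hom_image:
  assumes "comm_group A" "f \<in> hom A (additive_group UNIV)"
  shows "add_subgroup (f ` carrier A)"
proof -
  interpret group_hom A "additive_group UNIV" f by (rule group_hom_additive_group[OF assms(1,2)])
  show ?thesis
    using img_is_subgroup by (simp add: subgroup_additive_group_iff)
qed

lemma add_subgroup_vimage:
  assumes "comm_group A" "f \<in> hom A (additive_group UNIV)" "add_subgroup S"
  shows "subgroup {x \<in> carrier A. f x \<in> S} A"
proof -
  interpret group_hom A "additive_group UNIV" f by (rule group_hom_additive_group[OF assms(1,2)])
  show ?thesis
    by unfold_locales
      (use assms(3) in \<open>auto simp: add_subgroup_add add_subgroup_zero add_subgroup_minus inv_additive_group hom_mult\<close>)
qed

lemma torsion_free_int_pow:
  assumes "comm_group A" "torsion_free A" "x \<in> carrier A" "x [^]\<^bsub>A\<^esub> (k::int) = \<one>\<^bsub>A\<^esub>" "k \<noteq> 0"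
  shows "x = \<one>\<^bsub>A\<^esub>"
proof -
  interpret comm_group A by fact
  have "x [^]\<^bsub>A\<^esub> (nat \<bar>k\<bar>) = \<one>\<^bsub>A\<^esub>"
  proof (cases k rule: int_cases2)
    case (nonneg n)
    then show ?thesis using assms(4) by (simp add: int_pow_int)
  next
    case (nonpos n)
    then have "inv\<^bsub>A\<^esub> (x [^]\<^bsub>A\<^esub> n) = \<one>\<^bsub>A\<^esub>" using assms(3,4) by (simp add: int_pow_neg_int)
    then show ?thesis using assms(3) nonpos by (simp add: inv_eq_1_iff)
  qed
  then show ?thesis
    using assms(2,3,5) unfolding torsion_free_def by (metis zero_less_abs_iff zero_less_nat_eq)
qed

lemma independent_singleton:
  assumes "comm_group A" "torsion_free A" "x \<in> carrier A" "x \<noteq> \<one>\<^bsub>A\<^esub>"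
  shows "independent_in A {x}"
proof -
  interpret comm_group A by fact
  show ?thesis
    unfolding independent_in_def using assms torsion_free_int_pow[OF assms(1-3)]
    by (auto simp: finprod_singleton)
qed

section \<open>Rank 1 groups as subgroups of the rationals\<close>

lemma rank_one_groupD:
  assumes "rank_one_group A"
  shows "comm_group A" "torsion_free A" "has_rank A 1"
  using assms by (auto simp: rank_one_group_def)

text \<open>Against a fixed independent element \<open>a\<close>, rank 1 gives each \<open>x\<close>
  a relation (additively) \<open>d x = c a\<close> with \<open>d\<close> nonzero, and
  \<open>x\<close> is sent to \<open>c / d\<close>.\<close>

lemma rank_one_group_embedding:
  assumes A: "rank_one_group A"
  obtains f where "f \<in> hom A rat_group" "inj_on f (carrier A)" "\<exists>x\<in>carrier A. f x \<noteq> 0"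
proof -
  interpret comm_group A using rank_one_groupD(1)[OF A] .
  note tf = torsion_free_int_pow[OF rank_one_groupD(1,2)[OF A]]
  obtain B where "independent_in A B" "card B = 1"
    using rank_one_groupD(3)[OF A] unfolding has_rank_def by blast
  then obtain a where a: "independent_in A {a}" by (metis card_1_singletonE)
  have ac [simp]: "a \<in> carrier A" using a by (simp add: independent_in_def)
  have apow: "k = 0" if "a [^]\<^bsub>A\<^esub> (k::int) = \<one>\<^bsub>A\<^esub>" for k
    using a that by (auto simp: independent_in_def finprod_singleton dest!: spec[of _ "\<lambda>_. k"])
  have ex: "\<exists>c d. d \<noteq> 0 \<and> x [^]\<^bsub>A\<^esub> (d::int) = a [^]\<^bsub>A\<^esub> (c::int)" if x: "x \<in> carrier A" for x
  proof (cases "x = a")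
    case True
    then show ?thesis by (intro exI[of _ 1]) simp
  next
    case False
    have "\<not> independent_in A {a, x}"
      using rank_one_groupD(3)[OF A] False unfolding has_rank_def by fastforce
    then obtain c :: "'a \<Rightarrow> int" where c: "(\<Otimes>\<^bsub>A\<^esub>b\<in>{a,x}. b [^]\<^bsub>A\<^esub> c b) = \<one>\<^bsub>A\<^esub>" "c a \<noteq> 0 \<or> c x \<noteq> 0"
      using x by (auto simp: independent_in_def)
    have 1: "a [^]\<^bsub>A\<^esub> c a \<otimes>\<^bsub>A\<^esub> x [^]\<^bsub>A\<^esub> c x = \<one>\<^bsub>A\<^esub>"
      using c(1) x False by (simp add: finprod_insert)
    have "c x \<noteq> 0" using 1 c(2) apow[of "c a"] by auto
    moreover have "x [^]\<^bsub>A\<^esub> c x = inv\<^bsub>A\<^esub> (a [^]\<^bsub>A\<^esub> c a)"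
      using 1 x by (metis ac int_pow_closed inv_equality m_comm)
    then have "x [^]\<^bsub>A\<^esub> c x = a [^]\<^bsub>A\<^esub> (- c a)" by (simp add: int_pow_neg)
    ultimately show ?thesis by blast
  qed
  then obtain c d where cd: "\<And>x. x \<in> carrier A \<Longrightarrow> d x \<noteq> 0 \<and> x [^]\<^bsub>A\<^esub> (d x::int) = a [^]\<^bsub>A\<^esub> (c x::int)"
    by metis
  define f :: "'a \<Rightarrow> rat" where "f x = of_int (c x) / of_int (d x)" for x
  \<comment> \<open>\<open>c\<close> and \<open>d\<close> are mere choices. This equivalence shows
    that any relation between \<open>x\<close> and \<open>a\<close> computes \<open>f x\<close>:
    multiplied by \<open>d x\<close>, which torsion-freeness permits, it becomes an equation between
    multiples of \<open>a\<close>.\<close>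
  have f_eq: "f x = of_int k / of_int l \<longleftrightarrow> x [^]\<^bsub>A\<^esub> l = a [^]\<^bsub>A\<^esub> k" if x: "x \<in> carrier A" and l: "l \<noteq> 0" for x k l
  proof -
    have "x [^]\<^bsub>A\<^esub> l = a [^]\<^bsub>A\<^esub> k \<longleftrightarrow> x [^]\<^bsub>A\<^esub> l \<otimes>\<^bsub>A\<^esub> a [^]\<^bsub>A\<^esub> (- k) = \<one>\<^bsub>A\<^esub>"
      using x inv_solve_right'[of "\<one>\<^bsub>A\<^esub>" "x [^]\<^bsub>A\<^esub> l" "a [^]\<^bsub>A\<^esub> k"] by (auto simp: int_pow_neg)
    also have "\<dots> \<longleftrightarrow> (x [^]\<^bsub>A\<^esub> l \<otimes>\<^bsub>A\<^esub> a [^]\<^bsub>A\<^esub> (- k)) [^]\<^bsub>A\<^esub> d x = \<one>\<^bsub>A\<^esub>"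
      using tf[of "x [^]\<^bsub>A\<^esub> l \<otimes>\<^bsub>A\<^esub> a [^]\<^bsub>A\<^esub> (- k)" "d x"] cd[OF x] x
      by (metis (no_types, lifting) ac int_pow_closed int_pow_one m_closed)
    also have "(x [^]\<^bsub>A\<^esub> l \<otimes>\<^bsub>A\<^esub> a [^]\<^bsub>A\<^esub> (- k)) [^]\<^bsub>A\<^esub> d x = (x [^]\<^bsub>A\<^esub> d x) [^]\<^bsub>A\<^esub> l \<otimes>\<^bsub>A\<^esub> a [^]\<^bsub>A\<^esub> (- k * d x)"
      using x by (simp add: int_pow_distrib int_pow_pow mult.commute)
    also have "\<dots> = a [^]\<^bsub>A\<^esub> (c x * l - k * d x)"
      using cd[OF x] x by (simp add: int_pow_pow flip: int_pow_mult)
    also have "\<dots> = \<one>\<^bsub>A\<^esub> \<longleftrightarrow> c x * l = k * d x"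
      using apow[of "c x * l - k * d x"] by auto
    also have "\<dots> \<longleftrightarrow> f x = of_int k / of_int l"
      using l cd[OF x] by (simp add: f_def frac_eq_eq flip: of_int_mult)
    finally show ?thesis by blast
  qed
  show thesis
  proof
    show "f \<in> hom A rat_group"
    proof (rule homI)
      fix x y assume xy: "x \<in> carrier A" "y \<in> carrier A"
      have "(x \<otimes>\<^bsub>A\<^esub> y) [^]\<^bsub>A\<^esub> (d x * d y) = (x [^]\<^bsub>A\<^esub> d x) [^]\<^bsub>A\<^esub> d y \<otimes>\<^bsub>A\<^esub> (y [^]\<^bsub>A\<^esub> d y) [^]\<^bsub>A\<^esub> d x"
        using xy by (simp add: int_pow_distrib int_pow_pow mult.commute)
      also have "\<dots> = a [^]\<^bsub>A\<^esub> (c x * d y + c y * d x)"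
        using cd xy by (simp add: int_pow_pow int_pow_mult)
      finally have "f (x \<otimes>\<^bsub>A\<^esub> y) = of_int (c x * d y + c y * d x) / of_int (d x * d y)"
        by (subst f_eq) (use xy cd in auto)
      then show "f (x \<otimes>\<^bsub>A\<^esub> y) = f x \<otimes>\<^bsub>rat_group\<^esub> f y"
        using cd[OF xy(1)] cd[OF xy(2)] by (simp add: f_def field_simps)
    qed simp
    show "inj_on f (carrier A)"
    proof (rule inj_onI)
      fix x y assume xy: "x \<in> carrier A" "y \<in> carrier A" "f x = f y"
      then have "x [^]\<^bsub>A\<^esub> d y = a [^]\<^bsub>A\<^esub> c y"
        using f_eq[of x "d y" "c y"] cd[of y] by (simp add: f_def)
      then have "x [^]\<^bsub>A\<^esub> d y = y [^]\<^bsub>A\<^esub> d y" using cd[of y] xy by simp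
      then have "(x \<otimes>\<^bsub>A\<^esub> inv\<^bsub>A\<^esub> y) [^]\<^bsub>A\<^esub> d y = \<one>\<^bsub>A\<^esub>"
        using xy by (simp add: int_pow_distrib int_pow_inv)
      then have "x \<otimes>\<^bsub>A\<^esub> inv\<^bsub>A\<^esub> y = \<one>\<^bsub>A\<^esub>"
        using tf[of "x \<otimes>\<^bsub>A\<^esub> inv\<^bsub>A\<^esub> y" "d y"] cd[of y] xy by simp
      then show "x = y" using xy by (simp add: inv_solve_right')
    qed
    have "f a = of_int 1 / of_int 1" by (subst f_eq) simp_all
    then show "\<exists>x\<in>carrier A. f x \<noteq> 0" by (intro bexI[of _ a]) auto
  qed
qed

text \<open>Any two rationals satisfy a nontrivial integral relation, and injectivity of
  \<open>f\<close> carries it back to \<open>A\<close>; so no independent set has two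
  elements.\<close>

lemma rank_one_groupI:
  assumes A: "comm_group A" and f: "f \<in> hom A rat_group" "inj_on f (carrier A)"
    and ne: "\<exists>x\<in>carrier A. x \<noteq> \<one>\<^bsub>A\<^esub>"
  shows "rank_one_group A"
proof -
  interpret comm_group A by fact
  interpret f: group_hom A rat_group f by (rule group_hom_additive_group[OF A f(1)])
  note pow = hom_additive_pow[OF A f(1)]
  have f0: "f x = 0 \<longleftrightarrow> x = \<one>\<^bsub>A\<^esub>" if "x \<in> carrier A" for x
    using f(2) f.hom_one that by (metis additive_group_simps(3) inj_onD one_closed)
  have tf: "torsion_free A"
    unfolding torsion_free_def
  proof (intro ballI allI impI)
    fix x and n :: nat assume x: "x \<in> carrier A" "n > 0" "x [^]\<^bsub>A\<^esub> n = \<one>\<^bsub>A\<^esub>"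
    then have "of_nat n * f x = 0" using pow(1)[of x n] f0[of "\<one>\<^bsub>A\<^esub>"] by simp
    then show "x = \<one>\<^bsub>A\<^esub>" using x f0 by simp
  qed
  have "card B \<le> 1" if B: "independent_in A B" for B
  proof (rule ccontr)
    assume "\<not> card B \<le> 1"
    then obtain x y where xy: "x \<in> B" "y \<in> B" "x \<noteq> y"
      by (metis B card_le_Suc0_iff_eq independent_in_def One_nat_def)
    have Bc: "finite B" "B \<subseteq> carrier A" using B by (auto simp: independent_in_def)
    obtain a b where ab: "a \<noteq> 0 \<or> b \<noteq> 0" "of_int a * f x = of_int b * f y"
    proof (cases "f x = 0 \<or> f y = 0")
      case True
      then show thesis using that[of 1 0] that[of 0 1] by auto
    next
      case False
      then show thesis using rat_common_multiple[of "f x" "f y"] that by metis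
    qed
    define c where "c z = (if z = x then a else if z = y then - b else 0)" for z
    have "(\<Otimes>\<^bsub>A\<^esub>z\<in>B. z [^]\<^bsub>A\<^esub> c z) = (\<Otimes>\<^bsub>A\<^esub>z\<in>{x, y}. z [^]\<^bsub>A\<^esub> c z)"
      using Bc xy by (intro finprod_mono_neutral_cong) (auto simp: c_def)
    also have "\<dots> = x [^]\<^bsub>A\<^esub> a \<otimes>\<^bsub>A\<^esub> y [^]\<^bsub>A\<^esub> (- b)"
    proof -
      have xyc: "x \<in> carrier A" "y \<in> carrier A" using xy Bc by auto
      have "(\<Otimes>\<^bsub>A\<^esub>z\<in>{x, y}. z [^]\<^bsub>A\<^esub> c z) = x [^]\<^bsub>A\<^esub> c x \<otimes>\<^bsub>A\<^esub> (\<Otimes>\<^bsub>A\<^esub>z\<in>{y}. z [^]\<^bsub>A\<^esub> c z)"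
        by (rule finprod_insert) (use xy xyc in auto)
      also have "(\<Otimes>\<^bsub>A\<^esub>z\<in>{y}. z [^]\<^bsub>A\<^esub> c z) = y [^]\<^bsub>A\<^esub> c y"
        using xyc by (simp add: finprod_singleton)
      finally show ?thesis using xy by (simp add: c_def)
    qed
    also have "f \<dots> = 0"
      using xy Bc ab by (auto simp: pow subset_iff)
    then have "x [^]\<^bsub>A\<^esub> a \<otimes>\<^bsub>A\<^esub> y [^]\<^bsub>A\<^esub> (- b) = \<one>\<^bsub>A\<^esub>"
      using f0[of "x [^]\<^bsub>A\<^esub> a \<otimes>\<^bsub>A\<^esub> y [^]\<^bsub>A\<^esub> (- b)"] xy Bc by auto
    finally have "\<forall>z\<in>B. c z = 0" using B by (simp add: independent_in_def)
    then show False using ab(1) xy by (auto simp: c_def)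
  qed
  moreover obtain x where "x \<in> carrier A" "x \<noteq> \<one>\<^bsub>A\<^esub>" using ne by blast
  then have "independent_in A {x}" by (rule independent_singleton[OF A tf])
  then have "\<exists>B. independent_in A B \<and> card B = 1" by (intro exI[of _ "{x}"]) simp
  ultimately show ?thesis
    by (simp add: rank_one_group_def has_rank_def A tf)
qed

lemma height_eq_rat_height:
  assumes A: "comm_group A" and f: "f \<in> hom A rat_group" "inj_on f (carrier A)"
    and x: "x \<in> carrier A" and p: "p > 0"
  shows "height A p x = rat_height (f ` carrier A) p (f x)"
proof -
  interpret comm_group A by fact
  have "(\<exists>y\<in>carrier A. y [^]\<^bsub>A\<^esub> (p ^ k) = x) \<longleftrightarrow> f x / of_nat p ^ k \<in> f ` carrier A" for k
  proof
    assume "\<exists>y\<in>carrier A. y [^]\<^bsub>A\<^esub> (p ^ k) = x"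
    then obtain y where y: "y \<in> carrier A" "y [^]\<^bsub>A\<^esub> (p ^ k) = x" by blast
    then have "f y = f x / of_nat p ^ k"
      using hom_additive_pow(1)[OF A f(1) y(1), of "p ^ k"] p by (simp add: field_simps)
    then show "f x / of_nat p ^ k \<in> f ` carrier A" using y by (metis imageI)
  next
    assume "f x / of_nat p ^ k \<in> f ` carrier A"
    then obtain y where y: "y \<in> carrier A" "f y = f x / of_nat p ^ k" by auto
    then have "f (y [^]\<^bsub>A\<^esub> (p ^ k)) = f x"
      using hom_additive_pow(1)[OF A f(1) y(1), of "p ^ k"] p by (simp add: field_simps)
    then show "\<exists>y\<in>carrier A. y [^]\<^bsub>A\<^esub> (p ^ k) = x"
      using y x f(2) by (meson inj_onD nat_pow_closed)
  qed
  then show ?thesis by (simp add: height_def rat_height_def)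
qed

lemma char_equiv_cong: "(\<And>p. prime p \<Longrightarrow> \<chi> p = \<psi> p) \<Longrightarrow> char_equiv \<chi> \<psi>"
  by (auto simp: char_equiv_def cong: conj_cong)

lemma type_of_eq:
  assumes A: "comm_group A" and f: "f \<in> hom A rat_group" "inj_on f (carrier A)"
    and q: "q \<in> f ` carrier A" "q \<noteq> 0"
  shows "type_of A = {\<chi>. char_equiv (\<lambda>p. rat_height (f ` carrier A) p q) \<chi>}"
proof -
  interpret comm_group A by fact
  interpret f: group_hom A rat_group f by (rule group_hom_additive_group[OF A f(1)])
  have f0: "f x = 0 \<longleftrightarrow> x = \<one>\<^bsub>A\<^esub>" if "x \<in> carrier A" for x
    using f(2) f.hom_one that by (metis additive_group_simps(3) inj_onD one_closed)
  have S: "add_subgroup (f ` carrier A)" by (rule add_subgroup_hom_image[OF A f(1)])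
  have eq: "char_equiv (\<lambda>p. height A p x) (\<lambda>p. rat_height (f ` carrier A) p q)"
    if x: "x \<in> carrier A" "x \<noteq> \<one>\<^bsub>A\<^esub>" for x
  proof (rule char_equiv_trans)
    show "char_equiv (\<lambda>p. height A p x) (\<lambda>p. rat_height (f ` carrier A) p (f x))"
      by (rule char_equiv_cong) (rule height_eq_rat_height[OF A f x(1)], rule prime_gt_0_nat)
    show "char_equiv (\<lambda>p. rat_height (f ` carrier A) p (f x)) (\<lambda>p. rat_height (f ` carrier A) p q)"
      by (rule char_equiv_rat_height[OF S]) (use x q f0 in auto)
  qed
  obtain x where x: "x \<in> carrier A" "q = f x" using q by blast
  then have "x \<noteq> \<one>\<^bsub>A\<^esub>" using q f0 by blast
  then show ?thesis
    unfolding type_of_def using eq x by (blast intro: char_equiv_trans char_equiv_sym)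
qed

lemma type_of_ring:
  assumes "comm_group A" "f \<in> hom A rat_group" "inj_on f (carrier A)" and R: "rat_subring (f ` carrier A)"
  shows "type_of A = {\<chi>. char_equiv (ring_char (f ` carrier A)) \<chi>}"
proof -
  let ?R = "f ` carrier A"
  have "type_of A = {\<chi>. char_equiv (\<lambda>p. rat_height ?R p 1) \<chi>}"
    by (rule type_of_eq) (use assms rat_subringD in auto)
  moreover have "char_equiv (\<lambda>p. rat_height ?R p 1) (ring_char ?R)"
    using R rat_height_one by (intro char_equiv_cong) blast
  ultimately show ?thesis
    by (auto intro: char_equiv_trans char_equiv_sym)
qed

text \<open>An arbitrary embedding is rescaled so that 1 is the image of an element whose heights
  are all 0 or infinite; by \<open>rat_subringI\<close> the image is then a ring.\<close>

lemma rank_one_group_ring_embedding: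
  assumes A: "rank_one_group A" and idem: "idempotent_type (type_of A)"
  obtains f where "f \<in> hom A rat_group" "inj_on f (carrier A)" "rat_subring (f ` carrier A)"
proof -
  have cg: "comm_group A" using rank_one_groupD(1)[OF A] .
  obtain f where f: "f \<in> hom A rat_group" "inj_on f (carrier A)" and ne: "\<exists>x\<in>carrier A. f x \<noteq> 0"
    using rank_one_group_embedding[OF A] by blast
  define S where "S = f ` carrier A"
  have S: "add_subgroup S" unfolding S_def using cg f(1) by (rule add_subgroup_hom_image)
  obtain q where q: "q \<in> S" "q \<noteq> 0" using ne S_def by auto
  have ty: "type_of A = {\<chi>. char_equiv (\<lambda>p. rat_height S p q) \<chi>}"
    unfolding S_def by (rule type_of_eq) (use cg f q S_def in auto)
  obtain \<chi> where \<chi>: "char_equiv (\<lambda>p. rat_height S p q) \<chi>" "\<And>p. prime p \<Longrightarrow> \<chi> p = 0 \<or> \<chi> p = \<infinity>"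
    using idempotent_type_iff[OF ty] idem ty by auto
  \<comment> \<open>An idempotent type contains a characteristic \<chi> with values 0 and infinity.
    Wherever the height of \<open>q\<close> is neither, it differs from \<chi>, which happens at
    finitely many primes.\<close>
  have "finite {p. prime p \<and> rat_height S p q \<noteq> 0 \<and> rat_height S p q \<noteq> \<infinity>}"
    by (rule finite_subset[of _ "{p. prime p \<and> rat_height S p q \<noteq> \<chi> p}"])
      (use \<chi> in \<open>auto simp: char_equiv_def\<close>, metis enat.distinct(2))
  then obtain e where e: "e \<in> S" "e \<noteq> 0" "\<And>p. prime p \<Longrightarrow> rat_height S p e = 0 \<or> rat_height S p e = \<infinity>"
    using finite_heights_reduce[OF S q] by blast
  define g where "g x = f x / e" for x
  have g: "g \<in> hom A rat_group"
    using f(1) by (auto simp: hom_def g_def add_divide_distrib)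
  have ginj: "inj_on g (carrier A)"
    using f(2) e(2) by (auto simp: inj_on_def g_def)
  have gmem: "r \<in> g ` carrier A \<longleftrightarrow> r * e \<in> S" for r
    using e(2) by (auto simp: g_def S_def image_iff field_simps)
  have "rat_subring (g ` carrier A)"
  proof (rule rat_subringI)
    show gS: "add_subgroup (g ` carrier A)" using cg g by (rule add_subgroup_hom_image)
    show "1 \<in> g ` carrier A" using gmem e(1) by simp
    have "rat_height (g ` carrier A) p 1 = rat_height S p e" for p
      by (simp add: rat_height_def gmem)
    then show "rat_height (g ` carrier A) p 1 = 0 \<or> rat_height (g ` carrier A) p 1 = \<infinity>" if "prime p" for p
      using e(3) that by simp
  qed
  then show thesis by (rule that[OF g ginj])
qed

text \<open>The inverse of the isomorphism from the external direct sum, read component by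
  component. \<open>gfinprod\<close> accommodates an infinite \<open>D\<close>, where each element
  has finitely many nontrivial components.\<close>

definition summand_projections ::
    "('a, 'm) monoid_scheme \<Rightarrow> 'a set set \<Rightarrow> ('a set \<Rightarrow> 'a \<Rightarrow> 'a) \<Rightarrow> bool" where
  "summand_projections G D \<pi> \<longleftrightarrow>
     (\<forall>A\<in>D. \<pi> A \<in> hom G G \<and> (\<forall>x\<in>carrier G. \<pi> A x \<in> A) \<and> (\<forall>x\<in>A. \<pi> A x = x) \<and>
        (\<forall>B\<in>D. A \<noteq> B \<longrightarrow> (\<forall>x\<in>B. \<pi> A x = \<one>\<^bsub>G\<^esub>))) \<and>
     (\<forall>x\<in>carrier G. gfinprod G (\<lambda>A. \<pi> A x) D = x)"

lemma summand_projectionsD: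
  assumes "summand_projections G D \<pi>"
  shows "A \<in> D \<Longrightarrow> \<pi> A \<in> hom G G"
    "A \<in> D \<Longrightarrow> x \<in> carrier G \<Longrightarrow> \<pi> A x \<in> A"
    "A \<in> D \<Longrightarrow> x \<in> A \<Longrightarrow> \<pi> A x = x"
    "A \<in> D \<Longrightarrow> B \<in> D \<Longrightarrow> A \<noteq> B \<Longrightarrow> x \<in> B \<Longrightarrow> \<pi> A x = \<one>\<^bsub>G\<^esub>"
    "x \<in> carrier G \<Longrightarrow> gfinprod G (\<lambda>A. \<pi> A x) D = x"
  using assms unfolding summand_projections_def by (simp_all only: ball_simps simp_thms)

lemma rank_one_decomposition_projections:
  assumes G: "comm_group G" and D: "rank_one_decomposition G D"
  shows "\<exists>\<pi>. summand_projections G D \<pi>"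
proof -
  interpret comm_group G by fact
  let ?S = "sum_group D (\<lambda>A. G\<lparr>carrier := A\<rparr>)"
  let ?h = "\<lambda>x. gfinprod G x D"
  have sub: "subgroup A G" if "A \<in> D" for A using D that by (simp add: rank_one_decomposition_def)
  have grp: "group (G\<lparr>carrier := A\<rparr>)" if "A \<in> D" for A
    using sub[OF that] subgroup_imp_group by blast
  have h: "?h \<in> iso ?S G" using D by (simp add: rank_one_decomposition_def)
  have carS: "carrier ?S = {x \<in> \<Pi>\<^sub>E A\<in>D. A. finite {A \<in> D. x A \<noteq> \<one>\<^bsub>G\<^esub>}}"
    using grp by (subst carrier_sum_group) auto
  have Sgrp: "group ?S" using grp by (rule sum_group)
  define g where "g = inv_into (carrier ?S) ?h"
  have g: "g \<in> iso G ?S" unfolding g_def using group.iso_set_sym[OF Sgrp h] .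
  have gh: "g (?h x) = x" if "x \<in> carrier ?S" for x
    unfolding g_def by (rule inv_into_f_f) (use h that in \<open>simp_all add: iso_def bij_betw_def\<close>)
  have hg: "?h (g x) = x" if "x \<in> carrier G" for x
  proof -
    have "x \<in> ?h ` carrier ?S" using h that by (simp add: iso_def bij_betw_def)
    from f_inv_into_f[OF this] show ?thesis unfolding g_def .
  qed
  have gc: "g x \<in> carrier ?S" if "x \<in> carrier G" for x
    using g that by (auto simp: iso_def hom_def)
  have gA: "g x A \<in> A" if "x \<in> carrier G" "A \<in> D" for x A
    using gc[OF that(1)] that(2) by (auto simp: carS)
  have gsingle: "g a = (\<lambda>B\<in>D. if B = A then a else \<one>\<^bsub>G\<^esub>)" if A: "A \<in> D" "a \<in> A" for A a
  proof -
    let ?f = "\<lambda>B\<in>D. if B = A then a else \<one>\<^bsub>G\<^esub>"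
    have ac: "a \<in> carrier G" using A sub subgroup.mem_carrier by metis
    have "finite {B \<in> D. ?f B \<noteq> \<one>\<^bsub>G\<^esub>}"
      by (rule finite_subset[of _ "{A}"]) auto
    then have f: "?f \<in> carrier ?S"
      using A sub subgroup.one_closed by (fastforce simp: carS)
    have "?h ?f = gfinprod G (\<lambda>_. a) {A}"
      by (rule gfinprod_mono_neutral_cong_right[symmetric, THEN sym]) (use A ac in auto)
    also have "\<dots> = a" using ac by (simp add: finprod_singleton)
    finally show ?thesis using gh[OF f] by simp
  qed
  have "(\<lambda>x. g x A) \<in> hom G G" if A: "A \<in> D" for A
  proof (rule homI)
    fix x y assume xy: "x \<in> carrier G" "y \<in> carrier G"
    then have "g (x \<otimes>\<^bsub>G\<^esub> y) = g x \<otimes>\<^bsub>?S\<^esub> g y" using g by (auto simp: iso_def hom_def)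
    then show "g (x \<otimes>\<^bsub>G\<^esub> y) A = g x A \<otimes>\<^bsub>G\<^esub> g y A" using A by simp
  qed (use gA sub A subgroup.mem_carrier in metis)
  then have "summand_projections G D (\<lambda>A x. g x A)"
    unfolding summand_projections_def using gA gsingle hg by auto
  then show ?thesis by blast
qed

section \<open>Finite index and the regulator\<close>

lemma hom_finprod:
  assumes G: "comm_group G" and H: "comm_group H" and f: "f \<in> hom G H"
    and g: "\<And>i. i \<in> I \<Longrightarrow> g i \<in> carrier G"
  shows "f (finprod G g I) = finprod H (\<lambda>i. f (g i)) I"
proof -
  interpret G: comm_group G by fact
  interpret H: comm_group H by fact
  interpret f: group_hom G H f by unfold_locales (rule f)
  show ?thesis using g
  proof (induction I rule: infinite_finite_induct)
    case (insert i I)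
    have "f (finprod G g (insert i I)) = f (g i \<otimes>\<^bsub>G\<^esub> finprod G g I)"
      using insert by (subst G.finprod_insert) auto
    also have "\<dots> = f (g i) \<otimes>\<^bsub>H\<^esub> finprod H (\<lambda>i. f (g i)) I"
      using insert by (subst f.hom_mult) (auto intro!: G.finprod_closed)
    also have "\<dots> = finprod H (\<lambda>i. f (g i)) (insert i I)"
      using insert by (subst H.finprod_insert) auto
    finally show ?case .
  qed simp_all
qed

lemma hom_finprod_additive:
  assumes G: "comm_group G" and f: "f \<in> hom G (additive_group UNIV)"
    and g: "\<And>i. i \<in> I \<Longrightarrow> g i \<in> carrier G"
  shows "f (finprod G g I) = (\<Sum>i\<in>I. f (g i))"
  by (subst hom_finprod[OF G comm_group_additive_group[OF add_subgroup_UNIV] f g])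
    (simp_all add: finprod_additive_group)

lemma comm_group_subgroup:
  assumes "comm_group G" "subgroup H G"
  shows "comm_group (G\<lparr>carrier := H\<rparr>)"
proof -
  interpret comm_group G by fact
  show ?thesis
    by (rule group.group_comm_groupI[OF subgroup_imp_group[OF assms(2)]])
      (use subgroup.mem_carrier[OF assms(2)] m_comm in auto)
qed

lemma finprod_subgroup:
  assumes G: "comm_group G" and H: "subgroup H G" and g: "\<And>i. i \<in> I \<Longrightarrow> g i \<in> H"
  shows "finprod (G\<lparr>carrier := H\<rparr>) g I = finprod G g I"
proof -
  have "(\<lambda>x. x) \<in> hom (G\<lparr>carrier := H\<rparr>) G"
    using subgroup.subset[OF H] by (auto simp: hom_def)
  from hom_finprod[OF comm_group_subgroup[OF G H] G this, of I g] g show ?thesis by simp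
qed

lemma nat_pow_subgroup: "x [^]\<^bsub>G\<lparr>carrier := H\<rparr>\<^esub> (k::nat) = x [^]\<^bsub>G\<^esub> k"
  by (simp add: nat_pow_def)

lemma int_pow_subgroup:
  assumes "group G" "subgroup H G" "x \<in> H"
  shows "x [^]\<^bsub>G\<lparr>carrier := H\<rparr>\<^esub> (k::int) = x [^]\<^bsub>G\<^esub> k"
  using group.int_pow_consistent[OF assms, of k] by simp

lemma has_rankI_bound:
  assumes "\<And>B. independent_in G B \<Longrightarrow> card B \<le> n" and G: "comm_group G"
  shows "\<exists>m. has_rank G m"
proof -
  let ?C = "{card B |B. independent_in G B}"
  interpret comm_group G by fact
  have fin: "finite ?C"
    by (rule finite_subset[of _ "{..n}"]) (use assms(1) in auto)
  have "independent_in G {}" by (simp add: independent_in_def)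
  then have "?C \<noteq> {}" by blast
  with fin have "Max ?C \<in> ?C" "\<And>c. c \<in> ?C \<Longrightarrow> c \<le> Max ?C" by (simp_all only: Max_in Max_ge simp_thms)
  then have "has_rank G (Max ?C)" unfolding has_rank_def by auto
  then show ?thesis by blast
qed

text \<open>Cosets of \<open>A\<close> map onto cosets of \<open>B\<close>. If the finite numbers
  agree, the map is injective, and since every \<open>b\<close> in \<open>B\<close> gives a coset of
  \<open>A\<close> lying over \<open>B\<close>, it belongs to \<open>A\<close>.\<close>

lemma group_index_mono:
  assumes G: "comm_group G" and A: "subgroup A G" and B: "subgroup B G" and "A \<subseteq> B"
    and fin: "finite (rcosets\<^bsub>G\<^esub> A)"
  shows "finite (rcosets\<^bsub>G\<^esub> B)" "card (rcosets\<^bsub>G\<^esub> B) \<le> card (rcosets\<^bsub>G\<^esub> A)"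
    "card (rcosets\<^bsub>G\<^esub> B) = card (rcosets\<^bsub>G\<^esub> A) \<Longrightarrow> A = B"
proof -
  interpret comm_group G by fact
  \<comment> \<open>Multiplying the whole coset by \<open>B\<close> defines the map without choosing
    representatives.\<close>
  define \<phi> where "\<phi> X = B <#>\<^bsub>G\<^esub> X" for X
  have \<phi>: "\<phi> (A #>\<^bsub>G\<^esub> x) = B #>\<^bsub>G\<^esub> x" if x: "x \<in> carrier G" for x
  proof -
    have "B <#>\<^bsub>G\<^esub> A = B"
    proof
      show "B <#>\<^bsub>G\<^esub> A \<subseteq> B"
        using \<open>A \<subseteq> B\<close> subgroup.m_closed[OF B] by (auto simp: set_mult_def)
      show "B \<subseteq> B <#>\<^bsub>G\<^esub> A"
      proof
        fix b assume b: "b \<in> B"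
        then have "b \<otimes>\<^bsub>G\<^esub> \<one>\<^bsub>G\<^esub> \<in> B <#>\<^bsub>G\<^esub> A"
          unfolding set_mult_def using subgroup.one_closed[OF A] by blast
        then show "b \<in> B <#>\<^bsub>G\<^esub> A" using subgroup.mem_carrier[OF B b] by simp
      qed
    qed
    then show ?thesis
      using setmult_rcos_assoc[OF subgroup.subset[OF B] subgroup.subset[OF A] x] by (simp add: \<phi>_def)
  qed
  have surj: "rcosets\<^bsub>G\<^esub> B = \<phi> ` (rcosets\<^bsub>G\<^esub> A)"
    unfolding RCOSETS_def by (simp add: image_UN \<phi>)
  show "finite (rcosets\<^bsub>G\<^esub> B)" "card (rcosets\<^bsub>G\<^esub> B) \<le> card (rcosets\<^bsub>G\<^esub> A)"
    unfolding surj by (rule finite_imageI[OF fin], rule card_image_le[OF fin])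
  assume "card (rcosets\<^bsub>G\<^esub> B) = card (rcosets\<^bsub>G\<^esub> A)"
  then have inj: "inj_on \<phi> (rcosets\<^bsub>G\<^esub> A)"
    unfolding surj by (rule eq_card_imp_inj_on[OF fin])
  have "b \<in> A" if b: "b \<in> B" for b
  proof -
    have bc: "b \<in> carrier G" using b B subgroup.mem_carrier by metis
    have "\<phi> (A #>\<^bsub>G\<^esub> b) = \<phi> (A #>\<^bsub>G\<^esub> \<one>\<^bsub>G\<^esub>)"
      unfolding \<phi>[OF bc] \<phi>[OF one_closed] coset_join2[OF bc B b]
      by (rule coset_join2[OF one_closed B subgroup.one_closed[OF B], symmetric])
    then have "A #>\<^bsub>G\<^esub> b = A #>\<^bsub>G\<^esub> \<one>\<^bsub>G\<^esub>"
      by (rule inj_onD[OF inj]) (use rcosetsI[OF subgroup.subset[OF A]] bc in auto)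
    then have "A #>\<^bsub>G\<^esub> b = A" using coset_mult_one[OF subgroup.subset[OF A]] by simp
    then show ?thesis by (rule coset_join1[OF _ bc A])
  qed
  then show "A = B" using \<open>A \<subseteq> B\<close> by blast
qed

lemma carrier_eq_cosets_powers:
  assumes G: "comm_group G" and H: "subgroup H G" and cyc: "cyclic_group (G Mod H)"
  obtains d where "d \<in> carrier G"
    "\<And>x. x \<in> carrier G \<Longrightarrow> \<exists>r\<in>H. \<exists>j::int. x = r \<otimes>\<^bsub>G\<^esub> d [^]\<^bsub>G\<^esub> j"
proof -
  interpret comm_group G by fact
  interpret normal H G using H by (simp add: subgroup_imp_normal)
  have "group (G Mod H)" by (rule factorgroup_is_group)
  then obtain X where X: "X \<in> carrier (G Mod H)" "carrier (G Mod H) = range (\<lambda>n::int. X [^]\<^bsub>G Mod H\<^esub> n)"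
    using cyc group.cyclic_group by blast
  then obtain d where d: "d \<in> carrier G" "X = H #>\<^bsub>G\<^esub> d"
    unfolding carrier_FactGroup by blast
  have "\<exists>r\<in>H. \<exists>j::int. x = r \<otimes>\<^bsub>G\<^esub> d [^]\<^bsub>G\<^esub> j" if x: "x \<in> carrier G" for x
  proof -
    have "H #>\<^bsub>G\<^esub> x \<in> carrier (G Mod H)" using x by (auto simp: carrier_FactGroup)
    then obtain j :: int where "H #>\<^bsub>G\<^esub> x = X [^]\<^bsub>G Mod H\<^esub> j" using X by auto
    then have "H #>\<^bsub>G\<^esub> x = H #>\<^bsub>G\<^esub> (d [^]\<^bsub>G\<^esub> j)" using d FactGroup_int_pow by simp
    then have "x \<in> H #>\<^bsub>G\<^esub> (d [^]\<^bsub>G\<^esub> j)" using x H rcos_self by metis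
    then show ?thesis by (auto simp: r_coset_def)
  qed
  then show thesis using that d by blast
qed

lemma finite_index_pow:
  assumes G: "comm_group G" and H: "subgroup H G" and fin: "finite (rcosets\<^bsub>G\<^esub> H)" and x: "x \<in> carrier G"
  shows "x [^]\<^bsub>G\<^esub> card (rcosets\<^bsub>G\<^esub> H) \<in> H" "card (rcosets\<^bsub>G\<^esub> H) > 0"
proof -
  interpret comm_group G by fact
  interpret normal H G using H by (simp add: subgroup_imp_normal)
  interpret Q: comm_group "G Mod H" using H by (rule abelian_FactGroup)
  have c: "H #>\<^bsub>G\<^esub> x \<in> carrier (G Mod H)" using x by (auto simp: carrier_FactGroup)
  have o: "carrier (G Mod H) = rcosets\<^bsub>G\<^esub> H"
    by (simp add: FactGroup_def)
  have "H #>\<^bsub>G\<^esub> (x [^]\<^bsub>G\<^esub> card (rcosets\<^bsub>G\<^esub> H)) = H"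
    using Q.power_order_eq_one[OF _ c] fin FactGroup_pow[OF x] by (simp add: o)
  then show "x [^]\<^bsub>G\<^esub> card (rcosets\<^bsub>G\<^esub> H) \<in> H"
    using x H coset_join1 by (metis nat_pow_closed subset)
  show "card (rcosets\<^bsub>G\<^esub> H) > 0"
    using fin c by (auto simp: FactGroup_def card_gt_0_iff)
qed

lemma subgroup_pow_mem_gcd:
  assumes G: "comm_group G" and H: "subgroup H G" and d: "d \<in> carrier G"
    and "d [^]\<^bsub>G\<^esub> (a::int) \<in> H" "d [^]\<^bsub>G\<^esub> (b::int) \<in> H"
  shows "d [^]\<^bsub>G\<^esub> gcd a b \<in> H"
proof -
  interpret comm_group G by fact
  obtain u v where uv: "u * a + v * b = gcd a b" using bezout_int by blast
  have ip: "x [^]\<^bsub>G\<^esub> (k::int) \<in> H" if "x \<in> H" for x k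
    by (rule subgroup_int_pow_closed[OF H that])
  have "d [^]\<^bsub>G\<^esub> gcd a b = (d [^]\<^bsub>G\<^esub> a) [^]\<^bsub>G\<^esub> u \<otimes>\<^bsub>G\<^esub> (d [^]\<^bsub>G\<^esub> b) [^]\<^bsub>G\<^esub> v"
    using d by (simp add: int_pow_pow int_pow_mult mult.commute flip: uv)
  also have "\<dots> \<in> H"
    using assms(4,5) ip subgroup.m_closed[OF H] by simp
  finally show ?thesis .
qed

text \<open>
  Above a subgroup with cyclic quotient, a subgroup of finite index is determined by its index.
\<close>

lemma subgroup_index_cyclic:
  assumes G: "comm_group G" and d: "d \<in> carrier G"
    and gen: "\<And>x. x \<in> carrier G \<Longrightarrow> \<exists>r\<in>R. \<exists>j::int. x = r \<otimes>\<^bsub>G\<^esub> d [^]\<^bsub>G\<^esub> j"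
    and A: "subgroup A G" "R \<subseteq> A" "finite (rcosets\<^bsub>G\<^esub> A)"
  shows "d [^]\<^bsub>G\<^esub> (j::int) \<in> A \<longleftrightarrow> int (card (rcosets\<^bsub>G\<^esub> A)) dvd j"
proof -
  interpret comm_group G by fact
  let ?k = "card (rcosets\<^bsub>G\<^esub> A)"
  have dk: "d [^]\<^bsub>G\<^esub> int ?k \<in> A" and k0: "?k > 0"
    using finite_index_pow[OF G A(1,3) d] by (simp_all add: int_pow_int)
  have ip: "(d [^]\<^bsub>G\<^esub> l) [^]\<^bsub>G\<^esub> (i::int) \<in> A" if "d [^]\<^bsub>G\<^esub> (l::int) \<in> A" for l i
    using subgroup_int_pow_closed[OF A(1) that] .
  show ?thesis
  proof
    assume "int ?k dvd j"
    then obtain i where "j = int ?k * i" by blast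
    then show "d [^]\<^bsub>G\<^esub> j \<in> A" using ip[OF dk, of i] d by (simp add: int_pow_pow)
  next
    assume j: "d [^]\<^bsub>G\<^esub> j \<in> A"
    \<comment> \<open>If the \<open>g\<close>-th multiple of \<open>d\<close> lies in
      \<open>A\<close>, then 0, ..., \<open>g - 1\<close> already give all cosets, so the index is
      at most \<open>g\<close>. Being a divisor of the index, \<open>g\<close> equals it, and
      \<open>g\<close> divides \<open>j\<close>.\<close>
    define g where "g = gcd (int ?k) j"
    have g: "g > 0" "g dvd j" using k0 by (simp_all add: g_def)
    have dg: "d [^]\<^bsub>G\<^esub> g \<in> A"
      unfolding g_def by (rule subgroup_pow_mem_gcd[OF G A(1) d dk j])
    have "rcosets\<^bsub>G\<^esub> A \<subseteq> (\<lambda>i. A #>\<^bsub>G\<^esub> d [^]\<^bsub>G\<^esub> i) ` {0..<g}"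
    proof
      fix X assume "X \<in> rcosets\<^bsub>G\<^esub> A"
      then obtain x where x: "x \<in> carrier G" "X = A #>\<^bsub>G\<^esub> x" by (auto simp: RCOSETS_def)
      obtain r j where r: "r \<in> R" "x = r \<otimes>\<^bsub>G\<^esub> d [^]\<^bsub>G\<^esub> (j::int)" using gen[OF x(1)] by blast
      define s where "s = r \<otimes>\<^bsub>G\<^esub> (d [^]\<^bsub>G\<^esub> g) [^]\<^bsub>G\<^esub> (j div g)"
      have s: "s \<in> A" unfolding s_def
        using r(1) A(2) by (intro subgroup.m_closed[OF A(1)] ip[OF dg]) auto
      have rc: "r \<in> carrier G" by (rule subgroup.mem_carrier[OF A(1) subsetD[OF A(2) r(1)]])
      have "(d [^]\<^bsub>G\<^esub> g) [^]\<^bsub>G\<^esub> (j div g) \<otimes>\<^bsub>G\<^esub> d [^]\<^bsub>G\<^esub> (j mod g) = d [^]\<^bsub>G\<^esub> (g * (j div g) + j mod g)"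
        unfolding int_pow_pow[OF d] by (rule int_pow_mult[OF d, symmetric])
      then have "d [^]\<^bsub>G\<^esub> j = (d [^]\<^bsub>G\<^esub> g) [^]\<^bsub>G\<^esub> (j div g) \<otimes>\<^bsub>G\<^esub> d [^]\<^bsub>G\<^esub> (j mod g)"
        by simp
      then have "x = s \<otimes>\<^bsub>G\<^esub> d [^]\<^bsub>G\<^esub> (j mod g)"
        unfolding r s_def using rc d by (simp add: m_assoc)
      then have "X = A #>\<^bsub>G\<^esub> d [^]\<^bsub>G\<^esub> (j mod g)"
        using coset_mult_assoc[OF subgroup.subset[OF A(1)], of s "d [^]\<^bsub>G\<^esub> (j mod g)"]
          coset_join2[OF _ A(1) s] subgroup.mem_carrier[OF A(1) s] d by (simp add: x(2))
      then show "X \<in> (\<lambda>i. A #>\<^bsub>G\<^esub> d [^]\<^bsub>G\<^esub> i) ` {0..<g}"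
        using g(1) by auto
    qed
    then have "?k \<le> card ((\<lambda>i. A #>\<^bsub>G\<^esub> d [^]\<^bsub>G\<^esub> i) ` {0..<g})"
      by (intro card_mono) auto
    also have "\<dots> \<le> card {0..<g}" by (rule card_image_le) simp
    finally have "int ?k \<le> g" using g by simp
    moreover have "g \<le> int ?k" unfolding g_def using k0 by (intro gcd_le1_int) simp
    ultimately show "int ?k dvd j" using g(2) by simp
  qed
qed

text \<open>
  A cyclic quotient forces all completely decomposable subgroups of least index to coincide. So the
  regulator is one of them, and \<^const>\<open>Reg_decomposition\<close> is not an arbitrary value.
\<close>

lemma Reg_least_index:
  assumes G: "comm_group G" and ne: "cd_subgroups G \<noteq> {}" and cyc: "cyclic_group (G Mod Reg G)"
  shows "Reg G \<in> cd_subgroups G"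
    "\<And>K. K \<in> cd_subgroups G \<Longrightarrow> card (rcosets\<^bsub>G\<^esub> (Reg G)) \<le> card (rcosets\<^bsub>G\<^esub> K)"
proof -
  interpret comm_group G by fact
  define L where "L = {H \<in> cd_subgroups G. \<forall>K\<in>cd_subgroups G. card (rcosets\<^bsub>G\<^esub> H) \<le> card (rcosets\<^bsub>G\<^esub> K)}"
  have "L \<noteq> {}"
  proof -
    obtain K where "K \<in> cd_subgroups G" using ne by blast
    from ex_has_least_nat[of "\<lambda>H. H \<in> cd_subgroups G", OF this, of "\<lambda>H. card (rcosets\<^bsub>G\<^esub> H)"]
    show ?thesis unfolding L_def by blast
  qed
  then obtain A where A: "A \<in> L" by blast
  have Reg: "Reg G = \<Inter>L" by (simp add: Reg_def L_def)
  have cd: "subgroup H G" "finite (rcosets\<^bsub>G\<^esub> H)" if "H \<in> L" for H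
    using that by (auto simp: L_def cd_subgroups_def)
  have sub: "subgroup (Reg G) G"
    unfolding Reg using cd(1) \<open>L \<noteq> {}\<close> by (rule subgroups_Inter)
  obtain d where d: "d \<in> carrier G"
    "\<And>x. x \<in> carrier G \<Longrightarrow> \<exists>r\<in>Reg G. \<exists>j::int. x = r \<otimes>\<^bsub>G\<^esub> d [^]\<^bsub>G\<^esub> j"
    using carrier_eq_cosets_powers[OF G sub cyc] by blast
  \<comment> \<open>Two members of \<open>L\<close> both contain \<open>Reg G\<close> and have the
    same index, so they contain the same multiples of \<open>d\<close>, and therefore the same
    elements.\<close>
  have mem: "x \<in> H'" if H: "H \<in> L" "H' \<in> L" and x: "x \<in> H" for H H' x
  proof -
    have sH: "Reg G \<subseteq> H" "Reg G \<subseteq> H'" using H Reg by auto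
    have k: "card (rcosets\<^bsub>G\<^esub> H) = card (rcosets\<^bsub>G\<^esub> H')"
      using H by (auto simp: L_def intro: order_antisym)
    have xc: "x \<in> carrier G" using x cd(1)[OF H(1)] subgroup.mem_carrier by metis
    obtain r and j :: int where r: "r \<in> Reg G" "x = r \<otimes>\<^bsub>G\<^esub> d [^]\<^bsub>G\<^esub> j" using d(2)[OF xc] by blast
    have rH: "r \<in> H" "r \<in> H'" using r sH by auto
    have rc: "r \<in> carrier G" using r sub subgroup.mem_carrier by metis
    have "d [^]\<^bsub>G\<^esub> j = inv\<^bsub>G\<^esub> r \<otimes>\<^bsub>G\<^esub> x" using rc d(1) r(2) by (simp add: m_assoc[symmetric])
    then have "d [^]\<^bsub>G\<^esub> j \<in> H" using x rH cd(1)[OF H(1)] by (simp add: subgroup.m_closed subgroup.m_inv_closed)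
    then have "d [^]\<^bsub>G\<^esub> j \<in> H'"
      using subgroup_index_cyclic[OF G d cd(1)[OF H(1)] sH(1) cd(2)[OF H(1)]]
        subgroup_index_cyclic[OF G d cd(1)[OF H(2)] sH(2) cd(2)[OF H(2)]] k by simp
    then show ?thesis unfolding r(2) using rH(2) cd(1)[OF H(2)] by (simp add: subgroup.m_closed)
  qed
  have "Reg G = A" unfolding Reg using A mem by blast
  with A show "Reg G \<in> cd_subgroups G"
    "\<And>K. K \<in> cd_subgroups G \<Longrightarrow> card (rcosets\<^bsub>G\<^esub> (Reg G)) \<le> card (rcosets\<^bsub>G\<^esub> K)"
    by (auto simp: L_def)
qed

text \<open>Passing to a smaller subgroup cannot lower the index and keeps it only in case of
  equality, so \<open>H\<close> is the sole member of the family that \<open>Reg\<close>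
  intersects.\<close>

lemma Reg_eq_greatest:
  assumes G: "comm_group G" and H: "H \<in> cd_subgroups G"
    and max: "\<And>K. K \<in> cd_subgroups G \<Longrightarrow> K \<subseteq> H"
  shows "Reg G = H"
proof -
  have le: "card (rcosets\<^bsub>G\<^esub> H) \<le> card (rcosets\<^bsub>G\<^esub> K)"
    "card (rcosets\<^bsub>G\<^esub> H) = card (rcosets\<^bsub>G\<^esub> K) \<Longrightarrow> K = H" if "K \<in> cd_subgroups G" for K
    using group_index_mono[OF G _ _ max[OF that]] that H by (auto simp: cd_subgroups_def)
  have "{H \<in> cd_subgroups G. \<forall>K\<in>cd_subgroups G. card (rcosets\<^bsub>G\<^esub> H) \<le> card (rcosets\<^bsub>G\<^esub> K)} = {H}"
    using H le by (auto intro!: le(2) order_antisym)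
  then show ?thesis by (simp add: Reg_def)
qed

section \<open>Subgroups of finite-dimensional rational spaces\<close>

lemma of_int_fun_apply [simp]: "(of_int k :: 'c \<Rightarrow> 'b::ring_1) x = of_int k"
  by (cases k rule: int_cases2) (simp_all)

lemma sum_fun_apply: "(\<Sum>i\<in>I. f i) x = (\<Sum>i\<in>I. f i x)" for f :: "'i \<Rightarrow> 'c \<Rightarrow> 'b::comm_monoid_add"
  by (induction I rule: infinite_finite_induct) simp_all

definition axis :: "nat \<Rightarrow> rat \<Rightarrow> nat \<Rightarrow> rat" where
  "axis i c = (\<lambda>j. if j = i then c else 0)"

lemma axis_same [simp]: "axis i c i = c"
  and axis_other [simp]: "j \<noteq> i \<Longrightarrow> axis i c j = 0"
  by (simp_all add: axis_def)

lemma axis_eq_0_iff [simp]: "axis i c = 0 \<longleftrightarrow> c = 0"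
  by (auto simp: axis_def fun_eq_iff)

lemma axis_diff: "axis i (b - c) = axis i b - axis i c"
  and of_int_times_axis: "of_int k * axis i c = axis i (of_int k * c)"
  by (auto simp: axis_def fun_eq_iff)

lemma eq_axisI: "(\<And>j. j \<noteq> i \<Longrightarrow> x j = 0) \<Longrightarrow> x = axis i (x i)"
  by (auto simp: axis_def fun_eq_iff)

text \<open>The number of coordinates depends on the group and cannot enter the type, so rational
  n-space is realised inside \<open>nat \<Rightarrow> rat\<close> by zeros from \<open>n\<close>
  on.\<close>

definition box :: "nat \<Rightarrow> (nat \<Rightarrow> rat set) \<Rightarrow> (nat \<Rightarrow> rat) set" where
  "box n S = {x. (\<forall>i\<ge>n. x i = 0) \<and> (\<forall>i<n. x i \<in> S i)}"

lemma axis_mem_box: "(\<And>j. j < n \<Longrightarrow> 0 \<in> S j) \<Longrightarrow> i < n \<Longrightarrow> c \<in> S i \<Longrightarrow> axis i c \<in> box n S"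
  by (auto simp: box_def axis_def)

lemma add_subgroup_box: "(\<And>i. i < n \<Longrightarrow> add_subgroup (S i)) \<Longrightarrow> add_subgroup (box n S)"
  by (auto simp: add_subgroup_def box_def)

lemma sum_axis: "(\<And>i. i \<ge> n \<Longrightarrow> x i = 0) \<Longrightarrow> (\<Sum>i<n. axis i (x i)) = x"
  by (auto simp: fun_eq_iff sum_fun_apply axis_def sum.delta')

text \<open>The preimages under \<open>F\<close> of the coordinate axes are the summands. An
  embedding \<open>F\<close> is allowed so that the result serves both the concrete box itself and a
  subgroup of an abstract group.\<close>

lemma completely_decomposable_box:
  assumes K: "comm_group K" and F: "F \<in> hom K (additive_group UNIV)" "inj_on F (carrier K)"
    and im: "F ` carrier K = box n S"
    and S: "\<And>i. i < n \<Longrightarrow> add_subgroup (S i)" "\<And>i. i < n \<Longrightarrow> \<exists>s\<in>S i. s \<noteq> 0"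
  shows "completely_decomposable K"
proof -
  interpret K: comm_group K by fact
  interpret F: group_hom K "additive_group UNIV" F by (rule group_hom_additive_group[OF K F(1)])
  define A where "A i = {x \<in> carrier K. \<forall>j. j \<noteq> i \<longrightarrow> F x j = 0}" for i
  let ?D = "A ` {..<n}"
  let ?S = "sum_group ?D (\<lambda>B. K\<lparr>carrier := B\<rparr>)"
  let ?h = "\<lambda>x. gfinprod K x ?D"
  have S0: "0 \<in> S i" if "i < n" for i using S(1)[OF that] by (rule add_subgroup_zero)
  have subA: "subgroup (A i) K" for i
  proof -
    have "add_subgroup {v::nat \<Rightarrow> rat. \<forall>j. j \<noteq> i \<longrightarrow> v j = 0}" by (simp add: add_subgroup_def)
    from add_subgroup_vimage[OF K F(1) this] show ?thesis by (simp add: A_def)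
  qed
  have cgA: "comm_group (K\<lparr>carrier := A i\<rparr>)" for i by (rule comm_group_subgroup[OF K subA])
  have AK: "A i \<subseteq> carrier K" for i by (auto simp: A_def)
  have lift: "\<exists>x\<in>A i. F x = axis i s" if i: "i < n" and s: "s \<in> S i" for i s
  proof -
    have "axis i s \<in> F ` carrier K" unfolding im by (rule axis_mem_box) (use S0 i s in auto)
    then obtain x where "x \<in> carrier K" "F x = axis i s" by auto
    then show ?thesis by (intro bexI[of _ x]) (auto simp: A_def)
  qed
  have nonzero: "\<exists>x\<in>A i. F x i \<noteq> 0" if i: "i < n" for i
  proof -
    obtain s where s: "s \<in> S i" "s \<noteq> 0" using S(2)[OF i] by blast
    obtain x where "x \<in> A i" "F x = axis i s" using lift[OF i s(1)] by blast
    then show ?thesis using s(2) by (intro bexI[of _ x]) simp_all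
  qed
  \<comment> \<open>Summands are indexed by themselves as sets, so distinct axes must give distinct
    sets; this is where each \<open>S i\<close> has to be nonzero.\<close>
  have injA: "inj_on A {..<n}"
  proof (rule inj_onI)
    fix i j assume ij: "i \<in> {..<n}" "j \<in> {..<n}" "A i = A j"
    then obtain x where "x \<in> A i" "F x i \<noteq> 0" using nonzero by blast
    then show "i = j" using ij(3) unfolding A_def by blast
  qed
  have rk: "rank_one_group (K\<lparr>carrier := A i\<rparr>)" if i: "i < n" for i
  proof (rule rank_one_groupI[where f = "\<lambda>x. F x i"])
    show "comm_group (K\<lparr>carrier := A i\<rparr>)" by (rule cgA)
    show "(\<lambda>x. F x i) \<in> hom (K\<lparr>carrier := A i\<rparr>) rat_group"
      using AK[of i] by (auto simp: hom_def subset_iff)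
    show "inj_on (\<lambda>x. F x i) (carrier (K\<lparr>carrier := A i\<rparr>))"
    proof (rule inj_onI)
      fix x y assume xy: "x \<in> carrier (K\<lparr>carrier := A i\<rparr>)" "y \<in> carrier (K\<lparr>carrier := A i\<rparr>)" "F x i = F y i"
      have "F x = F y"
      proof
        fix j show "F x j = F y j" using xy by (cases "j = i") (auto simp: A_def)
      qed
      then show "x = y" using xy F(2) by (auto simp: A_def inj_on_def)
    qed
    obtain x where x: "x \<in> A i" "F x i \<noteq> 0" using nonzero[OF i] by blast
    then have "x \<noteq> \<one>\<^bsub>K\<^esub>" using F.hom_one by auto
    then show "\<exists>x\<in>carrier (K\<lparr>carrier := A i\<rparr>). x \<noteq> \<one>\<^bsub>K\<lparr>carrier := A i\<rparr>\<^esub>" using x by auto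
  qed
  have carS: "carrier ?S = (\<Pi>\<^sub>E B\<in>?D. B)"
    using cgA by (subst carrier_sum_group) (auto simp: comm_group_def)
  have xD: "x B \<in> carrier K" if "x \<in> carrier ?S" "B \<in> ?D" for x B
    using that AK unfolding carS by (auto dest!: PiE_mem)
  have Fh: "F (?h x) = (\<Sum>i<n. F (x (A i)))" if x: "x \<in> carrier ?S" for x
  proof -
    have "?h x = finprod K x ?D" using xD[OF x] by (intro K.gfinprod_eq_finprod) auto
    also have "F \<dots> = (\<Sum>B\<in>?D. F (x B))" by (rule hom_finprod_additive[OF K F(1) xD[OF x]])
    also have "\<dots> = (\<Sum>i<n. F (x (A i)))" by (simp add: sum.reindex[OF injA])
    finally show ?thesis .
  qed
  have xA: "x (A i) \<in> A i" if "x \<in> carrier ?S" "i < n" for x i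
    using that unfolding carS by (auto dest!: PiE_mem)
  have coord: "F (?h x) j = F (x (A j)) j" if x: "x \<in> carrier ?S" and j: "j < n" for x j
  proof -
    have "F (?h x) j = (\<Sum>i<n. F (x (A i)) j)" by (simp add: Fh[OF x] sum_fun_apply)
    also have "\<dots> = (\<Sum>i<n. if i = j then F (x (A j)) j else 0)"
      by (rule sum.cong) (use xA[OF x] in \<open>auto simp: A_def\<close>)
    also have "\<dots> = F (x (A j)) j" using j by simp
    finally show ?thesis .
  qed
  have "?h \<in> iso ?S K"
  proof -
    have hom: "?h \<in> hom ?S K"
      by (rule K.hom_group_sum) (use AK cgA in \<open>auto simp: hom_def comm_group_def\<close>)
    have inj: "inj_on ?h (carrier ?S)"
    proof (rule inj_onI)
      fix x y assume xy: "x \<in> carrier ?S" "y \<in> carrier ?S" "?h x = ?h y"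
      have "x (A i) = y (A i)" if i: "i < n" for i
      proof -
        have "F (x (A i)) = F (y (A i))"
        proof
          fix j show "F (x (A i)) j = F (y (A i)) j"
            using xA[OF xy(1) i] xA[OF xy(2) i] coord[OF xy(1) i] coord[OF xy(2) i] xy(3)
            by (cases "j = i") (auto simp: A_def)
        qed
        then show ?thesis using xA[OF xy(1) i] xA[OF xy(2) i] F(2) by (auto simp: A_def inj_on_def)
      qed
      then show "x = y"
        using xy(1,2) unfolding carS by (intro PiE_ext[of x ?D "\<lambda>B. B" y]) auto
    qed
    have surj: "?h ` carrier ?S = carrier K"
    proof
      show "?h ` carrier ?S \<subseteq> carrier K" using hom by (auto simp: hom_def)
      show "carrier K \<subseteq> ?h ` carrier ?S"
      proof
        fix z assume z: "z \<in> carrier K"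
        then have Fz: "F z \<in> box n S" using im by blast
        have "\<forall>i\<in>{..<n}. \<exists>y. y \<in> A i \<and> F y = axis i (F z i)"
          using lift Fz unfolding box_def by fastforce
        then obtain y where y: "\<And>i. i < n \<Longrightarrow> y i \<in> A i" "\<And>i. i < n \<Longrightarrow> F (y i) = axis i (F z i)"
          by (metis lessThan_iff)
        \<comment> \<open>An element of the sum group is a function on the summands, so the
          coordinate index is recovered from the summand by inverting \<open>A\<close>.\<close>
        define x where "x = restrict (\<lambda>B. y (the_inv_into {..<n} A B)) ?D"
        have xi: "x (A i) = y i" if "i < n" for i
          using that by (simp add: x_def the_inv_into_f_f[OF injA])
        have x: "x \<in> carrier ?S"
          unfolding carS by (rule PiE_I) (use xi y(1) in \<open>auto simp: x_def\<close>)
        have "F (?h x) = F z"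
          unfolding Fh[OF x] using Fz by (simp add: xi y(2) sum_axis box_def)
        moreover have "?h x \<in> carrier K" using hom x by (auto simp: hom_def)
        ultimately have "?h x = z" using F(2) z by (auto simp: inj_on_def)
        then show "z \<in> ?h ` carrier ?S" using x by (intro image_eqI[of _ _ x]) auto
      qed
    qed
    show ?thesis using hom inj surj by (simp add: iso_def bij_betw_def)
  qed
  then have "rank_one_decomposition K ?D"
    unfolding rank_one_decomposition_def using subA rk by auto
  then show ?thesis unfolding completely_decomposable_def using K by blast
qed

lemma rat_common_denominator:
  fixes f :: "'i \<Rightarrow> rat"
  assumes "finite I"
  obtains N :: int where "N > 0" "\<And>i. i \<in> I \<Longrightarrow> \<exists>k::int. of_int N * f i = of_int k"
proof -
  have "\<exists>N>0. \<forall>i\<in>I. \<exists>k::int. of_int N * f i = of_int k"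
    using assms
  proof (induction I rule: finite_induct)
    case (insert i I)
    then obtain N where N: "N > 0" "\<And>j. j \<in> I \<Longrightarrow> \<exists>k::int. of_int N * f j = of_int k" by blast
    obtain u v where uv: "v > 0" "coprime u v" "f i = of_int u / of_int v" by (rule rat_lowest_terms)
    show ?case
    proof (rule exI[of _ "v * N"], intro conjI ballI)
      show "v * N > 0" using uv N by simp
      fix j assume "j \<in> insert i I"
      then consider "j = i" | "j \<in> I" by blast
      then show "\<exists>k::int. of_int (v * N) * f j = of_int k"
      proof cases
        case 1
        then show ?thesis using uv by (intro exI[of _ "N * u"]) simp
      next
        case 2
        then obtain k :: int where "of_int N * f j = of_int k" using N by blast
        then show ?thesis by (intro exI[of _ "v * k"]) (simp add: mult.assoc)
      qed
    qed
  qed (use zero_less_one in blast)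
  then show thesis using that by blast
qed

interpretation rat_fun: vector_space "\<lambda>(c::rat) (x::nat \<Rightarrow> rat) i. c * x i"
  by unfold_locales (auto simp: fun_eq_iff algebra_simps)

text \<open>Clearing denominators turns a rational relation into an integral one, so integral
  independence implies linear independence over the rationals, and the dimension bound
  applies.\<close>

lemma independent_in_card_le:
  fixes S :: "(nat \<Rightarrow> rat) set"
  assumes S: "add_subgroup S" "\<And>x i. x \<in> S \<Longrightarrow> i \<ge> n \<Longrightarrow> x i = 0"
    and B: "independent_in (additive_group S) B"
  shows "card B \<le> n"
proof -
  have fin: "finite B" and BS: "B \<subseteq> S" using B by (auto simp: independent_in_def)
  have "rat_fun.independent B"
  proof (rule rat_fun.independent_if_scalars_zero[OF fin])
    fix f x assume sum0: "(\<Sum>x\<in>B. (\<lambda>i. f x * x i)) = 0" and x: "x \<in> B"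
    obtain N where N: "N > 0" "\<And>x. x \<in> B \<Longrightarrow> \<exists>k::int. of_int N * f x = of_int k"
      using rat_common_denominator[OF fin, of f] by blast
    then obtain c where c: "\<And>x. x \<in> B \<Longrightarrow> of_int N * f x = of_int (c x)" by metis
    have "(\<Otimes>\<^bsub>additive_group S\<^esub>b\<in>B. b [^]\<^bsub>additive_group S\<^esub> c b) = (\<Sum>b\<in>B. b [^]\<^bsub>additive_group S\<^esub> c b)"
      by (rule finprod_additive_group[OF S(1)])
        (use BS S(1) in \<open>auto simp: int_pow_additive_group subset_iff intro: add_subgroup_of_int_mult\<close>)
    also have "\<dots> = (\<Sum>b\<in>B. of_int (c b) * b)"
      by (rule sum.cong) (use BS S(1) in \<open>auto simp: int_pow_additive_group subset_iff\<close>)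
    also have "\<dots> = of_int N * (\<Sum>b\<in>B. (\<lambda>i. f b * b i))"
      unfolding sum_distrib_left by (rule sum.cong) (auto simp: fun_eq_iff c[symmetric])
    also have "\<dots> = 0" using sum0 by simp
    finally have "\<forall>b\<in>B. c b = 0" using B by (simp add: independent_in_def)
    then show "f x = 0" using c[OF x] N(1) x by simp
  qed
  moreover have "B \<subseteq> rat_fun.span ((\<lambda>i. axis i 1) ` {..<n})"
  proof
    fix x assume "x \<in> B"
    then have "x = (\<Sum>i<n. axis i (x i))" using S(2) BS by (subst sum_axis) auto
    also have "\<dots> = (\<Sum>i<n. (\<lambda>j. x i * axis i 1 j))"
      by (rule sum.cong) (auto simp: axis_def fun_eq_iff)
    also have "\<dots> \<in> rat_fun.span ((\<lambda>i. axis i 1) ` {..<n})"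
      by (intro rat_fun.span_sum rat_fun.span_scale rat_fun.span_base) auto
    finally show "x \<in> rat_fun.span ((\<lambda>i. axis i 1) ` {..<n})" .
  qed
  ultimately have "card B \<le> card ((\<lambda>i. axis i 1) ` {..<n})"
    using rat_fun.independent_span_bound[of "(\<lambda>i. axis i 1) ` {..<n}" B] by simp
  also have "\<dots> \<le> n" using card_image_le[of "{..<n}" "\<lambda>i. axis i 1"] by simp
  finally show ?thesis .
qed

lemma torsion_free_additive_group: "torsion_free (additive_group (S :: (nat \<Rightarrow> rat) set))"
  unfolding torsion_free_def by (auto simp: nat_pow_additive_group fun_eq_iff)

section \<open>Rigid groups in coordinates\<close>

text \<open>The group generated by the box and the vector \<open>d\<close>.\<close>

definition cyclic_ext :: "nat \<Rightarrow> (nat \<Rightarrow> rat set) \<Rightarrow> (nat \<Rightarrow> rat) \<Rightarrow> (nat \<Rightarrow> rat) set" where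
  "cyclic_ext n R d = {x. (\<forall>i\<ge>n. x i = 0) \<and> (\<exists>k::int. \<forall>i<n. x i - of_int k * d i \<in> R i)}"

lemma cyclic_ext_iff:
  "x \<in> cyclic_ext n R d \<longleftrightarrow>
     (\<exists>h\<in>box n R. \<exists>k::int. x = h + of_int k * (\<lambda>i. if i < n then d i else 0))"
  (is "_ \<longleftrightarrow> (\<exists>h\<in>_. \<exists>k. x = h + of_int k * ?d)")
proof
  assume "x \<in> cyclic_ext n R d"
  then obtain k :: int where k: "\<forall>i<n. x i - of_int k * d i \<in> R i" and 0: "\<forall>i\<ge>n. x i = 0"
    by (auto simp: cyclic_ext_def)
  have "x - of_int k * ?d \<in> box n R" using k 0 by (simp add: box_def)
  then show "\<exists>h\<in>box n R. \<exists>k::int. x = h + of_int k * ?d"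
    by (intro bexI[of _ "x - of_int k * ?d"] exI[of _ k]) simp_all
next
  assume "\<exists>h\<in>box n R. \<exists>k::int. x = h + of_int k * ?d"
  then obtain h k where h: "h \<in> box n R" "x = h + of_int k * ?d" by blast
  then show "x \<in> cyclic_ext n R d"
    unfolding cyclic_ext_def box_def by (auto intro!: exI[of _ k])
qed

text \<open>
  \<open>pure\<close> expresses that the intersection of \<open>cyclic_ext n R d\<close> with the \<open>i\<close>-th axis is \<open>R i\<close>.
\<close>

locale rigid_frame =
  fixes n :: nat and R :: "nat \<Rightarrow> rat set" and d :: "nat \<Rightarrow> rat"
  assumes ring: "i < n \<Longrightarrow> rat_subring (R i)"
    and incomparable: "i < n \<Longrightarrow> j < n \<Longrightarrow> R i \<subseteq> R j \<Longrightarrow> i = j"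
    and pure: "i < n \<Longrightarrow> (\<And>j. j < n \<Longrightarrow> j \<noteq> i \<Longrightarrow> of_int k * d j \<in> R j) \<Longrightarrow> of_int k * d i \<in> R i"
begin

abbreviation "E \<equiv> cyclic_ext n R d"
abbreviation "H \<equiv> box n R"

lemma add_subgroup_R: "i < n \<Longrightarrow> add_subgroup (R i)"
  using ring rat_subringD(1) by blast

lemma zero_R [simp]: "i < n \<Longrightarrow> 0 \<in> R i"
  using add_subgroup_R add_subgroup_zero by blast

lemma add_subgroup_H: "add_subgroup H"
  by (rule add_subgroup_box) (rule add_subgroup_R)

lemma add_subgroup_E: "add_subgroup E"
  unfolding add_subgroup_def
proof (intro conjI ballI)
  show "0 \<in> E" by (auto simp: cyclic_ext_def intro!: exI[of _ 0])
  fix x y assume "x \<in> E" "y \<in> E"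
  then obtain k l :: int where k: "\<forall>i<n. x i - of_int k * d i \<in> R i" and l: "\<forall>i<n. y i - of_int l * d i \<in> R i"
    and 0: "\<forall>i\<ge>n. x i = 0" "\<forall>i\<ge>n. y i = 0" by (auto simp: cyclic_ext_def)
  have "(x - y) i - of_int (k - l) * d i \<in> R i" if i: "i < n" for i
  proof -
    have "(x - y) i - of_int (k - l) * d i = (x i - of_int k * d i) - (y i - of_int l * d i)"
      by (simp add: algebra_simps)
    then show ?thesis using add_subgroup_diff[OF add_subgroup_R[OF i]] k l i by metis
  qed
  then show "x - y \<in> E"
    unfolding cyclic_ext_def mem_Collect_eq by (intro conjI exI[of _ "k - l"]) (use 0 in auto)
qed

lemma H_subset_E: "H \<subseteq> E"
  by (auto simp: box_def cyclic_ext_def intro!: exI[of _ 0])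

lemma E_support: "x \<in> E \<Longrightarrow> i \<ge> n \<Longrightarrow> x i = 0"
  by (simp add: cyclic_ext_def)

lemma axis_mem_H: "i < n \<Longrightarrow> r \<in> R i \<Longrightarrow> axis i r \<in> H"
  by (rule axis_mem_box) simp_all

lemma axis_mem_E_iff:
  assumes i: "i < n"
  shows "axis i r \<in> E \<longleftrightarrow> r \<in> R i"
proof
  assume "axis i r \<in> E"
  then obtain k :: int where k: "\<And>j. j < n \<Longrightarrow> axis i r j - of_int k * d j \<in> R j"
    by (auto simp: cyclic_ext_def)
  have "of_int k * d i \<in> R i"
  proof (rule pure[OF i])
    fix j assume j: "j < n" "j \<noteq> i"
    then have "- (of_int k * d j) \<in> R j" using k[of j] by simp
    then show "of_int k * d j \<in> R j"
      using add_subgroup_minus[OF add_subgroup_R[OF j(1)]] by fastforce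
  qed
  moreover have "r - of_int k * d i \<in> R i" using k[OF i] by simp
  ultimately show "r \<in> R i"
    using add_subgroup_add[OF add_subgroup_R[OF i]] by fastforce
next
  assume "r \<in> R i" then show "axis i r \<in> E" using axis_mem_H[OF i] H_subset_E by blast
qed

definition dvec :: "nat \<Rightarrow> rat" where "dvec = (\<lambda>i. if i < n then d i else 0)"

lemma E_iff: "x \<in> E \<longleftrightarrow> (\<exists>h\<in>H. \<exists>k::int. x = h + of_int k * dvec)"
  unfolding dvec_def by (rule cyclic_ext_iff)

lemma dvec_mem_E: "dvec \<in> E"
  unfolding E_iff using add_subgroup_zero[OF add_subgroup_H]
  by (intro bexI[of _ 0] exI[of _ 1]) simp_all

text \<open>\<open>N\<close> clears the denominators of \<open>d\<close>. It bounds the exponent of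
  the quotient of \<open>E\<close> by \<open>H\<close> and allows coordinates of elements of
  \<open>E\<close> to be pushed into the rings.\<close>

lemma common_denominator:
  obtains N :: int where "N > 0" "\<And>x. x \<in> E \<Longrightarrow> of_int N * x \<in> H"
proof -
  obtain N :: int where N: "N > 0" "\<And>i. i < n \<Longrightarrow> \<exists>k::int. of_int N * d i = of_int k"
    using rat_common_denominator[of "{..<n}" d] by auto
  have "of_int N * x \<in> H" if xE: "x \<in> E" for x
  proof -
    obtain h k where h: "h \<in> H" "x = h + of_int k * dvec" using iffD1[OF E_iff xE] by blast
    have Nd: "of_int N * dvec \<in> H"
    proof -
      have "of_int N * d i \<in> R i" if i: "i < n" for i
      proof -
        obtain z :: int where "of_int N * d i = of_int z" using N(2)[OF i] by blast
        then show ?thesis using rat_subring_of_int[OF ring[OF i]] by simp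
      qed
      then show ?thesis by (simp add: box_def dvec_def)
    qed
    have "of_int N * h + of_int k * (of_int N * dvec) \<in> H"
      by (rule add_subgroup_add[OF add_subgroup_H add_subgroup_of_int_mult[OF add_subgroup_H h(1)]
            add_subgroup_of_int_mult[OF add_subgroup_H Nd]])
    then show ?thesis by (simp add: h(2) algebra_simps)
  qed
  then show thesis using that N(1) by blast
qed

lemma comm_group_E: "comm_group (additive_group E)"
  by (rule comm_group_additive_group[OF add_subgroup_E])

lemma comm_group_H: "comm_group (additive_group H)"
  by (rule comm_group_additive_group[OF add_subgroup_H])

lemma subgroup_H: "subgroup H (additive_group E)"
  by (simp add: subgroup_additive_group_iff[OF add_subgroup_E] H_subset_E add_subgroup_H)

section \<open>Endomorphisms and rank 1 summands\<close>

lemma axis_one_mem_E: "i < n \<Longrightarrow> axis i 1 \<in> E"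
  using axis_mem_E_iff rat_subringD(2)[OF ring] by simp

text \<open>
  The image of the \<open>i\<close>-th basis vector is divisible like an element of \<open>R i\<close>, and by
  incomparability only the \<open>i\<close>-th coordinate of an element of \<open>E\<close> can be so divisible.
\<close>

lemma endomorphism_axis:
  assumes \<phi>: "\<phi> \<in> hom (additive_group E) (additive_group E)" and i: "i < n" and l: "l \<noteq> i"
  shows "\<phi> (axis i 1) l = 0"
proof (rule ccontr)
  define c where "c = \<phi> (axis i 1)"
  assume "\<phi> (axis i 1) l \<noteq> 0"
  then have cl: "c l \<noteq> 0" by (simp add: c_def)
  have \<phi>E: "\<phi> x \<in> E" if "x \<in> E" for x using \<phi> that by (auto simp: hom_def)
  have \<phi>': "\<phi> \<in> hom (additive_group E) (additive_group UNIV)" using \<phi> by (auto simp: hom_def)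
  have \<phi>int: "\<phi> (of_int k * x) = of_int k * \<phi> x" if "x \<in> E" for k x
    using hom_additive_pow(2)[OF comm_group_E \<phi>'] that by (simp add: int_pow_additive_group[OF add_subgroup_E])
  have cE: "c \<in> E" unfolding c_def by (rule \<phi>E[OF axis_one_mem_E[OF i]])
  then have ln: "l < n" using E_support[OF cE, of l] cl by (meson linorder_not_less)
  \<comment> \<open>Coordinates of elements of \<open>E\<close> lie in \<open>R l\<close> only after
    multiplication by \<open>N\<close>, hence the scalar \<open>N * c l\<close> in the comparison of
    \<open>R i\<close> with \<open>R l\<close>.\<close>
  obtain N where N: "N > 0" "\<And>x. x \<in> E \<Longrightarrow> of_int N * x \<in> H" using common_denominator by blast
  have "R i \<subseteq> R l"
  proof (rule rat_subring_subset_if_scaled[OF ring[OF i] ring[OF ln]])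
    show "of_int N * c l \<noteq> 0" using N(1) cl by simp
    fix r assume r: "r \<in> R i"
    obtain a v where av: "v > 0" "coprime a v" "r = of_int a / of_int v" by (rule rat_lowest_terms)
    have rE: "axis i r \<in> E" using axis_mem_E_iff[OF i] r by simp
    define w where "w = \<phi> (axis i r)"
    have wE: "w \<in> E" unfolding w_def by (rule \<phi>E[OF rE])
    have "of_int v * axis i r = of_int a * axis i 1"
      using av by (simp add: of_int_times_axis)
    then have "of_int v * w = of_int a * c"
      unfolding w_def c_def using \<phi>int[OF rE] \<phi>int[OF axis_one_mem_E[OF i]] by metis
    then have "(of_int v * w) l = (of_int a * c) l" by simp
    then have "of_int v * w l = of_int a * c l" by simp
    then have "w l = (of_int a * c l) / of_int v" using av(1) by (simp add: eq_divide_eq mult.commute)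
    then have "w l = r * c l" using av(3) by simp
    moreover have "of_int N * w l \<in> R l" using N(2)[OF wE] ln by (simp add: box_def)
    ultimately show "of_int N * c l * r \<in> R l" by (simp add: mult_ac)
  qed
  then show False using incomparable[OF i ln] l by simp
qed

text \<open>Some positive multiple of \<open>x\<close> is an integral combination of the basis
  vectors, whose images are supported on their own axes; the multiple is cancelled in the rational
  coordinate.\<close>

lemma endomorphism_diagonal:
  assumes \<phi>: "\<phi> \<in> hom (additive_group E) (additive_group E)" and x: "x \<in> E" and l: "l < n"
  shows "\<phi> x l = x l * \<phi> (axis l 1) l"
proof -
  have \<phi>': "\<phi> \<in> hom (additive_group E) (additive_group UNIV)" using \<phi> by (auto simp: hom_def)
  have \<phi>int: "\<phi> (of_int k * x) = of_int k * \<phi> x" if "x \<in> E" for k x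
    using hom_additive_pow(2)[OF comm_group_E \<phi>'] that by (simp add: int_pow_additive_group[OF add_subgroup_E])
  have \<phi>sum: "\<phi> (\<Sum>i\<in>I. g i) = (\<Sum>i\<in>I. \<phi> (g i))" if "\<And>i. i \<in> I \<Longrightarrow> g i \<in> E" for I :: "nat set" and g
    using hom_finprod_additive[OF comm_group_E \<phi>', of I g] that by (simp add: finprod_additive_group[OF add_subgroup_E])
  obtain M :: int where M: "M > 0" "\<And>i. i < n \<Longrightarrow> \<exists>z::int. of_int M * x i = of_int z"
    using rat_common_denominator[of "{..<n}" x] by auto
  then obtain z where z: "\<And>i. i < n \<Longrightarrow> of_int M * x i = of_int (z i)" by metis
  have "of_int M * x = (\<Sum>i<n. axis i ((of_int M * x) i))"
    using E_support[OF x] by (subst sum_axis) auto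
  also have "\<dots> = (\<Sum>i<n. of_int (z i) * axis i 1)"
    by (rule sum.cong) (auto simp: of_int_times_axis z[symmetric])
  finally have eq: "of_int M * x = (\<Sum>i<n. of_int (z i) * axis i 1)" .
  have "of_int M * \<phi> x = (\<Sum>i<n. \<phi> (of_int (z i) * axis i 1))"
    unfolding \<phi>int[OF x, symmetric] eq
    by (rule \<phi>sum) (use axis_one_mem_E add_subgroup_of_int_mult[OF add_subgroup_E] in auto)
  also have "\<dots> = (\<Sum>i<n. of_int (z i) * \<phi> (axis i 1))"
    by (rule sum.cong) (use \<phi>int axis_one_mem_E in auto)
  finally have "(of_int M * \<phi> x) l = (\<Sum>i<n. of_int (z i) * \<phi> (axis i 1)) l" by simp
  then have "of_int M * \<phi> x l = (\<Sum>i<n. of_int (z i) * \<phi> (axis i 1) l)"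
    by (simp add: sum_fun_apply)
  also have "\<dots> = (\<Sum>i<n. if i = l then of_int (z l) * \<phi> (axis l 1) l else 0)"
    by (rule sum.cong) (use endomorphism_axis[OF \<phi>] in auto)
  also have "\<dots> = of_int M * x l * \<phi> (axis l 1) l" using l by (simp add: z)
  finally show ?thesis using M(1) by simp
qed

text \<open>
  Projecting the \<open>k\<close>-th multiple of an element onto a rank 1 summand is an endomorphism of \<open>E\<close>,
  hence diagonal; so the summand contains a multiple of each basis vector on which it is supported.
\<close>

lemma rank_one_summand_axis:
  assumes K: "add_subgroup K" "K \<subseteq> E" and k: "k > 0" "\<And>x. x \<in> E \<Longrightarrow> of_int k * x \<in> K"
    and D: "rank_one_decomposition (additive_group K) D" and B: "B \<in> D"
  obtains i where "i < n" "\<And>b j. b \<in> B \<Longrightarrow> j \<noteq> i \<Longrightarrow> b j = 0"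
proof -
  have cK: "comm_group (additive_group K)" using K(1) by (rule comm_group_additive_group)
  obtain \<pi>' where "summand_projections (additive_group K) D \<pi>'"
    using rank_one_decomposition_projections[OF cK D] by blast
  note \<pi>' = summand_projectionsD[OF this, unfolded additive_group_simps]
  define \<pi> where "\<pi> = \<pi>' B"
  note \<pi> = \<pi>'(1-3)[OF B, folded \<pi>_def]
  have "subgroup B (additive_group K)" and rkB: "rank_one_group (additive_group B)"
    using D B by (auto simp: rank_one_decomposition_def)
  then have BK: "B \<subseteq> K" and sB: "add_subgroup B"
    using subgroup_additive_group_iff[OF K(1)] by auto
  define \<phi> where "\<phi> x = \<pi> (of_int k * x)" for x
  have \<phi>B: "\<phi> x \<in> B" if "x \<in> E" for x unfolding \<phi>_def by (rule \<pi>(2)[OF k(2)[OF that]])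
  have \<phi>: "\<phi> \<in> hom (additive_group E) (additive_group E)"
  proof (rule homI)
    fix x y assume "x \<in> carrier (additive_group E)" "y \<in> carrier (additive_group E)"
    then have "\<pi> (of_int k * x + of_int k * y) = \<pi> (of_int k * x) + \<pi> (of_int k * y)"
      using \<pi>(1) k(2) by (simp add: hom_def)
    then show "\<phi> (x \<otimes>\<^bsub>additive_group E\<^esub> y) = \<phi> x \<otimes>\<^bsub>additive_group E\<^esub> \<phi> y"
      by (simp add: \<phi>_def distrib_left)
  qed (use \<phi>B BK K(2) in auto)
  obtain f where f: "f \<in> hom (additive_group B) rat_group" "inj_on f B" and fne: "\<exists>x\<in>B. f x \<noteq> 0"
    using rank_one_group_embedding[OF rkB] by auto
  have f0: "f 0 = 0" using f(1) add_subgroup_zero[OF sB] by (auto simp: hom_def dest!: bspec[of _ _ 0])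
  have fint: "f (of_int l * x) = of_int l * f x" if "x \<in> B" for l x
    using hom_additive_pow(2)[OF comm_group_additive_group[OF sB] f(1)] that
    by (simp add: int_pow_additive_group[OF sB])
  have f_nonzero: "f x \<noteq> 0" if "x \<in> B" "x \<noteq> 0" for x
    using f(2) f0 that add_subgroup_zero[OF sB] by (metis inj_onD)
  have key: "j < n" "axis j (of_int k) \<in> B" if b: "b \<in> B" and bj: "b j \<noteq> 0" for b j
  proof -
    have bE: "b \<in> E" using b BK K(2) by blast
    show j: "j < n" using E_support[OF bE, of j] bj by (meson linorder_not_less)
    \<comment> \<open>\<open>\<pi>\<close> fixes \<open>B\<close>, so \<open>\<phi>\<close>
      multiplies \<open>b\<close> by \<open>k\<close>; the diagonal form then forces its
      \<open>j\<close>-th entry to be \<open>k\<close>.\<close>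
    have "\<phi> b = of_int k * b"
      unfolding \<phi>_def by (rule \<pi>(3)) (rule add_subgroup_of_int_mult[OF sB b])
    then have "of_int k * b j = b j * \<phi> (axis j 1) j"
      using endomorphism_diagonal[OF \<phi> bE j] by simp
    then have "\<phi> (axis j 1) j = of_int k" using bj by simp
    then have "\<phi> (axis j 1) = axis j (of_int k)"
      using eq_axisI[of j "\<phi> (axis j 1)"] endomorphism_axis[OF \<phi> j] by simp
    then show "axis j (of_int k) \<in> B" using \<phi>B[OF axis_one_mem_E[OF j]] by simp
  qed
  obtain b0 where b0: "b0 \<in> B" "b0 \<noteq> 0" using fne f0 by metis
  then obtain i where i: "b0 i \<noteq> 0" by (auto simp: fun_eq_iff)
  have "b j = 0" if b: "b \<in> B" and j: "j \<noteq> i" for b j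
  proof (rule ccontr)
    assume "b j \<noteq> 0"
    \<comment> \<open>Multiples of two different basis vectors would both lie in \<open>B\<close>,
      and rank 1 would make them proportional.\<close>
    note B2 = key(2)[OF b this] key(2)[OF b0(1) i]
    have ne: "axis j (of_int k) \<noteq> 0" "axis i (of_int k) \<noteq> 0" using k(1) by simp_all
    obtain \<alpha> \<beta> :: int where ab: "\<alpha> \<noteq> 0" "of_int \<alpha> * f (axis j (of_int k)) = of_int \<beta> * f (axis i (of_int k))"
      using rat_common_multiple[OF f_nonzero[OF B2(1) ne(1)] f_nonzero[OF B2(2) ne(2)]] by metis
    then have "f (of_int \<alpha> * axis j (of_int k)) = f (of_int \<beta> * axis i (of_int k))"
      using fint B2 by simp
    then have "of_int \<alpha> * axis j (of_int k) = of_int \<beta> * axis i (of_int k)"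
      by (rule inj_onD[OF f(2)]) (use B2 add_subgroup_of_int_mult[OF sB] in auto)
    then have "(of_int \<alpha> * axis j (of_int k)) j = (of_int \<beta> * axis i (of_int k)) j" by simp
    then show False using ab(1) k(1) j by simp
  qed
  then show thesis using that key(1)[OF b0(1) i] by blast
qed

section \<open>The regulator of \<open>E\<close>\<close>

lemma gfinprod_mem:
  assumes K: "add_subgroup K" and S: "add_subgroup S" and f: "\<And>A. A \<in> D \<Longrightarrow> f A \<in> K \<inter> S"
  shows "gfinprod (additive_group K) f D \<in> S"
proof (cases "finite {A \<in> D. f A \<noteq> 0}")
  case True
  have "finprod (additive_group K) f {A \<in> D. f A \<noteq> 0} = sum f {A \<in> D. f A \<noteq> 0}"
    by (rule finprod_additive_group[OF K]) (use f in auto)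
  also have "\<dots> \<in> S" by (rule add_subgroup_sum[OF S]) (use f in auto)
  finally show ?thesis using True by (simp add: gfinprod_def)
next
  \<comment> \<open>With infinitely many nontrivial factors, \<open>gfinprod\<close> takes the
    neutral element as its default value.\<close>
  case False
  then show ?thesis using add_subgroup_zero[OF S] by (simp add: gfinprod_def)
qed

text \<open>Each rank 1 summand of \<open>K\<close> lies on a coordinate axis, and by
  \<open>pure\<close> the axis meets \<open>E\<close> in \<open>R i\<close>. Hence the summands, and
  with them \<open>K\<close>, lie in \<open>H\<close>, which is what identifies the
  regulator.\<close>

lemma cd_subgroups_le_H:
  assumes "K \<in> cd_subgroups (additive_group E)"
  shows "K \<subseteq> H"
proof
  have sub: "subgroup K (additive_group E)" and fin: "finite (rcosets\<^bsub>additive_group E\<^esub> K)"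
    and cd: "completely_decomposable (additive_group K)"
    using assms by (auto simp: cd_subgroups_def)
  have K: "add_subgroup K" "K \<subseteq> E" using sub subgroup_additive_group_iff[OF add_subgroup_E] by auto
  obtain D where D: "rank_one_decomposition (additive_group K) D"
    using cd by (auto simp: completely_decomposable_def)
  have cK: "comm_group (additive_group K)" using K(1) by (rule comm_group_additive_group)
  let ?k = "card (rcosets\<^bsub>additive_group E\<^esub> K)"
  \<comment> \<open>The index multiplies \<open>E\<close> into \<open>K\<close>; this makes the
    projections of \<open>K\<close> usable as endomorphisms of \<open>E\<close>.\<close>
  have k: "of_int (int ?k) * x \<in> K" "int ?k > 0" if "x \<in> E" for x
    using finite_index_pow[OF comm_group_E sub fin, of x] that by (simp_all add: nat_pow_additive_group)
  have k0: "int ?k > 0" using k(2)[OF add_subgroup_zero[OF add_subgroup_E]] .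
  obtain \<pi> where "summand_projections (additive_group K) D \<pi>"
    using rank_one_decomposition_projections[OF cK D] by blast
  note \<pi> = summand_projectionsD(2,5)[OF this, unfolded additive_group_simps]
  have BH: "B \<subseteq> K \<inter> H" if B: "B \<in> D" for B
  proof
    fix b assume b: "b \<in> B"
    have "subgroup B (additive_group K)" using D B by (auto simp: rank_one_decomposition_def)
    then have bK: "b \<in> K" using subgroup_additive_group_iff[OF K(1)] b by auto
    obtain i where i: "i < n" "\<And>b j. b \<in> B \<Longrightarrow> j \<noteq> i \<Longrightarrow> b j = 0"
      using rank_one_summand_axis[OF K k0 k(1) D B] by blast
    have eq: "b = axis i (b i)" by (rule eq_axisI) (rule i(2)[OF b])
    then have "b i \<in> R i" using bK K(2) axis_mem_E_iff[OF i(1)] by (metis subsetD)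
    then have "axis i (b i) \<in> H" by (rule axis_mem_H[OF i(1)])
    then show "b \<in> K \<inter> H" using eq bK by simp
  qed
  fix x assume x: "x \<in> K"
  have "gfinprod (additive_group K) (\<lambda>A. \<pi> A x) D \<in> H"
    by (rule gfinprod_mem[OF K(1) add_subgroup_H]) (use \<pi>(1)[OF _ x] BH in blast)
  then show "x \<in> H" using \<pi>(2)[OF x] by simp
qed

lemma H_cd: "completely_decomposable (additive_group H)"
proof (rule completely_decomposable_box)
  show "comm_group (additive_group H)" by (rule comm_group_H)
  show "(\<lambda>x. x) \<in> hom (additive_group H) (additive_group UNIV)" by (simp add: hom_def)
  show "inj_on (\<lambda>x. x) (carrier (additive_group H))" by simp
  show "(\<lambda>x. x) ` carrier (additive_group H) = box n R" by simp
  show "add_subgroup (R i)" if "i < n" for i using that by (rule add_subgroup_R)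
  show "\<exists>s\<in>R i. s \<noteq> 0" if "i < n" for i
    using rat_subringD(2)[OF ring[OF that]] by (intro bexI[of _ 1]) auto
qed

lemma r_coset_additive_group: "K #>\<^bsub>additive_group S\<^esub> x = (\<lambda>h. h + x) ` K"
  by (auto simp: r_coset_def)

lemma H_coset_dvec:
  assumes "x \<in> E"
  obtains k :: int where "H #>\<^bsub>additive_group E\<^esub> x = H #>\<^bsub>additive_group E\<^esub> (of_int k * dvec)"
proof -
  interpret E: comm_group "additive_group E" by (rule comm_group_E)
  obtain h and k :: int where h: "h \<in> H" "x = h + of_int k * dvec" using iffD1[OF E_iff assms] by blast
  have dE: "of_int k * dvec \<in> E" by (rule add_subgroup_of_int_mult[OF add_subgroup_E dvec_mem_E])
  have "x \<in> H #>\<^bsub>additive_group E\<^esub> (of_int k * dvec)" using h by (auto simp: r_coset_additive_group)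
  then have "H #>\<^bsub>additive_group E\<^esub> (of_int k * dvec) = H #>\<^bsub>additive_group E\<^esub> x"
    by (rule E.repr_independence[OF _ _ subgroup_H]) (use dE in simp)
  then show thesis using that by metis
qed

lemma finite_rcosets_H: "finite (rcosets\<^bsub>additive_group E\<^esub> H)"
proof -
  interpret E: comm_group "additive_group E" by (rule comm_group_E)
  obtain N where N: "N > 0" "\<And>x. x \<in> E \<Longrightarrow> of_int N * x \<in> H" using common_denominator by blast
  have "rcosets\<^bsub>additive_group E\<^esub> H \<subseteq> (\<lambda>k. H #>\<^bsub>additive_group E\<^esub> (of_int k * dvec)) ` {0..<N}"
  proof
    fix X assume "X \<in> rcosets\<^bsub>additive_group E\<^esub> H"
    then obtain x where x: "x \<in> E" "X = H #>\<^bsub>additive_group E\<^esub> x" by (auto simp: RCOSETS_def)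
    obtain k where k: "X = H #>\<^bsub>additive_group E\<^esub> (of_int k * dvec)"
      using H_coset_dvec[OF x(1)] x(2) by metis
    have dE: "of_int l * dvec \<in> E" for l by (rule add_subgroup_of_int_mult[OF add_subgroup_E dvec_mem_E])
    \<comment> \<open>Division with remainder: the part divisible by \<open>N\<close> lies in
      \<open>H\<close>, so \<open>N\<close> representatives cover all cosets.\<close>
    have "of_int (N * (k div N) + k mod N) * dvec = of_int N * (of_int (k div N) * dvec) + of_int (k mod N) * dvec"
      by (simp only: of_int_add of_int_mult distrib_right mult.assoc)
    then have "of_int k * dvec = of_int N * (of_int (k div N) * dvec) + of_int (k mod N) * dvec"
      by (simp only: mult_div_mod_eq)
    then have "of_int k * dvec \<in> H #>\<^bsub>additive_group E\<^esub> (of_int (k mod N) * dvec)"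
      using N(2)[OF dE] by (auto simp: r_coset_additive_group)
    then have "X = H #>\<^bsub>additive_group E\<^esub> (of_int (k mod N) * dvec)"
      unfolding k by (intro E.repr_independence[OF _ _ subgroup_H, symmetric]) (use dE in simp_all)
    then show "X \<in> (\<lambda>k. H #>\<^bsub>additive_group E\<^esub> (of_int k * dvec)) ` {0..<N}"
      using N(1) by (intro image_eqI[of _ _ "k mod N"]) auto
  qed
  then show ?thesis by (rule finite_subset) simp
qed

lemma H_mem_cd_subgroups: "H \<in> cd_subgroups (additive_group E)"
  unfolding cd_subgroups_def using subgroup_H finite_rcosets_H H_cd by simp

lemma Reg_E: "Reg (additive_group E) = H"
  by (rule Reg_eq_greatest[OF comm_group_E H_mem_cd_subgroups cd_subgroups_le_H])

lemma ACD_E: "ACD_group (additive_group E)"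
proof -
  have "card B \<le> n" if "independent_in (additive_group E) B" for B
    by (rule independent_in_card_le[OF add_subgroup_E _ that]) (rule E_support)
  then have "\<exists>m. has_rank (additive_group E) m" using comm_group_E by (rule has_rankI_bound)
  then show ?thesis
    unfolding ACD_group_def using comm_group_E torsion_free_additive_group H_mem_cd_subgroups by blast
qed

lemma cyclic_E: "cyclic_group (additive_group E Mod H)"
proof -
  interpret E: comm_group "additive_group E" by (rule comm_group_E)
  interpret normal H "additive_group E" using subgroup_H by (simp add: E.subgroup_imp_normal)
  interpret Q: group "additive_group E Mod H" by (rule factorgroup_is_group)
  have d: "dvec \<in> carrier (additive_group E)" using dvec_mem_E by simp
  let ?X = "H #>\<^bsub>additive_group E\<^esub> dvec"
  have pow: "?X [^]\<^bsub>additive_group E Mod H\<^esub> (k::int) = H #>\<^bsub>additive_group E\<^esub> (of_int k * dvec)" for k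
    using FactGroup_int_pow[OF d] by (simp add: int_pow_additive_group[OF add_subgroup_E dvec_mem_E])
  have X: "?X \<in> carrier (additive_group E Mod H)" using d by (auto simp: carrier_FactGroup)
  have "carrier (additive_group E Mod H) = range (\<lambda>k::int. ?X [^]\<^bsub>additive_group E Mod H\<^esub> k)"
  proof
    show "carrier (additive_group E Mod H) \<subseteq> range (\<lambda>k::int. ?X [^]\<^bsub>additive_group E Mod H\<^esub> k)"
    proof
      fix Y assume "Y \<in> carrier (additive_group E Mod H)"
      then obtain x where x: "x \<in> E" "Y = H #>\<^bsub>additive_group E\<^esub> x" by (auto simp: carrier_FactGroup)
      obtain k where "Y = H #>\<^bsub>additive_group E\<^esub> (of_int k * dvec)"
        using H_coset_dvec[OF x(1)] x(2) by metis
      then show "Y \<in> range (\<lambda>k::int. ?X [^]\<^bsub>additive_group E Mod H\<^esub> k)" unfolding pow by blast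
    qed
    show "range (\<lambda>k::int. ?X [^]\<^bsub>additive_group E Mod H\<^esub> k) \<subseteq> carrier (additive_group E Mod H)"
      using Q.int_pow_closed[OF X] by auto
  qed
  then show ?thesis unfolding Q.cyclic_group using X by blast
qed

section \<open>Critical types of \<open>E\<close>\<close>

definition axis_type :: "nat \<Rightarrow> (nat \<Rightarrow> enat) set" where
  "axis_type i = {\<chi>. char_equiv (ring_char (R i)) \<chi>}"

text \<open>Needed for every \<open>D\<close>, since \<open>Reg_decomposition\<close> is an
  unspecified choice. \<open>B\<close> lies on one axis and, as a direct summand, contains every
  element of \<open>H\<close> of which it contains a nonzero multiple; so it is the full axis of
  \<open>H\<close>, with ring \<open>R i\<close>.\<close>

lemma type_of_summand:
  assumes D: "rank_one_decomposition (additive_group H) D" and B: "B \<in> D"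
  shows "\<exists>i<n. type_of (additive_group B) = axis_type i"
proof -
  obtain N where N: "N > 0" "\<And>x. x \<in> E \<Longrightarrow> of_int N * x \<in> H" using common_denominator by blast
  obtain i where i: "i < n" "\<And>b j. b \<in> B \<Longrightarrow> j \<noteq> i \<Longrightarrow> b j = 0"
    using rank_one_summand_axis[OF add_subgroup_H H_subset_E N D B] by blast
  obtain \<pi> where "summand_projections (additive_group H) D \<pi>"
    using rank_one_decomposition_projections[OF comm_group_H D] by blast
  note \<pi> = summand_projectionsD[OF this, unfolded additive_group_simps]
  have sub: "subgroup B (additive_group H)" and rkB: "rank_one_group (additive_group B)"
    using D B by (auto simp: rank_one_decomposition_def)
  then have BH: "B \<subseteq> H" and sB: "add_subgroup B"
    using subgroup_additive_group_iff[OF add_subgroup_H] by auto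
  have Bax: "b = axis i (b i)" if "b \<in> B" for b
    by (rule eq_axisI) (rule i(2)[OF that])
  obtain f where f: "f \<in> hom (additive_group B) rat_group" "inj_on f B" and fne: "\<exists>x\<in>B. f x \<noteq> 0"
    using rank_one_group_embedding[OF rkB] by auto
  from f(1) have "f 0 = 0" using add_subgroup_zero[OF sB] by (auto simp: hom_def dest!: bspec[of _ _ 0])
  then obtain b0 where b0: "b0 \<in> B" "b0 \<noteq> 0" using fne by metis
  then have b0i: "b0 i \<noteq> 0" using Bax[OF b0(1)] axis_eq_0_iff by metis
  have img: "(\<lambda>x. x i) ` B = R i"
  proof
    show "(\<lambda>x. x i) ` B \<subseteq> R i" using BH i(1) by (auto simp: box_def)
    show "R i \<subseteq> (\<lambda>x. x i) ` B"
    proof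
      fix r assume r: "r \<in> R i"
      define x where "x = axis i r"
      have xH: "x \<in> H" unfolding x_def by (rule axis_mem_H[OF i(1) r])
      have "x \<in> B"
      proof (cases "r = 0")
        case True
        then show ?thesis using add_subgroup_zero[OF sB] by (metis axis_eq_0_iff x_def)
      next
        case False
        obtain \<alpha> \<beta> :: int where ab: "\<alpha> \<noteq> 0" "of_int \<alpha> * r = of_int \<beta> * b0 i"
          using rat_common_multiple[OF False b0i] by metis
        have eq: "of_int \<alpha> * x = of_int \<beta> * b0"
          unfolding x_def of_int_times_axis ab(2) by (subst (2) Bax[OF b0(1)]) (simp only: of_int_times_axis)
        \<comment> \<open>A nonzero multiple of \<open>x\<close> is a multiple of \<open>b0\<close>
          in \<open>B\<close>, so every other projection kills that multiple, and by
          torsion-freeness \<open>x\<close> itself.\<close>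
        have \<pi>0: "\<pi> A x = 0" if A: "A \<in> D" "A \<noteq> B" for A
        proof -
          have hom: "\<pi> A \<in> hom (additive_group H) (additive_group UNIV)"
            using \<pi>(1)[OF A(1)] by (auto simp: hom_def)
          have \<pi>int: "\<pi> A (of_int l * y) = of_int l * \<pi> A y" if "y \<in> H" for l y
            using hom_additive_pow(2)[OF comm_group_H hom] that by (simp add: int_pow_additive_group[OF add_subgroup_H])
          have "of_int \<alpha> * \<pi> A x = of_int \<beta> * \<pi> A b0"
            using \<pi>int[OF xH] \<pi>int[of b0] b0(1) BH eq by (metis subsetD)
          also have "\<dots> = 0" using \<pi>(4)[OF A(1) B A(2) b0(1)] by simp
          finally show ?thesis using ab(1) by (auto simp: fun_eq_iff)
        qed
        have "x = gfinprod (additive_group H) (\<lambda>A. \<pi> A x) D" using \<pi>(5)[OF xH] by simp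
        also have "\<dots> \<in> B"
        proof (rule gfinprod_mem[OF add_subgroup_H sB])
          fix A assume A: "A \<in> D"
          show "\<pi> A x \<in> H \<inter> B"
          proof (cases "A = B")
            case True
            then show ?thesis using \<pi>(2)[OF B xH] BH by auto
          next
            case False
            then show ?thesis using \<pi>0[OF A] add_subgroup_zero[OF sB] add_subgroup_zero[OF add_subgroup_H] by simp
          qed
        qed
        finally show ?thesis .
      qed
      then show "r \<in> (\<lambda>x. x i) ` B" by (intro image_eqI[of _ _ x]) (simp_all add: x_def)
    qed
  qed
  have "type_of (additive_group B) = axis_type i"
    unfolding axis_type_def img[symmetric]
  proof (rule type_of_ring[of "additive_group B" "\<lambda>x. x i", unfolded additive_group_simps(1)])
    show "comm_group (additive_group B)" by (rule comm_group_additive_group[OF sB])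
    show "(\<lambda>x. x i) \<in> hom (additive_group B) rat_group" by (simp add: hom_def)
    show "inj_on (\<lambda>x. x i) B" by (rule inj_onI) (metis Bax)
    show "rat_subring ((\<lambda>x. x i) ` B)" unfolding img by (rule ring[OF i(1)])
  qed
  then show ?thesis using i(1) by blast
qed

text \<open>By \<open>Reg_E\<close> the chosen decomposition is one of the box, and a nontrivial
  part requires a summand of its type. Block rigidity and ring type are universal in the critical
  types, so an upper bound on them is the right form.\<close>

lemma critical_types_E: "critical_types (additive_group E) \<subseteq> axis_type ` {..<n}"
proof
  let ?E = "additive_group E"
  interpret E: comm_group ?E by (rule comm_group_E)
  have "\<exists>D. rank_one_decomposition (additive_group H) D" using H_cd by (simp add: completely_decomposable_def)
  then have D: "rank_one_decomposition (additive_group H) (Reg_decomposition ?E)"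
    unfolding Reg_decomposition_def Reg_E additive_group_simps(4) by (rule someI_ex)
  fix \<tau> assume "\<tau> \<in> critical_types ?E"
  then have "Reg_part ?E \<tau> \<noteq> {0}" by (simp add: critical_types_def)
  then have "{A \<in> Reg_decomposition ?E. type_of (additive_group A) = \<tau>} \<noteq> {}"
    using E.generate_empty unfolding Reg_part_def additive_group_simps(4) by force
  then obtain A where A: "A \<in> Reg_decomposition ?E" "type_of (additive_group A) = \<tau>" by blast
  obtain i where "i < n" "type_of (additive_group A) = axis_type i"
    using type_of_summand[OF D A(1)] by blast
  then show "\<tau> \<in> axis_type ` {..<n}" using A(2) by simp
qed

text \<open>The places where a characteristic is infinite are invariants of its class, and for
  \<open>ring_char\<close> they are the inverted primes. Comparable types thus give an inclusion of
  rings.\<close>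

lemma type_le_axis_type:
  assumes i: "i < n" and j: "j < n" and le: "type_le (axis_type i) (axis_type j)"
  shows "i = j"
proof -
  obtain \<chi> \<psi> where \<chi>: "char_equiv (ring_char (R i)) \<chi>" and \<psi>: "char_equiv (ring_char (R j)) \<psi>"
    and le: "\<And>p. prime p \<Longrightarrow> \<chi> p \<le> \<psi> p"
    using le by (auto simp: type_le_def axis_type_def)
  have "R i \<subseteq> R j"
  proof (rule rat_subring_subsetI[OF ring[OF i] ring[OF j]])
    fix p :: nat assume p: "prime p" "1 / of_nat p \<in> R i"
    have "ring_char (R i) p = \<infinity> \<longleftrightarrow> \<chi> p = \<infinity>" using \<chi> p(1) unfolding char_equiv_def by blast
    then have "\<chi> p = \<infinity>" using p(2) by (simp add: ring_char_def)
    then have "\<psi> p = \<infinity>" using le[OF p(1)] by simp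
    then have "ring_char (R j) p = \<infinity>" using \<psi> p(1) unfolding char_equiv_def by blast
    then show "1 / of_nat p \<in> R j" by (simp add: ring_char_def split: if_splits)
  qed
  then show ?thesis using incomparable i j by blast
qed

lemma class_A0_E: "class_A0 (additive_group E)"
proof -
  have 1: "block_rigid (additive_group E)"
    unfolding block_rigid_def
  proof (intro ballI impI)
    fix \<sigma> \<tau> assume "\<sigma> \<in> critical_types (additive_group E)" "\<tau> \<in> critical_types (additive_group E)" and ne: "\<sigma> \<noteq> \<tau>"
    then have "\<sigma> \<in> axis_type ` {..<n}" "\<tau> \<in> axis_type ` {..<n}"
      using critical_types_E by (blast dest: subsetD)+
    then obtain i j where ij: "i < n" "j < n" "\<sigma> = axis_type i" "\<tau> = axis_type j" by auto
    then have "i \<noteq> j" using ne by auto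
    then show "\<not> type_le \<sigma> \<tau> \<and> \<not> type_le \<tau> \<sigma>"
      using type_le_axis_type[OF ij(1,2)] type_le_axis_type[OF ij(2,1)] ij(3,4) by auto
  qed
  have idem: "idempotent_type (axis_type i)" for i
    unfolding idempotent_type_iff[OF axis_type_def]
    by (rule bexI[of _ "ring_char (R i)"]) (simp_all add: ring_char_def axis_type_def char_equiv_refl)
  have 2: "of_ring_type (additive_group E)"
    unfolding of_ring_type_def
  proof
    fix \<tau> assume "\<tau> \<in> critical_types (additive_group E)"
    then obtain i where "\<tau> = axis_type i" using subsetD[OF critical_types_E] by blast
    then show "idempotent_type \<tau>" using idem by simp
  qed
  show ?thesis
    unfolding class_A0_def Reg_E by (intro conjI ACD_E 1 2 cyclic_E)
qed

end

section \<open>Tensor products and multiplications\<close>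

text \<open>The pure tensor of \<open>x\<close> and \<open>y\<close>, as a coset in the quotient of
  the free Abelian group.\<close>

definition tensor ::
    "('a, 'm) monoid_scheme \<Rightarrow> ('b, 'n) monoid_scheme \<Rightarrow> 'a \<Rightarrow> 'b \<Rightarrow> ('a \<times> 'b \<Rightarrow>\<^sub>0 int) set" where
  "tensor G H x y =
     generate (free_Abelian_group (carrier G \<times> carrier H)) (tensor_relations G H)
       #>\<^bsub>free_Abelian_group (carrier G \<times> carrier H)\<^esub> frag_of (x, y)"

context
  fixes G :: "('a, 'm) monoid_scheme" and H :: "('b, 'n) monoid_scheme"
  assumes G: "comm_group G" and H: "comm_group H"
begin

abbreviation "FA \<equiv> free_Abelian_group (carrier G \<times> carrier H)"
abbreviation "TR \<equiv> generate FA (tensor_relations G H)"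

lemma tensor_relations_subset: "tensor_relations G H \<subseteq> carrier FA"
proof -
  interpret G: comm_group G by (rule G)
  interpret H: comm_group H by (rule H)
  have "u - v - w \<in> carrier FA" if "u \<in> carrier FA" "v \<in> carrier FA" "w \<in> carrier FA" for u v w
    using that by (auto dest!: subsetD[OF keys_diff])
  moreover have "frag_of (x, y) \<in> carrier FA" if "x \<in> carrier G" "y \<in> carrier H" for x y
    using that by simp
  ultimately show ?thesis
    unfolding tensor_relations_def by (fastforce simp del: carrier_free_Abelian_group_iff)
qed

lemma normal_TR: "TR \<lhd> FA"
proof -
  interpret F: comm_group FA by (rule abelian_free_Abelian_group)
  show ?thesis
    by (rule F.subgroup_imp_normal[OF F.generate_is_subgroup[OF tensor_relations_subset]])
qed

lemma tensor_group_eq: "tensor_group G H = FA Mod TR"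
  by (simp add: tensor_group_def Let_def)

lemma group_tensor_group: "group (tensor_group G H)"
  unfolding tensor_group_eq by (rule normal.factorgroup_is_group[OF normal_TR])

lemma tensor_closed: "x \<in> carrier G \<Longrightarrow> y \<in> carrier H \<Longrightarrow> tensor G H x y \<in> carrier (tensor_group G H)"
  unfolding tensor_group_eq tensor_def carrier_FactGroup by (rule imageI) simp

text \<open>The common core of additivity in either argument: a defining relation lies in the
  subgroup factored out.\<close>

lemma tensor_sum_eqI:
  assumes "frag_of u - frag_of v - frag_of w \<in> tensor_relations G H"
    and "u \<in> carrier G \<times> carrier H" "v \<in> carrier G \<times> carrier H" "w \<in> carrier G \<times> carrier H"
  shows "TR #>\<^bsub>FA\<^esub> frag_of u = (TR #>\<^bsub>FA\<^esub> frag_of v) \<otimes>\<^bsub>tensor_group G H\<^esub> (TR #>\<^bsub>FA\<^esub> frag_of w)"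
proof -
  interpret F: comm_group FA by (rule abelian_free_Abelian_group)
  have vw: "frag_of v + frag_of w \<in> carrier FA"
    using F.m_closed[of "frag_of v" "frag_of w"] assms(3,4) by simp
  have "frag_of u - frag_of v - frag_of w \<in> TR" using assms(1) by (rule generate.incl)
  then have "frag_of u \<in> TR #>\<^bsub>FA\<^esub> (frag_of v + frag_of w)"
    by (force simp: r_coset_def)
  then have "TR #>\<^bsub>FA\<^esub> (frag_of v + frag_of w) = TR #>\<^bsub>FA\<^esub> frag_of u"
    by (rule F.repr_independence[OF _ vw F.generate_is_subgroup[OF tensor_relations_subset]])
  moreover have "(TR #>\<^bsub>FA\<^esub> frag_of v) \<otimes>\<^bsub>tensor_group G H\<^esub> (TR #>\<^bsub>FA\<^esub> frag_of w) = TR #>\<^bsub>FA\<^esub> (frag_of v + frag_of w)"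
    unfolding tensor_group_eq mult_FactGroup
    using normal.rcos_sum[OF normal_TR, of "frag_of v" "frag_of w"] assms(3,4) by simp
  ultimately show ?thesis by simp
qed

lemma tensor_mult_left:
  assumes "x \<in> carrier G" "y \<in> carrier G" "z \<in> carrier H"
  shows "tensor G H (x \<otimes>\<^bsub>G\<^esub> y) z = tensor G H x z \<otimes>\<^bsub>tensor_group G H\<^esub> tensor G H y z"
proof -
  interpret G: comm_group G by (rule G)
  show ?thesis unfolding tensor_def
    by (rule tensor_sum_eqI) (use assms in \<open>auto simp: tensor_relations_def\<close>)
qed

lemma tensor_mult_right:
  assumes "x \<in> carrier G" "y \<in> carrier H" "z \<in> carrier H"
  shows "tensor G H x (y \<otimes>\<^bsub>H\<^esub> z) = tensor G H x y \<otimes>\<^bsub>tensor_group G H\<^esub> tensor G H x z"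
proof -
  interpret H: comm_group H by (rule H)
  show ?thesis unfolding tensor_def
    by (rule tensor_sum_eqI) (use assms in \<open>auto simp: tensor_relations_def\<close>)
qed

text \<open>Composed with the quotient map, both homomorphisms live on the free Abelian group, whose
  generators map to the pure tensors.\<close>

lemma tensor_hom_eqI:
  assumes K: "group K" and \<mu>: "\<mu> \<in> hom (tensor_group G H) K" and \<nu>: "\<nu> \<in> hom (tensor_group G H) K"
    and eq: "\<And>x y. x \<in> carrier G \<Longrightarrow> y \<in> carrier H \<Longrightarrow> \<mu> (tensor G H x y) = \<nu> (tensor G H x y)"
    and X: "X \<in> carrier (tensor_group G H)"
  shows "\<mu> X = \<nu> X"
proof -
  have q: "(\<lambda>c. TR #>\<^bsub>FA\<^esub> c) \<in> hom FA (tensor_group G H)"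
    unfolding tensor_group_eq by (rule normal.r_coset_hom_Mod[OF normal_TR])
  have gh: "group_hom FA K (\<lambda>c. \<kappa> (TR #>\<^bsub>FA\<^esub> c))" if "\<kappa> \<in> hom (tensor_group G H) K" for \<kappa>
    using hom_compose[OF q that] K
    by (simp add: group_hom_def group_hom_axioms_def comp_def)
  interpret \<mu>: group_hom FA K "\<lambda>c. \<mu> (TR #>\<^bsub>FA\<^esub> c)" by (rule gh[OF \<mu>])
  interpret \<nu>: group_hom FA K "\<lambda>c. \<nu> (TR #>\<^bsub>FA\<^esub> c)" by (rule gh[OF \<nu>])
  obtain c where c: "Poly_Mapping.keys c \<subseteq> carrier G \<times> carrier H" "X = TR #>\<^bsub>FA\<^esub> c"
    using X unfolding tensor_group_eq carrier_FactGroup by auto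
  have "\<mu> (TR #>\<^bsub>FA\<^esub> c) = \<nu> (TR #>\<^bsub>FA\<^esub> c)"
    using c(1)
  proof (induction c rule: free_Abelian_group_induct[consumes 1, case_names zero diff single])
    case zero
    show ?case using \<mu>.hom_one \<nu>.hom_one by simp
  next
    case (diff x y)
    have "x - y = x \<otimes>\<^bsub>FA\<^esub> inv\<^bsub>FA\<^esub> y" using diff by simp
    then show ?case
      using diff \<mu>.hom_mult[of x "inv\<^bsub>FA\<^esub> y"] \<nu>.hom_mult[of x "inv\<^bsub>FA\<^esub> y"]
        \<mu>.hom_inv[of y] \<nu>.hom_inv[of y] by simp
  next
    case (single a)
    then show ?case using eq[of "fst a" "snd a"] by (auto simp: tensor_def)
  qed
  then show ?thesis using c(2) by simp
qed

text \<open>The extension of \<beta> to the free Abelian group kills the bilinearity relations and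
  so factors through the quotient.\<close>

lemma tensor_universal:
  assumes K: "comm_group K"
    and closed: "\<And>x y. x \<in> carrier G \<Longrightarrow> y \<in> carrier H \<Longrightarrow> \<beta> x y \<in> carrier K"
    and left: "\<And>x y z. x \<in> carrier G \<Longrightarrow> y \<in> carrier G \<Longrightarrow> z \<in> carrier H \<Longrightarrow>
      \<beta> (x \<otimes>\<^bsub>G\<^esub> y) z = \<beta> x z \<otimes>\<^bsub>K\<^esub> \<beta> y z"
    and right: "\<And>x y z. x \<in> carrier G \<Longrightarrow> y \<in> carrier H \<Longrightarrow> z \<in> carrier H \<Longrightarrow>
      \<beta> x (y \<otimes>\<^bsub>H\<^esub> z) = \<beta> x y \<otimes>\<^bsub>K\<^esub> \<beta> x z"
  obtains \<mu> where "\<mu> \<in> hom (tensor_group G H) K"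
    "\<And>x y. x \<in> carrier G \<Longrightarrow> y \<in> carrier H \<Longrightarrow> \<mu> (tensor G H x y) = \<beta> x y"
proof -
  interpret G: comm_group G by (rule G)
  interpret H: comm_group H by (rule H)
  interpret K: comm_group K by fact
  interpret F: comm_group FA by (rule abelian_free_Abelian_group)
  have "(\<lambda>(x, y). \<beta> x y) ` (carrier G \<times> carrier H) \<subseteq> carrier K" using closed by auto
  then obtain h where h: "h \<in> hom FA K" "\<And>u. u \<in> carrier G \<times> carrier H \<Longrightarrow> h (frag_of u) = (\<lambda>(x, y). \<beta> x y) u"
    using K.free_Abelian_group_universal by metis
  interpret h: group_hom FA K h by unfold_locales (rule h(1))
  have rel: "h (frag_of u - frag_of v - frag_of w) = \<one>\<^bsub>K\<^esub>"
    if uvw: "u \<in> carrier G \<times> carrier H" "v \<in> carrier G \<times> carrier H" "w \<in> carrier G \<times> carrier H"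
      and eq: "(\<lambda>(x, y). \<beta> x y) u = (\<lambda>(x, y). \<beta> x y) v \<otimes>\<^bsub>K\<^esub> (\<lambda>(x, y). \<beta> x y) w" for u v w
  proof -
    have F: "frag_of u \<in> carrier FA" "frag_of v \<in> carrier FA" "frag_of w \<in> carrier FA"
      using uvw by simp_all
    have c: "h (frag_of v) \<in> carrier K" "h (frag_of w) \<in> carrier K" by (intro h.hom_closed F)+
    have "frag_of u - frag_of v - frag_of w = (frag_of u \<otimes>\<^bsub>FA\<^esub> inv\<^bsub>FA\<^esub> frag_of v) \<otimes>\<^bsub>FA\<^esub> inv\<^bsub>FA\<^esub> frag_of w"
      using uvw by simp
    also have "h \<dots> = (h (frag_of u) \<otimes>\<^bsub>K\<^esub> inv\<^bsub>K\<^esub> h (frag_of v)) \<otimes>\<^bsub>K\<^esub> inv\<^bsub>K\<^esub> h (frag_of w)"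
      by (simp only: h.hom_mult h.hom_inv F.m_closed F.inv_closed F)
    \<comment> \<open>The factors are swapped so that the two inverses cancel from the inside
      outwards.\<close>
    also have "h (frag_of u) = h (frag_of w) \<otimes>\<^bsub>K\<^esub> h (frag_of v)"
      using h(2)[OF uvw(1)] h(2)[OF uvw(2)] h(2)[OF uvw(3)] eq c K.m_comm by simp
    finally show ?thesis using c by (simp add: K.m_assoc)
  qed
  have "tensor_relations G H \<subseteq> kernel FA K h"
  proof
    fix t assume t: "t \<in> tensor_relations G H"
    then have "h t = \<one>\<^bsub>K\<^esub>"
      unfolding tensor_relations_def using left right by (auto intro!: rel)
    then show "t \<in> kernel FA K h"
      using subsetD[OF tensor_relations_subset t] by (simp add: kernel_def)
  qed
  then have "TR \<subseteq> kernel FA K h"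
    by (rule F.generate_subgroup_incl[OF _ h.subgroup_kernel])
  then obtain \<mu> where \<mu>: "\<mu> \<in> hom (FA Mod TR) K" "\<And>c. c \<in> carrier FA \<Longrightarrow> \<mu> (TR #>\<^bsub>FA\<^esub> c) = h c"
    using h.FactGroup_universal_kernel[OF normal_TR] by metis
  show thesis
  proof
    show "\<mu> \<in> hom (tensor_group G H) K" using \<mu>(1) by (simp only: tensor_group_eq)
    show "\<mu> (tensor G H x y) = \<beta> x y" if "x \<in> carrier G" "y \<in> carrier H" for x y
      unfolding tensor_def using \<mu>(2)[of "frag_of (x, y)"] h(2)[of "(x, y)"] that by simp
  qed
qed

end

text \<open>\<open>M\<close> and \<open>Mult G\<close> are compared through their coordinates in a
  common space. Closure of \<open>B\<close> is what makes injectivity of \<open>g\<close> applicable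
  to a product.\<close>

lemma iso_if_same_image:
  assumes f: "f \<in> hom A V" "inj_on f (carrier A)" and g: "g \<in> hom B V" "inj_on g (carrier B)"
    and im: "f ` carrier A = g ` carrier B"
    and closed: "\<And>x y. x \<in> carrier B \<Longrightarrow> y \<in> carrier B \<Longrightarrow> x \<otimes>\<^bsub>B\<^esub> y \<in> carrier B"
  shows "A \<cong> B"
proof -
  define h where "h x = inv_into (carrier B) g (f x)" for x
  have h: "h x \<in> carrier B" "g (h x) = f x" if "x \<in> carrier A" for x
  proof -
    have "f x \<in> g ` carrier B" using that im by auto
    then show "h x \<in> carrier B" "g (h x) = f x" unfolding h_def by (rule inv_into_into, rule f_inv_into_f)
  qed
  have heq: "h x = y" if "x \<in> carrier A" "y \<in> carrier B" "f x = g y" for x y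
    using h[OF that(1)] g(2) that by (auto simp: inj_on_def)
  have "h \<in> hom A B"
  proof (rule homI)
    fix x y assume xy: "x \<in> carrier A" "y \<in> carrier A"
    then have xyB: "h x \<otimes>\<^bsub>B\<^esub> h y \<in> carrier B" using h closed by simp
    have "g (h x \<otimes>\<^bsub>B\<^esub> h y) = f x \<otimes>\<^bsub>V\<^esub> f y" using h xy g(1) by (simp add: hom_def)
    moreover have "f (x \<otimes>\<^bsub>A\<^esub> y) = f x \<otimes>\<^bsub>V\<^esub> f y" using xy f(1) by (simp add: hom_def)
    ultimately have fg: "f (x \<otimes>\<^bsub>A\<^esub> y) = g (h x \<otimes>\<^bsub>B\<^esub> h y)" by simp
    then have "inv_into (carrier B) g (f (x \<otimes>\<^bsub>A\<^esub> y)) = h x \<otimes>\<^bsub>B\<^esub> h y"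
      by (simp add: inv_into_f_f[OF g(2) xyB])
    then show "h (x \<otimes>\<^bsub>A\<^esub> y) = h x \<otimes>\<^bsub>B\<^esub> h y" by (simp add: h_def)
  qed (rule h(1))
  moreover have "inj_on h (carrier A)"
  proof (rule inj_onI)
    fix x y assume "x \<in> carrier A" "y \<in> carrier A" "h x = h y"
    then have "f x = f y" using h(2) by metis
    then show "x = y" by (rule inj_onD[OF f(2)]) fact+
  qed
  moreover have "h ` carrier A = carrier B"
  proof
    show "h ` carrier A \<subseteq> carrier B" using h(1) by auto
    show "carrier B \<subseteq> h ` carrier A"
    proof
      fix y assume y: "y \<in> carrier B"
      then obtain x where x: "x \<in> carrier A" "f x = g y" using im by (metis imageE imageI)
      then show "y \<in> h ` carrier A" using heq[OF x(1) y x(2)] by auto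
    qed
  qed
  ultimately have "h \<in> iso A B" by (simp add: iso_def bij_betw_def)
  then show ?thesis by (auto simp: is_iso_def)
qed

text \<open>
  Replacing the numerators \<open>m i\<close> by inverses modulo the denominators yields the group whose
  multiplications form the given one.
\<close>

locale dual_frames = rigid_frame n R "\<lambda>i. of_int (m i) / of_int (N i)"
  for n and R and m N :: "nat \<Rightarrow> int" +
  fixes m' :: "nat \<Rightarrow> int"
  assumes N_pos: "i < n \<Longrightarrow> N i > 0" and m_m': "i < n \<Longrightarrow> N i dvd m i * m' i - 1"
begin

abbreviation "d \<equiv> \<lambda>i. (of_int (m i) / of_int (N i) :: rat)"
abbreviation "d' \<equiv> \<lambda>i. (of_int (m' i) / of_int (N i) :: rat)"

lemma
  assumes "i < n"
  shows coprime_m: "coprime (m i) (N i)" and coprime_m': "coprime (m' i) (N i)"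
proof -
  from m_m'[OF assms] obtain q where "m i * m' i - 1 = N i * q" by blast
  then have "m i * m' i + N i * (- q) = 1" "m' i * m i + N i * (- q) = 1" by (simp_all add: algebra_simps)
  then show "coprime (m i) (N i)" "coprime (m' i) (N i)" by (metis coprimeI dvd_add dvd_mult2)+
qed

text \<open>Multiplying the congruence of \<open>t m'\<close> and \<open>s\<close> modulo
  \<open>N\<close> by \<open>m\<close> exchanges \<open>m'\<close> on one side for \<open>m\<close>
  on the other, because \<open>m m'\<close> is 1 plus a multiple of \<open>N\<close>.\<close>

lemma cancel_m':
  assumes i: "i < n" and s: "s \<in> R i" "t \<in> R i" "(t * of_int (m' i) - s) / of_int (N i) \<in> R i"
  shows "(t - s * of_int (m i)) / of_int (N i) \<in> R i"
proof -
  obtain q where q: "m i * m' i - 1 = N i * q" using m_m'[OF i] by blast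
  then have "(of_int (m i * m' i - 1) :: rat) = of_int (N i * q)" by simp
  then have q': "of_int (m i) * of_int (m' i) = 1 + of_int (N i) * (of_int q :: rat)" by simp
  have "of_int (m i) * ((t * of_int (m' i) - s) / of_int (N i)) - of_int q * t \<in> R i"
    by (intro add_subgroup_diff[OF add_subgroup_R[OF i]] add_subgroup_of_int_mult[OF add_subgroup_R[OF i]] s)
  also have "of_int (m i) * ((t * of_int (m' i) - s) / of_int (N i)) - of_int q * t
      = (t * (of_int (m i) * of_int (m' i)) - s * of_int (m i) - of_int (N i) * of_int q * t) / of_int (N i)"
    using N_pos[OF i] by (simp add: field_simps)
  also have "\<dots> = (t - s * of_int (m i)) / of_int (N i)"
    unfolding q' by (simp add: algebra_simps)
  finally show ?thesis .
qed

end

text \<open>Both numerators are prime to \<open>N j\<close>, so membership of the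
  \<open>k\<close>-th multiple of either fraction in \<open>R j\<close> means that
  \<open>k / N j\<close> lies in \<open>R j\<close>. Purity of the dual frame is therefore the
  purity of the original one.\<close>

sublocale dual_frames \<subseteq> dual: rigid_frame n R "\<lambda>i. of_int (m' i) / of_int (N i)"
proof
  fix i k assume i: "i < n" and k: "\<And>j. j < n \<Longrightarrow> j \<noteq> i \<Longrightarrow> of_int k * d' j \<in> R j"
  have conv: "of_int k * d' j \<in> R j \<longleftrightarrow> of_int k * d j \<in> R j" if j: "j < n" for j
  proof -
    have zk: "0 \<in> R j" "of_int k \<in> R j" "- of_int k \<in> R j"
      using rat_subring_of_int[OF ring[OF j], of k] zero_R[OF j] add_subgroup_minus[OF add_subgroup_R[OF j]] by auto
    have Nj: "N j > 0" by (rule N_pos[OF j])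
    show ?thesis
    proof
      assume a: "of_int k * d' j \<in> R j"
      have cp: "coprime (m' j) (N j)" by (rule coprime_m'[OF j])
      have "of_int k / of_int (N j) \<in> R j"
        by (rule add_subgroup_coprime[OF add_subgroup_R[OF j] cp]) (use a zk Nj in \<open>simp_all add: mult.commute\<close>)
      then have "of_int (m j) * (of_int k / of_int (N j)) \<in> R j"
        by (rule add_subgroup_of_int_mult[OF add_subgroup_R[OF j]])
      then show "of_int k * d j \<in> R j" by (simp add: mult.commute)
    next
      assume a: "of_int k * d j \<in> R j"
      have cp: "coprime (m j) (N j)" by (rule coprime_m[OF j])
      have "of_int k / of_int (N j) \<in> R j"
        by (rule add_subgroup_coprime[OF add_subgroup_R[OF j] cp]) (use a zk Nj in \<open>simp_all add: mult.commute\<close>)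
      then have "of_int (m' j) * (of_int k / of_int (N j)) \<in> R j"
        by (rule add_subgroup_of_int_mult[OF add_subgroup_R[OF j]])
      then show "of_int k * d' j \<in> R j" by (simp add: mult.commute)
    qed
  qed
  show "of_int k * d' i \<in> R i"
    using pure[OF i, of k] k conv i by blast
qed (use ring incomparable in blast)+

section \<open>Multiplications of the dual group in coordinates\<close>

context dual_frames
begin

text \<open>With one argument frozen, \<beta> is an endomorphism, hence diagonal; this is applied to
  each argument in turn.\<close>

lemma bilinear_diagonal:
  assumes closed: "\<And>x y. x \<in> dual.E \<Longrightarrow> y \<in> dual.E \<Longrightarrow> \<beta> x y \<in> dual.E"
    and left: "\<And>x y z. x \<in> dual.E \<Longrightarrow> y \<in> dual.E \<Longrightarrow> z \<in> dual.E \<Longrightarrow> \<beta> (x + y) z = \<beta> x z + \<beta> y z"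
    and right: "\<And>x y z. x \<in> dual.E \<Longrightarrow> y \<in> dual.E \<Longrightarrow> z \<in> dual.E \<Longrightarrow> \<beta> x (y + z) = \<beta> x y + \<beta> x z"
    and xy: "x \<in> dual.E" "y \<in> dual.E" and l: "l < n"
  shows "\<beta> x y l = x l * y l * \<beta> (axis l 1) (axis l 1) l"
proof -
  have "(\<lambda>x. \<beta> x y) \<in> hom (additive_group dual.E) (additive_group dual.E)"
    using closed left xy by (simp add: hom_def)
  from dual.endomorphism_diagonal[OF this xy(1) l] have "\<beta> x y l = x l * \<beta> (axis l 1) y l" .
  moreover have "\<beta> (axis l 1) \<in> hom (additive_group dual.E) (additive_group dual.E)"
    using closed right dual.axis_one_mem_E[OF l] by (simp add: hom_def)
  from dual.endomorphism_diagonal[OF this xy(2) l]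
  have "\<beta> (axis l 1) y l = y l * \<beta> (axis l 1) (axis l 1) l" .
  ultimately show ?thesis by simp
qed

text \<open>Of the two factors \<open>N i\<close>, one is removed by multiplying with the basis
  vectors, which gives \<open>t i\<close> in \<open>R i\<close>; the other by squaring
  \<open>dual.dvec\<close>, which fixes \<open>t i / N i\<close> modulo \<open>R i\<close>.\<close>

lemma bilinear_coefficients:
  assumes closed: "\<And>x y. x \<in> dual.E \<Longrightarrow> y \<in> dual.E \<Longrightarrow> \<beta> x y \<in> dual.E"
    and diag: "\<And>x y l. x \<in> dual.E \<Longrightarrow> y \<in> dual.E \<Longrightarrow> l < n \<Longrightarrow> \<beta> x y l = x l * y l * a l"
  shows "(\<lambda>i. if i < n then a i / of_int (N i) ^ 2 else 0) \<in> E"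
proof -
  define t where "t i = a i / of_int (N i)" for i
  have tR: "t i \<in> R i" if i: "i < n" for i
  proof -
    have supp: "\<beta> x y l = 0" if "x \<in> dual.E" "y \<in> dual.E" "l \<ge> n" for x y l
      using dual.E_support[OF closed] that by blast
    have axisE: "axis i 1 \<in> dual.E" by (rule dual.axis_one_mem_E[OF i])
    \<comment> \<open>A product with a basis vector lies on the \<open>i\<close>-th axis, where
      purity leaves only \<open>R i\<close>.\<close>
    have *: "x i * a i \<in> R i" if x: "x \<in> dual.E" for x
    proof -
      have "\<beta> x (axis i 1) = axis i (x i * a i)"
      proof
        fix l show "\<beta> x (axis i 1) l = axis i (x i * a i) l"
          using supp[OF x axisE, of l] diag[OF x axisE, of l] i
          by (cases "l < n"; cases "l = i") auto
      qed
      then show ?thesis using closed[OF x axisE] dual.axis_mem_E_iff[OF i] by simp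
    qed
    \<comment> \<open>The instances \<open>dual.dvec\<close> and \<open>axis i 1\<close> give two
      coprime multiples of \<open>t i\<close>.\<close>
    have "of_int (m' i) * t i \<in> R i"
      using *[OF dual.dvec_mem_E] i by (simp add: t_def dual.dvec_def mult.commute)
    moreover have "of_int (N i) * t i \<in> R i"
      using *[OF axisE] N_pos[OF i] by (simp add: t_def)
    ultimately show ?thesis
      by (rule add_subgroup_coprime[OF add_subgroup_R[OF i] coprime_m'[OF i]])
  qed
  \<comment> \<open>This square supplies one \<open>k\<close> for all coordinates; the same
    \<open>k\<close> will witness that the coefficient vector lies in \<open>E\<close>.\<close>
  have "\<beta> dual.dvec dual.dvec \<in> dual.E" by (intro closed dual.dvec_mem_E)
  then obtain k :: int where k: "\<And>i. i < n \<Longrightarrow> \<beta> dual.dvec dual.dvec i - of_int k * d' i \<in> R i"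
    by (auto simp: cyclic_ext_def)
  have "a i / of_int (N i) ^ 2 - of_int k * d i \<in> R i" if i: "i < n" for i
  proof -
    have Ni: "N i > 0" by (rule N_pos[OF i])
    let ?s = "(t i * of_int (m' i) - of_int k) / of_int (N i)"
    have kR: "of_int k \<in> R i" by (rule rat_subring_of_int[OF ring[OF i]])
    have "d' i * d' i * a i - of_int k * d' i \<in> R i"
      using k[OF i] diag[OF dual.dvec_mem_E dual.dvec_mem_E i] i by (simp add: dual.dvec_def)
    also have "d' i * d' i * a i - of_int k * d' i = of_int (m' i) * ?s"
      using Ni by (simp add: t_def field_simps)
    finally have 1: "of_int (m' i) * ?s \<in> R i" .
    have "of_int (m' i) * t i - of_int k \<in> R i"
      by (intro add_subgroup_diff[OF add_subgroup_R[OF i]] add_subgroup_of_int_mult[OF add_subgroup_R[OF i]] tR kR i)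
    then have 2: "of_int (N i) * ?s \<in> R i" using Ni by (simp add: mult.commute)
    have "?s \<in> R i" by (rule add_subgroup_coprime[OF add_subgroup_R[OF i] coprime_m'[OF i] 1 2])
    then have "(t i - of_int k * of_int (m i)) / of_int (N i) \<in> R i"
      by (rule cancel_m'[OF i kR tR[OF i]])
    also have "(t i - of_int k * of_int (m i)) / of_int (N i) = a i / of_int (N i) ^ 2 - of_int k * d i"
      by (simp add: t_def diff_divide_distrib power2_eq_square)
    finally show ?thesis .
  qed
  then show ?thesis
    unfolding cyclic_ext_def mem_Collect_eq by (intro conjI exI[of _ k]) auto
qed

text \<open>The classes of \<open>b\<close>, \<open>x\<close>, \<open>y\<close> are multiples
  \<open>k\<close>, \<open>K\<close>, \<open>L\<close> of \<open>d\<close>, \<open>d'\<close>,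
  \<open>d'\<close>. The factor \<open>N i ^ 2\<close> leaves the leading term
  \<open>k K L m m' m' / N\<close>, which is congruent to \<open>k K L m' / N\<close>; so the
  product has class \<open>k K L\<close>.\<close>

lemma product_mem_dual_E:
  assumes b: "b \<in> E" and x: "x \<in> dual.E" and y: "y \<in> dual.E"
  shows "(\<lambda>i. of_int (N i) ^ 2 * b i * x i * y i) \<in> dual.E"
proof -
  obtain k :: int where k: "\<And>i. i < n \<Longrightarrow> b i - of_int k * d i \<in> R i" using b by (auto simp: cyclic_ext_def)
  obtain K :: int where K: "\<And>i. i < n \<Longrightarrow> x i - of_int K * d' i \<in> R i" using x by (auto simp: cyclic_ext_def)
  obtain L :: int where L: "\<And>i. i < n \<Longrightarrow> y i - of_int L * d' i \<in> R i" using y by (auto simp: cyclic_ext_def)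
  have "of_int (N i) ^ 2 * b i * x i * y i - of_int (k * K * L) * d' i \<in> R i" if i: "i < n" for i
  proof -
    have Ni: "of_int (N i) \<noteq> (0::rat)" using N_pos[OF i] by simp
    define u where "u = b i - of_int k * d i"
    define r where "r = x i - of_int K * d' i"
    define s where "s = y i - of_int L * d' i"
    obtain q where q: "m i * m' i - 1 = N i * q" using m_m'[OF i] by blast
    then have "(of_int (m i * m' i - 1) :: rat) = of_int (N i * q)" by simp
    then have q': "of_int (m i) * of_int (m' i) = 1 + of_int (N i) * (of_int q :: rat)" by simp
    \<comment> \<open>The embedded integers get atomic names, so that a polynomial identity over the
      rationals remains.\<close>
    define z where "z = (of_int q :: rat)"
    define M where "M = (of_int (m i) :: rat)"
    define M' where "M' = (of_int (m' i) :: rat)"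
    define \<nu> where "\<nu> = (of_int (N i) :: rat)"
    define \<kappa> where "\<kappa> = (of_int k :: rat)"
    define K' where "K' = (of_int K :: rat)"
    define L' where "L' = (of_int L :: rat)"
    have z: "M * M' = 1 + \<nu> * z" using q' by (simp add: M_def M'_def \<nu>_def z_def)
    have \<nu>: "\<nu> \<noteq> 0" using Ni by (simp add: \<nu>_def)
    have bi: "\<nu> * b i = \<kappa> * M + \<nu> * u" and xi: "\<nu> * x i = K' * M' + \<nu> * r" and yi: "\<nu> * y i = L' * M' + \<nu> * s"
      using Ni by (simp_all add: u_def r_def s_def M_def M'_def \<nu>_def \<kappa>_def K'_def L'_def algebra_simps)
    \<comment> \<open>The remainder after the leading term: its first two summands come from
      \<open>u\<close> and from replacing \<open>M * M'\<close>, the last from \<open>r\<close> and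
      \<open>s\<close>. All its ingredients lie in \<open>R i\<close>.\<close>
    let ?w = "K' * L' * u * M' * M' + \<kappa> * K' * L' * M' * z + (\<kappa> * M + \<nu> * u) * (K' * M' * s + L' * M' * r + \<nu> * r * s)"
    have "\<nu> * (\<nu> ^ 2 * b i * x i * y i) = (\<nu> * b i) * (\<nu> * x i) * (\<nu> * y i)"
      by (simp add: power2_eq_square)
    also have "\<dots> = \<kappa> * K' * L' * M' * (M * M') + \<nu> * K' * L' * u * M' * M' + \<nu> * (\<kappa> * M + \<nu> * u) * (K' * M' * s + L' * M' * r + \<nu> * r * s)"
      unfolding bi xi yi by (simp add: algebra_simps)
    also have "\<dots> = \<kappa> * K' * L' * M' + \<nu> * ?w"
      unfolding z by (simp add: algebra_simps)
    finally have "\<nu> ^ 2 * b i * x i * y i = \<kappa> * K' * L' * (M' / \<nu>) + ?w"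
      using \<nu> by (simp add: field_simps)
    then have eq: "of_int (N i) ^ 2 * b i * x i * y i - of_int (k * K * L) * d' i = ?w"
      by (simp add: \<nu>_def M'_def \<kappa>_def K'_def L'_def)
    have mem: "u \<in> R i" "r \<in> R i" "s \<in> R i" "z \<in> R i" "M \<in> R i" "M' \<in> R i" "\<nu> \<in> R i" "\<kappa> \<in> R i" "K' \<in> R i" "L' \<in> R i"
      using k[OF i] K[OF i] L[OF i] rat_subring_of_int[OF ring[OF i]]
      by (simp_all add: u_def r_def s_def z_def M_def M'_def \<nu>_def \<kappa>_def K'_def L'_def)
    show ?thesis unfolding eq
      by (intro add_subgroup_add[OF add_subgroup_R[OF i]] rat_subringD(3)[OF ring[OF i]] mem)
  qed
  moreover have "\<forall>i\<ge>n. of_int (N i) ^ 2 * b i * x i * y i = 0" using b by (simp add: cyclic_ext_def)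
  ultimately show ?thesis unfolding cyclic_ext_def mem_Collect_eq by blast
qed

text \<open>By diagonality a multiplication is determined by the squares of the basis vectors.
  Scaling them by \<open>1 / N i ^ 2\<close> makes the image exactly \<open>E\<close>:
  \<open>bilinear_coefficients\<close> gives one inclusion, \<open>product_mem_dual_E\<close> with
  the universal property the other.\<close>

lemma Mult_embedding:
  obtains \<Phi> where "\<Phi> \<in> hom (Mult (additive_group dual.E)) (additive_group UNIV)"
    "inj_on \<Phi> (carrier (Mult (additive_group dual.E)))"
    "\<Phi> ` carrier (Mult (additive_group dual.E)) = E"
proof -
  let ?G = "additive_group dual.E"
  let ?T = "tensor_group ?G ?G"
  let ?t = "tensor ?G ?G"
  note cG = dual.comm_group_E
  interpret G: comm_group ?G by (rule cG)
  note t_closed = tensor_closed[OF cG cG, unfolded additive_group_simps(1)]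
  note t_left = tensor_mult_left[OF cG cG, unfolded additive_group_simps(1,2)]
  note t_right = tensor_mult_right[OF cG cG, unfolded additive_group_simps(1,2)]
  have carM: "carrier (Mult ?G) = hom ?T ?G \<inter> extensional (carrier ?T)"
    by (simp add: Mult_def hom_group_def)
  have multM: "f \<otimes>\<^bsub>Mult ?G\<^esub> g = (\<lambda>X\<in>carrier ?T. f X + g X)" for f g
    by (simp add: Mult_def hom_group_def)
  define \<Phi> :: "_ \<Rightarrow> nat \<Rightarrow> rat" where
    "\<Phi> \<mu> = (\<lambda>i. if i < n then \<mu> (?t (axis i 1) (axis i 1)) i / of_int (N i) ^ 2 else 0)" for \<mu>
  have diag: "\<mu> (?t x y) l = x l * y l * \<mu> (?t (axis l 1) (axis l 1)) l"
    if \<mu>: "\<mu> \<in> hom ?T ?G" and xy: "x \<in> dual.E" "y \<in> dual.E" and l: "l < n" for \<mu> x y l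
  proof -
    have closed: "\<mu> (?t x y) \<in> dual.E" if "x \<in> dual.E" "y \<in> dual.E" for x y
      using \<mu> t_closed[OF that] by (auto simp: hom_def)
    have add: "\<mu> (X \<otimes>\<^bsub>?T\<^esub> Y) = \<mu> X + \<mu> Y" if "X \<in> carrier ?T" "Y \<in> carrier ?T" for X Y
      using \<mu> that by (simp add: hom_def)
    show "\<mu> (?t x y) l = x l * y l * \<mu> (?t (axis l 1) (axis l 1)) l"
      by (rule bilinear_diagonal[of "\<lambda>x y. \<mu> (?t x y)"])
        (simp_all add: closed t_left t_right add t_closed xy l)
  qed
  have hom: "\<Phi> \<in> hom (Mult ?G) (additive_group UNIV)"
  proof (rule homI)
    fix \<mu> \<nu> assume "\<mu> \<in> carrier (Mult ?G)" "\<nu> \<in> carrier (Mult ?G)"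
    show "\<Phi> (\<mu> \<otimes>\<^bsub>Mult ?G\<^esub> \<nu>) = \<Phi> \<mu> \<otimes>\<^bsub>additive_group UNIV\<^esub> \<Phi> \<nu>"
    proof
      fix i
      have "?t (axis i 1) (axis i 1) \<in> carrier ?T" if "i < n"
        by (intro t_closed dual.axis_one_mem_E that)
      then show "\<Phi> (\<mu> \<otimes>\<^bsub>Mult ?G\<^esub> \<nu>) i = (\<Phi> \<mu> \<otimes>\<^bsub>additive_group UNIV\<^esub> \<Phi> \<nu>) i"
        by (simp add: \<Phi>_def multM add_divide_distrib)
    qed
  qed simp
  have inj: "inj_on \<Phi> (carrier (Mult ?G))"
  proof (rule inj_onI)
    fix \<mu> \<nu> assume "\<mu> \<in> carrier (Mult ?G)" "\<nu> \<in> carrier (Mult ?G)" and eq: "\<Phi> \<mu> = \<Phi> \<nu>"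
    then have \<mu>\<nu>: "\<mu> \<in> hom ?T ?G" "\<nu> \<in> hom ?T ?G" and ext: "\<mu> \<in> extensional (carrier ?T)" "\<nu> \<in> extensional (carrier ?T)"
      by (simp_all add: carM)
    have a: "\<mu> (?t (axis i 1) (axis i 1)) i = \<nu> (?t (axis i 1) (axis i 1)) i" if "i < n" for i
      using fun_cong[OF eq, of i] that N_pos[OF that] by (simp add: \<Phi>_def)
    have "\<mu> (?t x y) = \<nu> (?t x y)" if xy: "x \<in> dual.E" "y \<in> dual.E" for x y
    proof
      fix l
      have E: "\<mu> (?t x y) \<in> dual.E" "\<nu> (?t x y) \<in> dual.E"
        using \<mu>\<nu> t_closed[OF xy] by (auto simp: hom_def)
      show "\<mu> (?t x y) l = \<nu> (?t x y) l"
        using diag[OF \<mu>\<nu>(1) xy] diag[OF \<mu>\<nu>(2) xy] a dual.E_support[OF E(1)] dual.E_support[OF E(2)]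
        by (cases "l < n") simp_all
    qed
    then have "\<mu> X = \<nu> X" if "X \<in> carrier ?T" for X
      using tensor_hom_eqI[OF cG cG G.is_group \<mu>\<nu> _ that] by simp
    then show "\<mu> = \<nu>" by (rule extensionalityI[OF ext])
  qed
  have "\<Phi> \<mu> \<in> E" if "\<mu> \<in> carrier (Mult ?G)" for \<mu>
  proof -
    have \<mu>: "\<mu> \<in> hom ?T ?G" using that by (simp add: carM)
    have closed: "\<mu> (?t x y) \<in> dual.E" if "x \<in> dual.E" "y \<in> dual.E" for x y
      using \<mu> t_closed[OF that] by (auto simp: hom_def)
    show ?thesis
      unfolding \<Phi>_def by (rule bilinear_coefficients[of "\<lambda>x y. \<mu> (?t x y)"]) (simp_all add: closed diag[OF \<mu>])
  qed
  moreover have "b \<in> \<Phi> ` carrier (Mult ?G)" if b: "b \<in> E" for b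
  proof -
    define \<beta> where "\<beta> x y = (\<lambda>i. of_int (N i) ^ 2 * b i * x i * y i)" for x y :: "nat \<Rightarrow> rat"
    obtain \<mu> where \<mu>: "\<mu> \<in> hom ?T ?G" "\<And>x y. x \<in> dual.E \<Longrightarrow> y \<in> dual.E \<Longrightarrow> \<mu> (?t x y) = \<beta> x y"
    proof (rule tensor_universal[OF cG cG cG, of \<beta>, unfolded additive_group_simps(1,2)])
      show "\<beta> x y \<in> dual.E" if "x \<in> dual.E" "y \<in> dual.E" for x y
        unfolding \<beta>_def by (rule product_mem_dual_E[OF b that])
    qed (auto simp: \<beta>_def fun_eq_iff algebra_simps)
    \<comment> \<open>Elements of \<open>hom_group\<close> are extensional, so the map from the
      universal property is cut down to the carrier.\<close>
    define \<nu> where "\<nu> = restrict \<mu> (carrier ?T)"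
    have "\<nu> \<in> hom ?T ?G"
      using \<mu>(1) group.is_monoid[OF group_tensor_group[OF cG cG]]
      by (simp add: hom_def \<nu>_def monoid.m_closed Pi_iff)
    then have "\<nu> \<in> carrier (Mult ?G)" by (simp add: carM \<nu>_def)
    moreover have "\<Phi> \<nu> = b"
    proof
      fix i
      have "\<nu> (?t (axis i 1) (axis i 1)) i = of_int (N i) ^ 2 * b i" if i: "i < n"
        using \<mu>(2)[OF dual.axis_one_mem_E[OF i] dual.axis_one_mem_E[OF i]]
          t_closed[OF dual.axis_one_mem_E[OF i] dual.axis_one_mem_E[OF i]] by (simp add: \<nu>_def \<beta>_def)
      then show "\<Phi> \<nu> i = b i"
        using N_pos[of i] E_support[OF b, of i] by (cases "i < n") (simp_all add: \<Phi>_def)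
    qed
    ultimately show ?thesis by (intro image_eqI[of _ _ \<nu>]) simp_all
  qed
  ultimately have "\<Phi> ` carrier (Mult ?G) = E" by blast
  with hom inj show thesis by (rule that)
qed

lemma Mult_closed:
  assumes f: "f \<in> carrier (Mult (additive_group dual.E))" and g: "g \<in> carrier (Mult (additive_group dual.E))"
  shows "f \<otimes>\<^bsub>Mult (additive_group dual.E)\<^esub> g \<in> carrier (Mult (additive_group dual.E))"
proof -
  let ?G = "additive_group dual.E"
  let ?T = "tensor_group ?G ?G"
  interpret T: group ?T by (rule group_tensor_group[OF dual.comm_group_E dual.comm_group_E])
  have "(\<lambda>X\<in>carrier ?T. f X + g X) \<in> hom ?T ?G"
    using f g add_subgroup_add[OF dual.add_subgroup_E]
    by (auto simp: Mult_def hom_group_def hom_def Pi_iff algebra_simps)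
  then show ?thesis by (simp add: Mult_def hom_group_def)
qed

end

section \<open>Coordinates for an abstract rigid group\<close>

text \<open>The projection onto \<open>B\<close> isolates one term of a relation. The ambient
  \<open>P\<close> is kept apart from \<open>A\<close> because the bound is applied to the rank of
  the whole group and to the rank of a \<open>Reg_part\<close>.\<close>

lemma independent_summands:
  assumes M: "comm_group M" "torsion_free M" and A: "subgroup A M" and P: "subgroup P M"
    and \<pi>: "summand_projections (M\<lparr>carrier := A\<rparr>) D \<pi>" and DA: "\<And>B. B \<in> D \<Longrightarrow> subgroup B M \<and> B \<subseteq> A"
    and T: "finite T" "T \<subseteq> D" and e: "\<And>B. B \<in> T \<Longrightarrow> e B \<in> B \<and> e B \<in> P \<and> e B \<noteq> \<one>\<^bsub>M\<^esub>"
  shows "independent_in (M\<lparr>carrier := P\<rparr>) (e ` T)" "card (e ` T) = card T"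
proof -
  interpret M: comm_group M by (rule M(1))
  note \<pi>D = summand_projectionsD[OF \<pi>, simplified]
  have inj: "inj_on e T"
  proof (rule inj_onI, rule ccontr)
    fix B B' assume B: "B \<in> T" "B' \<in> T" "e B = e B'" "B \<noteq> B'"
    have BD: "B \<in> D" "B' \<in> D" using B(1,2) T(2) by auto
    have "\<pi> B (e B) = e B" "\<pi> B (e B') = \<one>\<^bsub>M\<^esub>"
      using \<pi>D(3)[OF BD(1)] \<pi>D(4)[OF BD B(4)] e[OF B(1)] e[OF B(2)] by simp_all
    then show False using B e by metis
  qed
  then show "card (e ` T) = card T" by (rule card_image)
  have eA: "e B \<in> A" if "B \<in> T" for B using that T(2) DA e by blast
  have ec: "e B \<in> carrier M" if "B \<in> T" for B using subgroup.mem_carrier[OF A eA[OF that]] .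
  have "c (e B) = 0" if eq: "(\<Otimes>\<^bsub>M\<lparr>carrier := P\<rparr>\<^esub>b\<in>e ` T. b [^]\<^bsub>M\<lparr>carrier := P\<rparr>\<^esub> c b) = \<one>\<^bsub>M\<^esub>" and B: "B \<in> T"
    for c :: "'a \<Rightarrow> int" and B
  proof -
    interpret A: comm_group "M\<lparr>carrier := A\<rparr>" by (rule comm_group_subgroup[OF M(1) A])
    interpret P: comm_group "M\<lparr>carrier := P\<rparr>" by (rule comm_group_subgroup[OF M(1) P])
    let ?g = "\<lambda>B. e B [^]\<^bsub>M\<^esub> c (e B)"
    have gB: "?g B' \<in> B'" if "B' \<in> T" for B'
      using M.subgroup_int_pow_closed[of B' "e B'"] DA e that T(2) by blast
    then have gA: "?g B' \<in> A" if "B' \<in> T" for B' using that T(2) DA by blast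
    have gP: "b [^]\<^bsub>M\<lparr>carrier := P\<rparr>\<^esub> c b = b [^]\<^bsub>M\<^esub> c b" "b [^]\<^bsub>M\<^esub> c b \<in> P" if "b \<in> e ` T" for b
    proof -
      have "b \<in> P" using that e by blast
      then show "b [^]\<^bsub>M\<lparr>carrier := P\<rparr>\<^esub> c b = b [^]\<^bsub>M\<^esub> c b" "b [^]\<^bsub>M\<^esub> c b \<in> P"
        by (rule int_pow_subgroup[OF M.is_group P], rule M.subgroup_int_pow_closed[OF P])
    qed
    \<comment> \<open>The relation is given in \<open>P\<close>, while the projections live on
      \<open>A\<close>; it is moved there through \<open>M\<close>, reindexed by summands.\<close>
    have "\<one>\<^bsub>M\<^esub> = (\<Otimes>\<^bsub>M\<lparr>carrier := P\<rparr>\<^esub>b\<in>e ` T. b [^]\<^bsub>M\<^esub> c b)"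
      unfolding eq[symmetric] by (rule P.finprod_cong') (use gP in auto)
    also have "\<dots> = (\<Otimes>\<^bsub>M\<^esub>b\<in>e ` T. b [^]\<^bsub>M\<^esub> c b)"
      by (rule finprod_subgroup[OF M(1) P gP(2)])
    also have "\<dots> = (\<Otimes>\<^bsub>M\<^esub>B\<in>T. ?g B)"
      by (rule M.finprod_reindex[OF _ inj]) (use ec in auto)
    also have "\<dots> = (\<Otimes>\<^bsub>M\<lparr>carrier := A\<rparr>\<^esub>B\<in>T. ?g B)"
      by (rule finprod_subgroup[OF M(1) A gA, symmetric])
    finally have one: "(\<Otimes>\<^bsub>M\<lparr>carrier := A\<rparr>\<^esub>B\<in>T. ?g B) = \<one>\<^bsub>M\<^esub>" by simp
    have BD: "B \<in> D" using B T(2) by blast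
    have "\<one>\<^bsub>M\<^esub> = \<pi> B \<one>\<^bsub>M\<^esub>"
      using \<pi>D(3)[OF BD] subgroup.one_closed DA[OF BD] by metis
    also have "\<dots> = (\<Otimes>\<^bsub>M\<lparr>carrier := A\<rparr>\<^esub>B'\<in>T. \<pi> B (?g B'))"
      unfolding one[symmetric]
      by (rule hom_finprod[OF comm_group_subgroup[OF M(1) A] comm_group_subgroup[OF M(1) A] \<pi>D(1)[OF BD]])
        (use gA in simp)
    also have "\<dots> = (\<Otimes>\<^bsub>M\<lparr>carrier := A\<rparr>\<^esub>B'\<in>T. if B = B' then ?g B' else \<one>\<^bsub>M\<lparr>carrier := A\<rparr>\<^esub>)"
    proof (rule A.finprod_cong')
      fix B' assume B': "B' \<in> T"
      show "\<pi> B (?g B') = (if B = B' then ?g B' else \<one>\<^bsub>M\<lparr>carrier := A\<rparr>\<^esub>)"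
      proof (cases "B = B'")
        case True
        then show ?thesis using \<pi>D(3)[OF BD] gB[OF B] by simp
      next
        case False
        have "B' \<in> D" using B' T(2) by blast
        then show ?thesis using \<pi>D(4)[OF BD _ False gB[OF B']] False by simp
      qed
    qed (use gA A.one_closed in auto)
    also have "\<dots> = ?g B"
      by (rule A.finprod_singleton[OF B T(1)]) (use gA in auto)
    finally have "?g B = \<one>\<^bsub>M\<^esub>" by simp
    then show ?thesis using torsion_free_int_pow[OF M ec[OF B]] e[OF B] by blast
  qed
  then show "independent_in (M\<lparr>carrier := P\<rparr>) (e ` T)"
    unfolding independent_in_def using T(1) e by auto
qed

text \<open>The last conclusion is the usable form of least index: a completely decomposable
  overgroup of the regulator has at most its index, hence the same, and so coincides with
  it.\<close>

lemma class_A0_Reg: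
  assumes "class_A0 M"
  shows "comm_group M" "torsion_free M" "subgroup (Reg M) M" "finite (rcosets\<^bsub>M\<^esub> (Reg M))"
    "rank_one_decomposition (M\<lparr>carrier := Reg M\<rparr>) (Reg_decomposition M)"
    "\<And>K. K \<in> cd_subgroups M \<Longrightarrow> Reg M \<subseteq> K \<Longrightarrow> K = Reg M"
proof -
  show M: "comm_group M" "torsion_free M"
    using assms by (simp_all add: class_A0_def ACD_group_def)
  have ne: "cd_subgroups M \<noteq> {}" and cyc: "cyclic_group (M Mod Reg M)"
    using assms by (simp_all add: class_A0_def ACD_group_def)
  note least = Reg_least_index[OF M(1) ne cyc]
  show sub: "subgroup (Reg M) M" "finite (rcosets\<^bsub>M\<^esub> (Reg M))"
    using least(1) by (auto simp: cd_subgroups_def)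
  have "\<exists>D. rank_one_decomposition (M\<lparr>carrier := Reg M\<rparr>) D"
    using least(1) by (simp add: cd_subgroups_def completely_decomposable_def)
  then show "rank_one_decomposition (M\<lparr>carrier := Reg M\<rparr>) (Reg_decomposition M)"
    unfolding Reg_decomposition_def by (rule someI_ex)
  fix K assume K: "K \<in> cd_subgroups M" "Reg M \<subseteq> K"
  then have sK: "subgroup K M" by (simp add: cd_subgroups_def)
  note idx = group_index_mono[OF M(1) sub(1) sK K(2) sub(2)]
  show "K = Reg M" by (rule idx(3)[OF order_antisym[OF idx(2) least(2)[OF K(1)]], symmetric])
qed

text \<open>Finite rank bounds the number of summands, rank 1 of each \<open>Reg_part\<close>
  separates their types, and block rigidity makes distinct types incomparable.\<close>

lemma rigid_summands:
  assumes A0: "class_A0 M" and rig: "rigid M"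
  defines "D \<equiv> Reg_decomposition M"
  shows "finite D"
    "\<And>B. B \<in> D \<Longrightarrow> subgroup B M \<and> B \<subseteq> Reg M \<and> rank_one_group (M\<lparr>carrier := B\<rparr>)"
    "\<And>B. B \<in> D \<Longrightarrow> idempotent_type (type_of (M\<lparr>carrier := B\<rparr>))"
    "\<And>B B'. B \<in> D \<Longrightarrow> B' \<in> D \<Longrightarrow> type_le (type_of (M\<lparr>carrier := B\<rparr>)) (type_of (M\<lparr>carrier := B'\<rparr>)) \<Longrightarrow> B = B'"
proof -
  note M = class_A0_Reg[OF A0]
  interpret M: comm_group M by (rule M(1))
  note D = M(5)[folded D_def]
  have sub: "subgroup B M \<and> B \<subseteq> Reg M \<and> rank_one_group (M\<lparr>carrier := B\<rparr>)" if B: "B \<in> D" for B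
  proof -
    have 1: "subgroup B (M\<lparr>carrier := Reg M\<rparr>)" "rank_one_group (M\<lparr>carrier := B\<rparr>)"
      using D B by (simp_all add: rank_one_decomposition_def)
    then show ?thesis using M.incl_subgroup[OF M(3) 1(1)] subgroup.subset[OF 1(1)] by simp
  qed
  then show "\<And>B. B \<in> D \<Longrightarrow> subgroup B M \<and> B \<subseteq> Reg M \<and> rank_one_group (M\<lparr>carrier := B\<rparr>)" .
  have "\<exists>x\<in>B. x \<noteq> \<one>\<^bsub>M\<^esub>" if B: "B \<in> D" for B
  proof -
    obtain f where f: "f \<in> hom (M\<lparr>carrier := B\<rparr>) rat_group" and fne: "\<exists>x\<in>B. f x \<noteq> 0"
      using rank_one_group_embedding[of "M\<lparr>carrier := B\<rparr>"] sub[OF B] by (metis partial_object.select_convs(1) partial_object.update_convs(1) partial_object.surjective)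
    interpret f: group_hom "M\<lparr>carrier := B\<rparr>" rat_group f
      by (rule group_hom_additive_group[OF comm_group_subgroup[OF M(1)] f]) (use sub[OF B] in simp)
    obtain x where "x \<in> B" "f x \<noteq> 0" using fne by blast
    moreover from this have "x \<noteq> \<one>\<^bsub>M\<^esub>" using f.hom_one by auto
    ultimately show ?thesis by blast
  qed
  then obtain e where e: "\<And>B. B \<in> D \<Longrightarrow> e B \<in> B \<and> e B \<noteq> \<one>\<^bsub>M\<^esub>" by metis
  obtain \<pi> where \<pi>: "summand_projections (M\<lparr>carrier := Reg M\<rparr>) D \<pi>"
    using rank_one_decomposition_projections[OF comm_group_subgroup[OF M(1,3)] D] by blast
  \<comment> \<open>One nontrivial element from each summand in \<open>T\<close> gives an
    independent set in \<open>P\<close>.\<close>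
  have ind: "card T \<le> r" if "subgroup P M" "finite T" "T \<subseteq> D" "\<And>B. B \<in> T \<Longrightarrow> e B \<in> P" "has_rank (M\<lparr>carrier := P\<rparr>) r" for P T r
  proof -
    have *: "independent_in (M\<lparr>carrier := P\<rparr>) (e ` T)" "card (e ` T) = card T"
      by (rule independent_summands[OF M(1,2,3) that(1) \<pi> _ that(2,3)]; use sub e that in blast)+
    then show ?thesis using that(5) unfolding has_rank_def by metis
  qed
  show "finite D"
  proof (rule ccontr)
    assume inf: "infinite D"
    obtain r where r: "has_rank M r" using A0 by (auto simp: class_A0_def ACD_group_def)
    obtain T where T: "finite T" "T \<subseteq> D" "card T = Suc r"
      using infinite_arbitrarily_large[OF inf] by metis
    have "card T \<le> r"
    proof (rule ind[of "carrier M" T r])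
      show "subgroup (carrier M) M" by (rule M.subgroup_self)
      show "e B \<in> carrier M" if "B \<in> T" for B
        using that T(2) e sub subgroup.mem_carrier by (metis subsetD)
    qed (use T r in simp_all)
    then show False using T(3) by simp
  qed
  let ?\<tau> = "\<lambda>B. type_of (M\<lparr>carrier := B\<rparr>)"
  have part: "subgroup (Reg_part M (?\<tau> B)) M" for B
    unfolding Reg_part_def
    by (rule M.generate_is_subgroup) (use sub subgroup.subset D_def in blast)
  have incl: "B' \<subseteq> Reg_part M (?\<tau> B)" if "B' \<in> D" "?\<tau> B' = ?\<tau> B" for B B'
    unfolding Reg_part_def using that by (auto intro!: generate.incl simp: D_def)
  have crit: "?\<tau> B \<in> critical_types M" if "B \<in> D" for B
    unfolding critical_types_def using incl[OF that refl] e[OF that] by blast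
  then show "\<And>B. B \<in> D \<Longrightarrow> idempotent_type (?\<tau> B)"
    using A0 by (simp add: class_A0_def of_ring_type_def)
  have inj: "B = B'" if B: "B \<in> D" "B' \<in> D" and eq: "?\<tau> B' = ?\<tau> B" for B B'
  proof (rule ccontr)
    assume "B \<noteq> B'"
    \<comment> \<open>Two summands of equal type would put two independent elements into this
      part.\<close>
    have "has_rank (M\<lparr>carrier := Reg_part M (?\<tau> B)\<rparr>) 1" using rig crit[OF B(1)] by (simp add: rigid_def)
    then have "card {B, B'} \<le> 1"
      by (rule ind[OF part, rotated 3]) (use B e incl[OF B(1) refl] incl[OF B(2) eq] in auto)
    then show False using \<open>B \<noteq> B'\<close> by simp
  qed
  fix B B' assume B: "B \<in> D" "B' \<in> D" and le: "type_le (?\<tau> B) (?\<tau> B')"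
  have "block_rigid M" using rig by (simp add: rigid_def)
  then have "?\<tau> B = ?\<tau> B'" using crit[OF B(1)] crit[OF B(2)] le unfolding block_rigid_def by blast
  then show "B = B'" using inj[OF B] by simp
qed

lemma ring_char_mono_type_le:
  assumes "R \<subseteq> S" shows "type_le {\<chi>. char_equiv (ring_char R) \<chi>} {\<chi>. char_equiv (ring_char S) \<chi>}"
  unfolding type_le_def
  by (rule bexI[of _ "ring_char R"], rule bexI[of _ "ring_char S"])
    (use assms in \<open>auto simp: ring_char_def char_equiv_refl\<close>)

text \<open>
  If \<open>pure\<close> failed, enlarging the summands of the regulator to their purifications would give a
  completely decomposable subgroup of smaller index.
\<close>

lemma rigid_coordinates:
  assumes A0: "class_A0 M" and rig: "rigid M"
  obtains n R d F where "rigid_frame n R d" "F \<in> hom M (additive_group UNIV)" "inj_on F (carrier M)"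
    "F ` carrier M = cyclic_ext n R d"
proof -
  note M = class_A0_Reg[OF A0]
  note S = rigid_summands[OF A0 rig]
  interpret M: comm_group M by (rule M(1))
  define D where "D = Reg_decomposition M"
  note S = S[folded D_def]
  let ?A = "M\<lparr>carrier := Reg M\<rparr>"
  have cA: "comm_group ?A" by (rule comm_group_subgroup[OF M(1,3)])
  interpret A: comm_group ?A by (rule cA)
  obtain \<pi> where \<pi>: "summand_projections ?A D \<pi>"
    using rank_one_decomposition_projections[OF cA M(5)[folded D_def]] by blast
  note \<pi> = summand_projectionsD[OF this, simplified]
  have cB: "comm_group (M\<lparr>carrier := B\<rparr>)" if "B \<in> D" for B
    using comm_group_subgroup[OF M(1)] S(2)[OF that] by blast
  have "\<forall>B\<in>D. \<exists>f. f \<in> hom (M\<lparr>carrier := B\<rparr>) rat_group \<and> inj_on f B \<and> rat_subring (f ` B)"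
  proof
    fix B assume B: "B \<in> D"
    have "rank_one_group (M\<lparr>carrier := B\<rparr>)" using S(2)[OF B] by blast
    from rank_one_group_ring_embedding[OF this S(3)[OF B]]
    show "\<exists>f. f \<in> hom (M\<lparr>carrier := B\<rparr>) rat_group \<and> inj_on f B \<and> rat_subring (f ` B)" by auto
  qed
  then obtain f where f: "\<And>B. B \<in> D \<Longrightarrow> f B \<in> hom (M\<lparr>carrier := B\<rparr>) rat_group"
    "\<And>B. B \<in> D \<Longrightarrow> inj_on (f B) B" "\<And>B. B \<in> D \<Longrightarrow> rat_subring (f B ` B)" by metis
  have incB: "B = B'" if B: "B \<in> D" "B' \<in> D" "f B ` B \<subseteq> f B' ` B'" for B B'
  proof (rule S(4)[OF B(1,2)])
    have "type_of (M\<lparr>carrier := B\<rparr>) = {\<chi>. char_equiv (ring_char (f B ` B)) \<chi>}" if "B \<in> D" for B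
      using type_of_ring[OF cB[OF that] f(1)[OF that]] f(2,3)[OF that] by simp
    then show "type_le (type_of (M\<lparr>carrier := B\<rparr>)) (type_of (M\<lparr>carrier := B'\<rparr>))"
      using ring_char_mono_type_le[OF B(3)] B(1,2) by simp
  qed
  define n where "n = card D"
  obtain b where b: "bij_betw b {..<n} D"
    using ex_bij_betw_nat_finite[OF S(1)] unfolding n_def atLeast0LessThan by blast
  have bD: "b i \<in> D" if "i < n" for i using b that by (auto simp: bij_betw_def)
  have binj: "i = j" if "i < n" "j < n" "b i = b j" for i j
    using b that by (auto simp: bij_betw_def inj_on_def)
  define R where "R i = f (b i) ` b i" for i
  have Rring: "rat_subring (R i)" if "i < n" for i unfolding R_def by (rule f(3)[OF bD[OF that]])
  define k where "k = card (rcosets\<^bsub>M\<^esub> (Reg M))"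
  have k: "x [^]\<^bsub>M\<^esub> k \<in> Reg M" if "x \<in> carrier M" for x
    unfolding k_def by (rule finite_index_pow(1)[OF M(1,3,4) that])
  have k0: "k > 0" unfolding k_def by (rule finite_index_pow(2)[OF M(1,3,4) M.one_closed])
  define p where "p i x = f (b i) (\<pi> (b i) x)" for i x
  have p_hom: "p i \<in> hom ?A rat_group" if i: "i < n" for i
  proof (rule homI)
    fix x y assume xy: "x \<in> carrier ?A" "y \<in> carrier ?A"
    have "\<pi> (b i) (x \<otimes>\<^bsub>M\<^esub> y) = \<pi> (b i) x \<otimes>\<^bsub>M\<^esub> \<pi> (b i) y"
      using \<pi>(1)[OF bD[OF i]] xy by (simp add: hom_def)
    then show "p i (x \<otimes>\<^bsub>?A\<^esub> y) = p i x \<otimes>\<^bsub>rat_group\<^esub> p i y"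
      using f(1)[OF bD[OF i]] \<pi>(2)[OF bD[OF i]] xy by (simp add: p_def hom_def)
  qed simp
  \<comment> \<open>The \<open>k\<close>-th multiple of \<open>x\<close> lies in the regulator,
    where coordinates exist; division by \<open>k\<close> makes \<open>F\<close> extend them to all
    of \<open>M\<close>.\<close>
  define F where "F x = (\<lambda>i. if i < n then p i (x [^]\<^bsub>M\<^esub> k) / of_nat k else 0)" for x
  have F_hom: "F \<in> hom M (additive_group UNIV)"
  proof (rule homI)
    fix x y assume xy: "x \<in> carrier M" "y \<in> carrier M"
    have "p i ((x \<otimes>\<^bsub>M\<^esub> y) [^]\<^bsub>M\<^esub> k) = p i (x [^]\<^bsub>M\<^esub> k) + p i (y [^]\<^bsub>M\<^esub> k)" if "i < n" for i
      using p_hom[OF that] k xy by (simp add: M.nat_pow_distrib hom_def)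
    then show "F (x \<otimes>\<^bsub>M\<^esub> y) = F x \<otimes>\<^bsub>additive_group UNIV\<^esub> F y"
      by (auto simp: F_def fun_eq_iff add_divide_distrib)
  qed simp
  interpret F: group_hom M "additive_group UNIV" F by (rule group_hom_additive_group[OF M(1) F_hom])
  have F_Reg: "F x i = p i x" if x: "x \<in> Reg M" and i: "i < n" for x i
    using hom_additive_pow(1)[OF cA p_hom[OF i], of x k] x i k0 by (simp add: F_def nat_pow_subgroup)
  \<comment> \<open>All components of the \<open>k\<close>-th multiple vanish, so that multiple is
    trivial, and \<open>M\<close> is torsion-free.\<close>
  have kernel: "x = \<one>\<^bsub>M\<^esub>" if x: "x \<in> carrier M" and 0: "F x = 0" for x
  proof -
    have "\<pi> B (x [^]\<^bsub>M\<^esub> k) = \<one>\<^bsub>M\<^esub>" if B: "B \<in> D" for B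
    proof -
      obtain i where i: "i < n" "B = b i" using b B by (auto simp: bij_betw_def)
      interpret f: group_hom "M\<lparr>carrier := B\<rparr>" rat_group "f B"
        by (rule group_hom_additive_group[OF cB[OF B] f(1)[OF B]])
      have "f B (\<pi> B (x [^]\<^bsub>M\<^esub> k)) = f B \<one>\<^bsub>M\<^esub>"
        using fun_cong[OF 0, of i] i k0 f.hom_one by (simp add: F_def p_def)
      then show ?thesis
        by (rule inj_onD[OF f(2)[OF B]]) (use \<pi>(2)[OF B k[OF x]] S(2)[OF B] subgroup.one_closed in auto)
    qed
    then have "gfinprod ?A (\<lambda>B. \<pi> B (x [^]\<^bsub>M\<^esub> k)) D = gfinprod ?A (\<lambda>B. \<one>\<^bsub>?A\<^esub>) D"
      by (intro A.gfinprod_cong) (auto simp: simp_implies_def subgroup.one_closed[OF M(3)])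
    also have "\<dots> = \<one>\<^bsub>M\<^esub>" by (simp add: gfinprod_def)
    finally have "x [^]\<^bsub>M\<^esub> k = \<one>\<^bsub>M\<^esub>" using \<pi>(5)[OF k[OF x]] by simp
    then show ?thesis using M(2) x k0 by (simp add: torsion_free_def)
  qed
  have F_inj: "inj_on F (carrier M)"
    using kernel F.inj_on_one_iff by simp
  have F_box: "F ` Reg M = box n R"
  proof
    show "F ` Reg M \<subseteq> box n R"
    proof (rule image_subsetI)
      fix x assume x: "x \<in> Reg M"
      have "F x i \<in> R i" if "i < n" for i
        unfolding F_Reg[OF x that] R_def p_def by (rule imageI) (rule \<pi>(2)[OF bD[OF that] x])
      then show "F x \<in> box n R" by (simp add: box_def F_def)
    qed
    show "box n R \<subseteq> F ` Reg M"
    proof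
      fix y assume y: "y \<in> box n R"
      then have "\<forall>i\<in>{..<n}. \<exists>a. a \<in> b i \<and> y i = f (b i) a" by (auto simp: box_def R_def)
      then obtain a where a: "\<And>i. i < n \<Longrightarrow> a i \<in> b i" "\<And>i. i < n \<Longrightarrow> y i = f (b i) (a i)"
        by (metis lessThan_iff)
      have aA: "a i \<in> carrier ?A" if "i \<in> {..<n}" for i using a(1)[of i] S(2)[OF bD, of i] that by auto
      define x where "x = finprod ?A a {..<n}"
      have x: "x \<in> Reg M" using A.finprod_closed[of a "{..<n}"] aA by (auto simp: x_def)
      have "F x j = y j" if j: "j < n" for j
      proof -
        have "p j x = (\<Sum>i<n. p j (a i))"
          unfolding x_def by (rule hom_finprod_additive[OF cA p_hom[OF j] aA])
        also have "\<dots> = (\<Sum>i<n. if i = j then y j else 0)"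
        proof (rule sum.cong)
          fix i assume i: "i \<in> {..<n}"
          interpret f: group_hom "M\<lparr>carrier := b j\<rparr>" rat_group "f (b j)"
            by (rule group_hom_additive_group[OF cB[OF bD[OF j]] f(1)[OF bD[OF j]]])
          show "p j (a i) = (if i = j then y j else 0)"
          proof (cases "i = j")
            case True
            then show ?thesis using \<pi>(3)[OF bD[OF j] a(1)[OF j]] a(2)[OF j] by (simp add: p_def)
          next
            case False
            then have "b j \<noteq> b i" using binj j i by auto
            then have "\<pi> (b j) (a i) = \<one>\<^bsub>M\<^esub>"
              using \<pi>(4)[OF bD[OF j] bD _ a(1)] i by auto
            then show ?thesis using False f.hom_one by (simp add: p_def)
          qed
        qed simp
        also have "\<dots> = y j" using j by simp
        finally show ?thesis by (simp add: F_Reg[OF x j])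
      qed
      then have "F x = y" using y by (auto simp: fun_eq_iff F_def box_def)
      then show "y \<in> F ` Reg M" using x by blast
    qed
  qed
  have cyc: "cyclic_group (M Mod Reg M)" using A0 by (simp add: class_A0_def)
  obtain g where g: "g \<in> carrier M"
    "\<And>x. x \<in> carrier M \<Longrightarrow> \<exists>r\<in>Reg M. \<exists>j::int. x = r \<otimes>\<^bsub>M\<^esub> g [^]\<^bsub>M\<^esub> j"
    using carrier_eq_cosets_powers[OF M(1,3) cyc] by blast
  have Fg: "(\<lambda>i. if i < n then F g i else 0) = F g" by (auto simp: F_def)
  have RegM: "Reg M \<subseteq> carrier M" using M(3) by (rule subgroup.subset)
  have Fpow: "F (r \<otimes>\<^bsub>M\<^esub> g [^]\<^bsub>M\<^esub> j) = F r + of_int j * F g" if "r \<in> Reg M" for r and j :: int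
    using that RegM g(1) hom_additive_pow(2)[OF M(1) F_hom g(1)] by (auto simp: subset_iff)
  have F_image: "F ` carrier M = cyclic_ext n R (F g)"
  proof
    show "F ` carrier M \<subseteq> cyclic_ext n R (F g)"
    proof (rule image_subsetI)
      fix x assume "x \<in> carrier M"
      then obtain r and j :: int where r: "r \<in> Reg M" "x = r \<otimes>\<^bsub>M\<^esub> g [^]\<^bsub>M\<^esub> j" using g(2) by blast
      have "F r \<in> box n R" using r(1) F_box by blast
      then show "F x \<in> cyclic_ext n R (F g)" unfolding cyclic_ext_iff Fg r(2) Fpow[OF r(1)] by blast
    qed
    show "cyclic_ext n R (F g) \<subseteq> F ` carrier M"
    proof
      fix y assume "y \<in> cyclic_ext n R (F g)"
      then obtain h and j :: int where h: "h \<in> box n R" "y = h + of_int j * F g"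
        unfolding cyclic_ext_iff Fg by blast
      obtain r where r: "r \<in> Reg M" "h = F r" using h(1) F_box by auto
      have yF: "y = F (r \<otimes>\<^bsub>M\<^esub> g [^]\<^bsub>M\<^esub> j)" unfolding h(2) r(2) Fpow[OF r(1)] ..
      show "y \<in> F ` carrier M" unfolding yF by (rule imageI) (use r(1) RegM g(1) in auto)
    qed
  qed
  have FM: "add_subgroup (F ` carrier M)" by (rule add_subgroup_hom_image[OF M(1) F_hom])
  \<comment> \<open>The purification of the \<open>i\<close>-th summand in coordinates: everything
    that the image of \<open>M\<close> has on the \<open>i\<close>-th axis.\<close>
  define S' where "S' i = {s. axis i s \<in> F ` carrier M}" for i
  have S': "add_subgroup (S' i)" for i
    unfolding S'_def add_subgroup_def mem_Collect_eq axis_diff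
    using add_subgroup_zero[OF FM] add_subgroup_diff[OF FM] by (auto simp: axis_eq_0_iff[THEN iffD2])
  have box_FM: "box n R \<subseteq> F ` carrier M" using F_box RegM by blast
  have R_S': "R i \<subseteq> S' i" if "i < n" for i
  proof
    fix r assume "r \<in> R i"
    then have "axis i r \<in> box n R"
      by (rule axis_mem_box[rotated 2]) (use Rring that add_subgroup_zero rat_subringD(1) in blast)+
    then show "r \<in> S' i" using box_FM by (auto simp: S'_def)
  qed
  define K where "K = {x \<in> carrier M. F x \<in> box n S'}"
  have K_sub: "subgroup K M"
    unfolding K_def by (rule add_subgroup_vimage[OF M(1) F_hom add_subgroup_box[OF S']])
  have K_cd: "completely_decomposable (M\<lparr>carrier := K\<rparr>)"
  proof (rule completely_decomposable_box[where F = F and n = n and S = S'])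
    show "comm_group (M\<lparr>carrier := K\<rparr>)" by (rule comm_group_subgroup[OF M(1) K_sub])
    show "F \<in> hom (M\<lparr>carrier := K\<rparr>) (additive_group UNIV)" using F_hom by (auto simp: hom_def K_def)
    show "inj_on F (carrier (M\<lparr>carrier := K\<rparr>))" using F_inj by (auto simp: K_def inj_on_def)
    have "y \<in> F ` carrier M" if y: "y \<in> box n S'" for y
    proof -
      have "(\<Sum>i<n. axis i (y i)) \<in> F ` carrier M"
        by (rule add_subgroup_sum[OF FM]) (use y in \<open>auto simp: box_def S'_def\<close>)
      then show ?thesis using y by (subst (asm) sum_axis) (auto simp: box_def)
    qed
    then show "F ` carrier (M\<lparr>carrier := K\<rparr>) = box n S'" by (auto simp: K_def)
    show "add_subgroup (S' i)" if "i < n" for i by (rule S')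
    show "\<exists>s\<in>S' i. s \<noteq> 0" if "i < n" for i
      using R_S'[OF that] rat_subringD(2)[OF Rring[OF that]] by (intro bexI[of _ 1]) auto
  qed
  have Reg_K: "Reg M \<subseteq> K"
  proof
    fix x assume x: "x \<in> Reg M"
    then have "F x \<in> box n R" using F_box by blast
    then have "F x \<in> box n S'" using R_S' unfolding box_def by blast
    then show "x \<in> K" using x RegM by (auto simp: K_def)
  qed
  have "finite (rcosets\<^bsub>M\<^esub> K)" by (rule group_index_mono(1)[OF M(1,3) K_sub Reg_K M(4)])
  then have "K \<in> cd_subgroups M" using K_sub K_cd by (simp add: cd_subgroups_def)
  \<comment> \<open>Least index of the regulator excludes a proper enlargement; this is the source
    of \<open>pure\<close>.\<close>
  then have K_eq: "K = Reg M" using Reg_K by (rule M(6))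
  have "rigid_frame n R (F g)"
  proof
    show "rat_subring (R i)" if "i < n" for i by (rule Rring[OF that])
    show "i = j" if "i < n" "j < n" "R i \<subseteq> R j" for i j
      using incB[OF bD[OF that(1)] bD[OF that(2)]] that(3) binj[OF that(1,2)] by (simp add: R_def)
    fix i and l :: int assume i: "i < n" and l: "\<And>j. j < n \<Longrightarrow> j \<noteq> i \<Longrightarrow> of_int l * F g j \<in> R j"
    let ?s = "of_int l * F g i"
    \<comment> \<open>By assumption on \<open>l\<close>, the multiple of \<open>F g\<close> differs
      from its \<open>i\<close>-th component by a vector of the box. So that component lies in the
      image of \<open>M\<close>, hence in \<open>K\<close>, which is the regulator.\<close>
    have "of_int l * F g - axis i ?s \<in> box n R"
      unfolding box_def mem_Collect_eq
    proof (intro conjI allI impI)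
      fix j assume "j \<ge> n" then show "(of_int l * F g - axis i ?s) j = 0" using i by (simp add: F_def)
    next
      fix j assume j: "j < n"
      then show "(of_int l * F g - axis i ?s) j \<in> R j"
        using l[OF j] add_subgroup_zero[OF rat_subringD(1)[OF Rring[OF j]]] by (cases "j = i") auto
    qed
    then have v: "of_int l * F g - axis i ?s \<in> F ` carrier M" using box_FM by blast
    have "of_int l * F g \<in> F ` carrier M"
      by (rule add_subgroup_of_int_mult[OF FM]) (use g(1) in blast)
    from add_subgroup_diff[OF FM this v] have ax: "axis i ?s \<in> F ` carrier M" by simp
    then obtain x where x: "x \<in> carrier M" "F x = axis i ?s" by auto
    have "F x \<in> box n S'" unfolding x(2)
      by (rule axis_mem_box) (use i ax add_subgroup_zero[OF S'] in \<open>auto simp: S'_def\<close>)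
    then have "x \<in> Reg M" using x(1) K_eq by (auto simp: K_def)
    then have "axis i ?s \<in> box n R" using F_box x(2) by (metis imageI)
    then have "axis i ?s i \<in> R i" using i by (simp only: box_def mem_Collect_eq)
    then show "?s \<in> R i" by simp
  qed
  then show thesis using F_hom F_inj F_image by (rule that)
qed

lemma modular_inverse_exists:
  fixes u v :: int
  assumes "coprime u v"
  shows "\<exists>w. v dvd u * w - 1"
proof -
  obtain a b where "a * u + b * v = 1"
    using bezout_int[of u v] assms by (auto simp: coprime_iff_gcd_eq_1)
  then have "u * a - 1 = v * (- b)" by (simp add: algebra_simps)
  then show ?thesis by (metis dvd_triv_left)
qed

theorem corollary4p3:
  fixes M :: "('a, 'm) monoid_scheme"
  assumes "class_A0 M" and "rigid M"
  shows "\<exists>G :: (nat \<Rightarrow> rat) monoid. class_A0 G \<and> M \<cong> Mult G"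
proof -
  obtain n R d F where frame: "rigid_frame n R d"
    and F: "F \<in> hom M (additive_group UNIV)" "inj_on F (carrier M)" "F ` carrier M = cyclic_ext n R d"
    using rigid_coordinates[OF assms] by blast
  \<comment> \<open>Lowest terms make each numerator invertible modulo its denominator.\<close>
  have "\<exists>u v :: int. v > 0 \<and> coprime u v \<and> d i = of_int u / of_int v" for i
    using rat_lowest_terms[of "d i"] by metis
  then obtain m N where mN: "\<And>i. N i > 0" "\<And>i. coprime (m i) (N i)" "\<And>i. d i = of_int (m i) / of_int (N i)"
    by metis
  obtain m' where m': "\<And>i. N i dvd m i * m' i - 1"
    using modular_inverse_exists[OF mN(2)] by metis
  have d: "d = (\<lambda>i. of_int (m i) / of_int (N i))" by (rule ext) (rule mN(3))
  interpret dual_frames n R m N m'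
    by (rule dual_frames.intro[OF frame[unfolded d]], rule dual_frames_axioms.intro) (rule mN(1), rule m')
  obtain \<Phi> where \<Phi>: "\<Phi> \<in> hom (Mult (additive_group dual.E)) (additive_group UNIV)"
    "inj_on \<Phi> (carrier (Mult (additive_group dual.E)))"
    "\<Phi> ` carrier (Mult (additive_group dual.E)) = E"
    by (rule Mult_embedding)
  \<comment> \<open>\<open>F\<close> and \<open>\<Phi>\<close> embed the two groups in the same
    rational space with the same image \<open>E\<close>.\<close>
  have iso: "M \<cong> Mult (additive_group dual.E)"
    by (rule iso_if_same_image[OF F(1,2) \<Phi>(1,2)]) (simp_all add: F(3) \<Phi>(3) d Mult_closed)
  show ?thesis
    by (intro exI[of _ "additive_group dual.E"] conjI dual.class_A0_E iso)
qed

end
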